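(* For any odd integer $k\geq 1$ and any strict partition $\xi\in\mathcal{SP}$, $$\mathrm{Ch}_{k}\big(D(\xi)\big)=2\,\mathrm{Ch}^{\mathrm{spin}}_{k}(\xi).$$
   Context: Partitions. A partition of $n\ge 0$ is a finite weakly decreasing sequence $\lambda=(\lambda_1,\dots,\lambda_\ell)$ of positive integers with $|\lambda|:=\lambda_1+\cdots+\lambda_\ell=n$; $\ell(\lambda)=\ell$ is the number of parts. It is identified with its Young diagram, the set of boxes $(x,y)$ of positive integers with $1\le y\le \ell(\lambda)$ and $1\le x\le\lambda_y$ ($x$ = column, $y$ = row). A partition is odd if all its parts are odd, and strict if its parts are pairwise distinct. $\mathcal{P}$, $\mathcal{OP}$, $\mathcal{SP}$ denote the sets of all, odd, strict partitions, and $\mathcal{OP}_n$, $\mathcal{SP}_n$ their subsets of partitions of $n$. $\pi\cup 1^{m}$ denotes $\pi$ with $m$ additional parts equal to $1$. The falling power is $n^{\downarrow k}=n(n-1)\cdots(n-k+1)$. Linear characters. For partitions $\lambda,\sigma$ of $n$, $\chi^\lambda(\sigma)$ is the irreducible character of the symmetric group $\mathfrak{S}_n$ indexed by $\lambda$, evaluated on a permutation of cycle type $\sigma$. For $\pi\in\mathcal{P}$ with $k=|\pi|$ and $\lambda\in\mathcal P$ with $n=|\lambda|$, $\mathrm{Ch}_\pi(\lambda)=n^{\downarrow k}\,\chi^\lambda(\pi\cup1^{n-k})/\chi^\lambda(1^n)$ if $n\ge k$, and $\mathrm{Ch}_\pi(\lambda)=0$ otherwise. Spin characters. Let $p_\pi=\prod_i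 p_{\pi_i}$ be the power-sum symmetric functions and $P_\xi$ ($\xi\in\mathcal{SP}$) Schur's $P$-functions, i.e. the Hall–Littlewood functions $P_\xi(x;t)$ at $t=-1$. For $\pi\in\mathcal{OP}_n$, $\xi\in\mathcal{SP}_n$ the numbers $X^\xi(\pi)$ are defined by $p_\pi=\sum_{\xi\in\mathcal{SP}_n}X^\xi(\pi)P_\xi$. For $\pi\in\mathcal{OP}$ with $k=|\pi|$ and $\xi\in\mathcal{SP}$ with $n=|\xi|$, the normalized spin character is $\mathrm{Ch}^{\mathrm{spin}}_\pi(\xi)=n^{\downarrow k}\,X^\xi(\pi\cup1^{n-k})/X^\xi(1^n)$ if $n\ge k$, and $0$ otherwise. (Equivalently, for $n\ge k$ it equals $n^{\downarrow k}2^{(k-\ell(\pi))/2}\phi^\xi(\pi\cup 1^{n-k})/\phi^\xi(1^n)$, where $\phi^\xi$ is the irreducible spin character of the symmetric group indexed by $\xi$.) One writes $\mathrm{Ch}_k$, $\mathrm{Ch}^{\mathrm{spin}}_k$ for $\pi=(k)$. Double. For $\xi=(\xi_1,\dots,\xi_\ell)\in\mathcal{SP}_n$ its double $D(\xi)$ is the partition of $2n$ whose Young diagram is $$\{(x,y):1\le y\le\ell,\ y+1\le x\le y+\xi_y\}\cup\{(x,y):1\le x\le \ell,\ x\le y\le x+\xi_x-1\},$$ i.e. the partition $(\xi_1,\dots,\xi_\ell\,|\,\xi_1-1,\dots,\xi_\ell-1)$ in Frobenius notation (arms $\xi_i$, legs $\xi_i-1$). For example $D((6,5,2))=(7,7,5,3,2,2)$.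 *)

theory Defs
  imports
    Complex_Main
    "HOL-Library.Function_Algebras"
    "HOL-Library.Multiset"
    "HOL-Library.Poly_Mapping"
    "HOL-Combinatorics.Permutations"
    "HOL-Combinatorics.Orbits"
    "HOL-Computational_Algebra.Fraction_Field"
begin

section \<open>Partitions\<close>

definition is_partition :: "nat list \<Rightarrow> bool" where
  "is_partition \<mu> \<longleftrightarrow> sorted_wrt (\<ge>) \<mu> \<and> (\<forall>m\<in>set \<mu>. 0 < m)"

definition strict_partition :: "nat list \<Rightarrow> bool" where
  "strict_partition \<xi> \<longleftrightarrow> is_partition \<xi> \<and> distinct \<xi>"

definition strict_partitions_of :: "nat \<Rightarrow> nat list set" where
  "strict_partitions_of n = {\<xi>. strict_partition \<xi> \<and> sum_list \<xi> = n}"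

text \<open>Boxes are pairs (column, row), both counted from 1; the list index of a part is counted
  from 0.\<close>

definition diagram :: "nat list \<Rightarrow> (nat \<times> nat) set" where
  "diagram \<mu> = {(x, y). 1 \<le> y \<and> y \<le> length \<mu> \<and> 1 \<le> x \<and> x \<le> \<mu> ! (y - 1)}"

definition double_diagram :: "nat list \<Rightarrow> (nat \<times> nat) set" where
  "double_diagram \<xi> =
     {(x, y). 1 \<le> y \<and> y \<le> length \<xi> \<and> y + 1 \<le> x \<and> x \<le> y + \<xi> ! (y - 1)} \<union>
     {(x, y). 1 \<le> x \<and> x \<le> length \<xi> \<and> x \<le> y \<and> y \<le> x + \<xi> ! (x - 1) - 1}"

definition double :: "nat list \<Rightarrow> nat list" where
  "double \<xi> = (THE \<mu>. is_partition \<mu> \<and> diagram \<mu> = double_diagram \<xi>)"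

section \<open>Irreducible characters of the symmetric group\<close>

text \<open>The trace of a linear endomorphism of a subspace V of a space of complex-valued functions.
  It is meant for finite-dimensional V mapped into itself, where it does not depend on the chosen
  basis.\<close>

interpretation fun_space: vector_space "\<lambda>(a::complex) (f::'a \<Rightarrow> complex) x. a * f x"
  by unfold_locales (auto simp: algebra_simps fun_eq_iff)

definition trace_on :: "('a \<Rightarrow> complex) set \<Rightarrow> (('a \<Rightarrow> complex) \<Rightarrow> 'a \<Rightarrow> complex) \<Rightarrow> complex" where
  "trace_on V f =
     (let B = (SOME B. B \<subseteq> V \<and> fun_space.independent B \<and> fun_space.span B = V)
      in \<Sum>b\<in>B. fun_space.representation B (f b) b)"

text \<open>The symmetric group of degree n consists of the permutations of \<open>{..<n}\<close>. Its complex group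
  algebra is the space of functions supported on these permutations, with convolution as product;
  the delta functions multiply as the permutations compose.\<close>

definition group_algebra :: "nat \<Rightarrow> ((nat \<Rightarrow> nat) \<Rightarrow> complex) set" where
  "group_algebra n = {f. \<forall>p. \<not> p permutes {..<n} \<longrightarrow> f p = 0}"

definition delta :: "(nat \<Rightarrow> nat) \<Rightarrow> (nat \<Rightarrow> nat) \<Rightarrow> complex" where
  "delta s p = (if p = s then 1 else 0)"

definition conv :: "nat \<Rightarrow> ((nat \<Rightarrow> nat) \<Rightarrow> complex) \<Rightarrow> ((nat \<Rightarrow> nat) \<Rightarrow> complex) \<Rightarrow> (nat \<Rightarrow> nat) \<Rightarrow> complex" where
  "conv n f g r = (\<Sum>p | p permutes {..<n}. f p * g (inv p \<circ> r))"

text \<open>The canonical Young tableau: the numbers 0, 1, ... are placed in the boxes of \<open>\<mu>\<close> row by row;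
  \<open>box_of \<mu> i\<close> is the box which contains \<open>i\<close>.\<close>

definition box_of :: "nat list \<Rightarrow> nat \<Rightarrow> nat \<times> nat" where
  "box_of \<mu> i =
     concat (map (\<lambda>y. map (\<lambda>x. (x, y)) [1..<Suc (\<mu> ! (y - 1))]) [1..<Suc (length \<mu>)]) ! i"

definition row_group :: "nat list \<Rightarrow> (nat \<Rightarrow> nat) set" where
  "row_group \<mu> = {p. p permutes {..<sum_list \<mu>} \<and>
     (\<forall>i<sum_list \<mu>. snd (box_of \<mu> (p i)) = snd (box_of \<mu> i))}"

definition column_group :: "nat list \<Rightarrow> (nat \<Rightarrow> nat) set" where
  "column_group \<mu> = {p. p permutes {..<sum_list \<mu>} \<and>
     (\<forall>i<sum_list \<mu>. fst (box_of \<mu> (p i)) = fst (box_of \<mu> i))}"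

definition young_symmetrizer :: "nat list \<Rightarrow> (nat \<Rightarrow> nat) \<Rightarrow> complex" where
  "young_symmetrizer \<mu> =
     conv (sum_list \<mu>)
       (\<Sum>p\<in>row_group \<mu>. delta p)
       (\<Sum>q\<in>column_group \<mu>. (\<lambda>r. of_int (sign q) * delta q r))"

text \<open>The Specht module of \<open>\<mu>\<close>, realized as the left ideal generated by the Young symmetrizer.
  In this convention the one-row partitions give the trivial representations.\<close>

definition specht_module :: "nat list \<Rightarrow> ((nat \<Rightarrow> nat) \<Rightarrow> complex) set" where
  "specht_module \<mu> =
     (\<lambda>f. conv (sum_list \<mu>) f (young_symmetrizer \<mu>)) ` group_algebra (sum_list \<mu>)"

definition cycle_type :: "nat \<Rightarrow> (nat \<Rightarrow> nat) \<Rightarrow> nat multiset" where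
  "cycle_type n p = image_mset card (mset_set (orbit p ` {..<n}))"

text \<open>\<open>irr_character \<mu> \<sigma>\<close> is the value of the irreducible character indexed by \<open>\<mu>\<close> on a
  permutation of cycle type \<open>\<sigma>\<close>.\<close>

definition irr_character :: "nat list \<Rightarrow> nat list \<Rightarrow> complex" where
  "irr_character \<mu> \<sigma> =
     (let n = sum_list \<mu>;
          s = (SOME p. p permutes {..<n} \<and> cycle_type n p = mset \<sigma>)
      in trace_on (specht_module \<mu>) (conv n (delta s)))"

definition falling_power :: "nat \<Rightarrow> nat \<Rightarrow> complex" where
  "falling_power n k = (\<Prod>i<k. of_nat n - of_nat i)"

definition Ch :: "nat list \<Rightarrow> nat list \<Rightarrow> complex" where
  "Ch \<pi> \<mu> =
     (let k = sum_list \<pi>; n = sum_list \<mu>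
      in if k \<le> n
         then falling_power n k * irr_character \<mu> (\<pi> @ replicate (n - k) 1)
                / irr_character \<mu> (replicate n 1)
         else 0)"

section \<open>Spin characters\<close>

definition power_sum :: "nat \<Rightarrow> (nat \<Rightarrow> 'a::field) \<Rightarrow> nat list \<Rightarrow> 'a" where
  "power_sum N x \<pi> = (\<Prod>r\<leftarrow>\<pi>. \<Sum>i<N. x i ^ r)"

text \<open>The Hall-Littlewood polynomial in \<open>x 0, \<dots>, x (N - 1)\<close>,
    \<open>P\<^sub>\<mu>(x; t) = \<Sum>w. w (x\<^sup>\<mu> \<Prod>i,j. (x\<^sub>i - t x\<^sub>j) / (x\<^sub>i - x\<^sub>j))\<close>
  with the product over all \<open>i\<close>, \<open>j\<close> such that \<open>\<mu>\<^sub>i > \<mu>\<^sub>j\<close>, and with \<open>w\<close> running over the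
  permutations of the variables modulo the stabilizer of \<open>\<mu>\<close>, where \<open>\<mu>\<close> is padded with zeros to
  length \<open>N\<close>. The cosets correspond to the rearrangements \<open>a\<close> of \<open>\<mu>\<close>. Unlike the formula that
  divides a sum over all permutations by a polynomial in \<open>t\<close>, this one can be used at \<open>t = -1\<close>.\<close>

definition hall_littlewood_P :: "nat \<Rightarrow> (nat \<Rightarrow> 'a::field) \<Rightarrow> 'a \<Rightarrow> nat list \<Rightarrow> 'a" where
  "hall_littlewood_P N x t \<mu> =
     (if length \<mu> \<le> N then
        \<Sum>a \<in> {(\<lambda>i. if w i < length \<mu> then \<mu> ! w i else 0) | w. w permutes {..<N}}.
          (\<Prod>i<N. x i ^ a i) *
          (\<Prod>(i, j) \<in> {(i, j). i < N \<and> j < N \<and> a j < a i}. (x i - t * x j) / (x i - x j))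
      else 0)"

definition schur_P :: "nat \<Rightarrow> (nat \<Rightarrow> 'a::field) \<Rightarrow> nat list \<Rightarrow> 'a" where
  "schur_P N x \<xi> = hall_littlewood_P N x (-1) \<xi>"

text \<open>The field of rational functions over the complex numbers in countably many indeterminates.\<close>

type_synonym ratfun = "((nat \<Rightarrow>\<^sub>0 nat) \<Rightarrow>\<^sub>0 complex) fract"

definition indet :: "nat \<Rightarrow> ratfun" where
  "indet i = Fract (Poly_Mapping.single (Poly_Mapping.single i 1) 1) 1"

definition const_fun :: "complex \<Rightarrow> ratfun" where
  "const_fun c = Fract (Poly_Mapping.single 0 c) 1"

text \<open>The numbers \<open>X\<^sup>\<xi>(\<pi>)\<close> are the coefficients of the power-sum function of \<open>\<pi>\<close> with respect to
  Schur's P-functions. The ring of symmetric functions is the inverse limit of the rings of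
  symmetric polynomials in N variables, so that an identity of symmetric functions is the family of
  its restrictions to N variables, for all N.\<close>

definition spin_X :: "nat list \<Rightarrow> nat list \<Rightarrow> complex" where
  "spin_X \<xi> \<pi> =
     (THE X. (\<forall>\<zeta>. \<zeta> \<notin> strict_partitions_of (sum_list \<pi>) \<longrightarrow> X \<zeta> = 0) \<and>
        (\<forall>N. power_sum N indet \<pi> =
           (\<Sum>\<zeta>\<in>strict_partitions_of (sum_list \<pi>). const_fun (X \<zeta>) * schur_P N indet \<zeta>))) \<xi>"

definition Ch_spin :: "nat list \<Rightarrow> nat list \<Rightarrow> complex" where
  "Ch_spin \<pi> \<xi> =
     (let k = sum_list \<pi>; n = sum_list \<xi>
      in if k \<le> n
         then falling_power n k * spin_X \<xi> (\<pi> @ replicate (n - k) 1)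
                / spin_X \<xi> (replicate n 1)
         else 0)"

end

theory Submission
  imports Defs "HOL-Computational_Algebra.Polynomial"
begin

text \<open>Both sides are computed as explicit rational functions of the parts of \<open>\<xi>\<close>, and the two functions are
compared. The representation theory enters only through one formula on each side.

On the linear side, write a partition \<open>\<mu>\<close> as the strictly decreasing vector of its beta-numbers
\<open>l i = \<mu>\<^sub>i + N - 1 - i\<close>. By the Frobenius formula, the irreducible character of \<open>\<mu>\<close> at the cycle
type \<open>\<sigma>\<close> is the coefficient of \<open>x\<close> to the power \<open>l\<close> in the product of the power sum of \<open>\<sigma>\<close> and the
Vandermonde determinant; a factor that is independent of \<open>\<sigma>\<close> cancels in the normalized character, so
that the formula is needed only up to such a factor (\<open>irr_character_formula\<close>). It is derived from the
Young symmetrizer. The trace on the Specht module is a sum of the symmetrizer over a conjugacy class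
(\<open>trace_on_left_ideal\<close>). The alternating coefficient functions \<open>char_fn\<close> of permutations satisfy an
orthogonality relation that counts intertwining permutations (\<open>pairing_char_fn\<close>), which expands the
conjugacy sum in these functions. By a triangularity argument over all shapes, only the term of \<open>\<mu>\<close>
survives (\<open>averaged_char_fn_vanishing\<close>). Multiplication by the power sum of one cycle of length \<open>k\<close>
lowers one beta-number by \<open>k\<close>, so the normalized character is a sum over the beta-numbers
(\<open>Ch_formula\<close>):
the sum over \<open>a\<close> of \<open>a! / (a - k)!\<close> times the product of \<open>(a - k - b) / (a - b)\<close> over the other
beta-numbers \<open>b\<close>.

On the spin side, the P-functions are extended to arbitrary sequences of exponents; as such they are
alternating (\<open>seqP_swap\<close>), and there is a Pieri-type rule for the product with an odd power sum
(\<open>power_sum_times_seqP\<close>). After division by the weights of the spin dimension formula, the expansion of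
\<open>p\<^sub>1\<^sup>m\<close> has constant coefficients, and that of \<open>p\<^sub>k p\<^sub>1\<^sup>m\<close> shows the normalized spin character
(\<open>Ch_spin_formula\<close>): a sum over the parts \<open>d \<ge> k\<close>, where \<open>d\<close> is lowered by \<open>k\<close>, and over the pairs of
parts with sum \<open>k\<close>, which are removed.

Finally, the beta-numbers of the double of \<open>\<xi>\<close> are the numbers \<open>N + x\<close> for the parts \<open>x\<close>, and the numbers
below \<open>N\<close> except the numbers \<open>N - x\<close>. In the sum over beta-numbers a part \<open>x \<ge> k\<close> contributes through
\<open>N + x\<close> and through \<open>N - (x - k)\<close>, and the two contributions add up to twice the spin term. A pair of
parts \<open>x + w = k\<close> contributes through \<open>N + x\<close> and \<open>N + w\<close>, again with twice the spin terms as the sum;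
all other terms vanish (\<open>beta_phi_double\<close>).\<close>

section \<open>Identities between rational functions\<close>

lemma lagrange_interpolation:
  fixes a :: "'i \<Rightarrow> 'a::field"
  assumes fin: "finite K" and inj: "inj_on a K" and deg: "degree f < card K"
  shows "f = (\<Sum>i\<in>K. smult (poly f (a i) / (\<Prod>j\<in>K-{i}. a i - a j)) (\<Prod>j\<in>K-{i}. [:- a j, 1:]))"
    (is "f = ?g")
proof (rule poly_eqI_degree)
  show "card (a ` K) > degree f" using deg inj by (simp add: card_image)
  have "degree (\<Prod>j\<in>K-{i}. [:- a j, 1:]) \<le> card K - 1" if "i \<in> K" for i
    using fin that by (intro order.trans[OF degree_prod_sum_le]) auto
  then have "degree ?g \<le> card K - 1"
    by (intro degree_sum_le fin order.trans[OF degree_smult_le])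
  then show "card (a ` K) > degree ?g" using deg inj by (simp add: card_image)
next
  fix x assume "x \<in> a ` K"
  then obtain k where k: "k \<in> K" "x = a k" by auto
  have "poly ?g x = (\<Sum>i\<in>K. poly f (a i) / (\<Prod>j\<in>K-{i}. a i - a j) * (\<Prod>j\<in>K-{i}. a k - a j))"
    by (simp add: poly_sum poly_prod k)
  also have "\<dots> = (\<Sum>i\<in>K. if i = k then poly f (a k) else 0)"
  proof (rule sum.cong[OF refl])
    fix i assume i: "i \<in> K"
    show "poly f (a i) / (\<Prod>j\<in>K-{i}. a i - a j) * (\<Prod>j\<in>K-{i}. a k - a j)
      = (if i = k then poly f (a k) else 0)"
    proof (cases "i = k")
      case True
      have "(\<Prod>j\<in>K-{k}. a k - a j) \<noteq> 0"
        using fin inj k by (auto simp: prod_zero_iff inj_on_def)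
      then show ?thesis using True by simp
    next
      case False
      then have "(\<Prod>j\<in>K-{i}. a k - a j) = 0"
        using fin k by (intro prod_zero) auto
      then show ?thesis using False by simp
    qed
  qed
  also have "\<dots> = poly f (a k)" using fin k by simp
  finally show "poly f x = poly ?g x" using k by simp
qed

lemma coeff_prod_linear:
  fixes a :: "'i \<Rightarrow> 'a::comm_ring_1"
  assumes "finite K"
  shows "coeff (\<Prod>j\<in>K. [:- a j, 1:]) (card K) = 1"
proof -
  have "degree (\<Prod>j\<in>K. [:- a j, 1:]) \<le> card K"
    using assms by (intro order.trans[OF degree_prod_sum_le]) auto
  show ?thesis using assms
  proof (induction K)
    case (insert k K)
    have d: "degree (\<Prod>j\<in>K. [:- a j, 1:]) \<le> card K"
      using insert by (intro order.trans[OF degree_prod_sum_le]) auto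
    show ?case using insert d by (simp add: coeff_eq_0)
  qed simp
qed

text \<open>The left-hand side is the divided difference of \<open>f\<close> at the nodes: compare the leading coefficients in
Lagrange interpolation.\<close>

lemma divided_difference:
  fixes a :: "'i \<Rightarrow> 'a::field"
  assumes fin: "finite K" and inj: "inj_on a K" and deg: "degree f < card K"
  shows "(\<Sum>i\<in>K. poly f (a i) / (\<Prod>j\<in>K-{i}. a i - a j)) = coeff f (card K - 1)"
proof -
  have "coeff f (card K - 1) = (\<Sum>i\<in>K. poly f (a i) / (\<Prod>j\<in>K-{i}. a i - a j)
      * coeff (\<Prod>j\<in>K-{i}. [:- a j, 1:]) (card K - 1))"
    by (subst (1) lagrange_interpolation[OF assms]) (simp only: coeff_sum coeff_smult)
  also have "\<dots> = (\<Sum>i\<in>K. poly f (a i) / (\<Prod>j\<in>K-{i}. a i - a j))"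
  proof (rule sum.cong[OF refl])
    fix i assume "i \<in> K"
    then have "card K - 1 = card (K - {i})" using fin by simp
    then show "poly f (a i) / (\<Prod>j\<in>K-{i}. a i - a j)
      * coeff (\<Prod>j\<in>K-{i}. [:- a j, 1:]) (card K - 1) = poly f (a i) / (\<Prod>j\<in>K-{i}. a i - a j)"
      using fin by (simp only: coeff_prod_linear[OF finite_Diff[OF fin]]) simp
  qed
  finally show ?thesis by simp
qed

text \<open>Expanding the product over \<open>j\<close> groups the terms by the set \<open>K\<close> that consists of \<open>i\<close> and of the indices
where \<open>d\<close> was chosen. For \<open>d i j\<close> proportional to \<open>1 / (a i - a j)\<close> the inner sums become divided
differences, most of which vanish for reasons of degree.\<close>

lemma sum_prod_one_plus:
  fixes c :: "'i \<Rightarrow> 'a::comm_ring_1"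
  assumes fin: "finite I"
  shows "(\<Sum>i\<in>I. c i * (\<Prod>j\<in>I-{i}. 1 + d i j)) =
    (\<Sum>K\<in>Pow I - {{}}. \<Sum>i\<in>K. c i * (\<Prod>j\<in>K-{i}. d i j))"
proof -
  have "(\<Sum>i\<in>I. c i * (\<Prod>j\<in>I-{i}. 1 + d i j))
      = (\<Sum>i\<in>I. \<Sum>J\<in>Pow (I-{i}). c i * (\<Prod>j\<in>J. d i j))"
  proof (rule sum.cong[OF refl])
    fix i assume "i \<in> I"
    have "(\<Prod>j\<in>I-{i}. 1 + d i j) = (\<Prod>j\<in>I-{i}. d i j + 1)" by (simp add: add.commute)
    also have "\<dots> = (\<Sum>J\<in>Pow (I-{i}). \<Prod>j\<in>J. d i j)"
      using fin by (subst prod_add) auto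
    finally show "c i * (\<Prod>j\<in>I-{i}. 1 + d i j) = (\<Sum>J\<in>Pow (I-{i}). c i * (\<Prod>j\<in>J. d i j))"
      by (simp add: sum_distrib_left)
  qed
  also have "\<dots> = (\<Sum>(i,J)\<in>Sigma I (\<lambda>i. Pow (I-{i})). c i * (\<Prod>j\<in>J. d i j))"
    using fin by (intro sum.Sigma) auto
  also have "\<dots> = (\<Sum>(K,i)\<in>Sigma (Pow I - {{}}) (\<lambda>K. K). c i * (\<Prod>j\<in>K-{i}. d i j))"
    by (rule sum.reindex_bij_witness[of _ "\<lambda>(K,i). (i, K-{i})" "\<lambda>(i,J). (insert i J, i)"])
       (auto simp: insert_absorb intro!: arg_cong2[of _ _ _ _ "(*)"] prod.cong)
  also have "\<dots> = (\<Sum>K\<in>Pow I - {{}}. \<Sum>i\<in>K. c i * (\<Prod>j\<in>K-{i}. d i j))"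
    using fin by (intro sum.Sigma[symmetric]) (auto intro: finite_subset)
  finally show ?thesis .
qed

text \<open>The effect of one box on the hook length formula: with \<open>t = 1\<close>, this is the recursion for the number of
standard tableaux in terms of beta-numbers. Only the sets with one or two elements in the expansion
have a nonzero divided difference of the identity polynomial.\<close>

lemma sum_shift_vandermonde:
  fixes a :: "'i \<Rightarrow> 'a::field"
  assumes fin: "finite I" and inj: "inj_on a I"
  shows "(\<Sum>i\<in>I. a i * (\<Prod>j\<in>I-{i}. 1 + (- t) / (a i - a j)))
    = (\<Sum>i\<in>I. a i) - t * of_nat (card I choose 2)"
proof -
  have one: "(\<Sum>i\<in>K. a i * (\<Prod>j\<in>K-{i}. (- t) / (a i - a j)))
     = (if card K = 1 then sum a K else if card K = 2 then - t else 0)" if K: "K \<subseteq> I" "K \<noteq> {}" for K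
  proof -
    have fK: "finite K" using K fin finite_subset by blast
    have iK: "inj_on a K" using inj K inj_on_subset by blast
    show ?thesis
    proof (cases "card K = 1")
      case True
      then obtain x where "K = {x}" by (auto simp: card_1_singleton_iff)
      then show ?thesis by simp
    next
      case False
      then have c2: "card K \<ge> 2" using K fK
        using card_0_eq[of K] by linarith
      have "(\<Sum>i\<in>K. a i * (\<Prod>j\<in>K-{i}. (- t) / (a i - a j)))
         = (- t) ^ (card K - 1) * (\<Sum>i\<in>K. poly [:0,1:] (a i) / (\<Prod>j\<in>K-{i}. a i - a j))"
        unfolding sum_distrib_left using fK
        by (intro sum.cong refl) (simp only: prod_dividef prod_constant card_Diff_singleton poly_pCons, simp)
      also have "\<dots> = (- t) ^ (card K - 1) * coeff [:0,1:] (card K - 1)"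
        using c2 by (subst divided_difference[OF fK iK]) auto
      also have "\<dots> = (if card K = 2 then - t else 0)"
        using c2 by (auto simp: coeff_pCons split: nat.splits)
      finally show ?thesis using False by simp
    qed
  qed
  have P: "Pow I - {{}} = {K. K \<subseteq> I \<and> card K = 1} \<union> ({K. K \<subseteq> I \<and> card K = 2} \<union> {K. K \<subseteq> I \<and> card K > 2})"
  proof -
    have "card K = 1 \<or> card K = 2 \<or> card K > 2" if "K \<subseteq> I" "K \<noteq> {}" for K
      using that fin finite_subset[of K I] card_0_eq[of K] by linarith
    then show ?thesis by auto
  qed
  have fins: "finite {K. K \<subseteq> I \<and> Q K}" for Q using fin by simp
  have s1: "(\<Sum>K | K \<subseteq> I \<and> card K = 1. sum a K) = sum a I"
    by (rule sum.reindex_bij_witness[of _ "\<lambda>i. {i}" "\<lambda>K. the_elem K"])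
       (auto simp: card_1_singleton_iff)
  have "(\<Sum>i\<in>I. a i * (\<Prod>j\<in>I-{i}. 1 + (- t) / (a i - a j)))
    = (\<Sum>K\<in>Pow I - {{}}. if card K = 1 then sum a K else if card K = 2 then - t else 0)"
    unfolding sum_prod_one_plus[OF fin] by (intro sum.cong refl one) auto
  also have "\<dots> = (\<Sum>K | K \<subseteq> I \<and> card K = 1. sum a K) + ((\<Sum>K | K \<subseteq> I \<and> card K = 2. - t) + 0)"
    unfolding P using fins
    by (subst sum.union_disjoint, simp, simp, force, subst sum.union_disjoint, simp, simp, force)
       (auto intro!: arg_cong2[of _ _ _ _ "(+)"] sum.neutral)
  also have "\<dots> = sum a I - t * of_nat (card I choose 2)"
    using n_subsets[OF fin] s1 by simp
  finally show ?thesis .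
qed

text \<open>The analogue for shifted tableaux. With \<open>u i = i (i - 1)\<close> the denominators are the differences
\<open>u i - u b\<close>, and each factor is \<open>1 - 2 b / (u i - u b)\<close>; the factor \<open>i\<close> completes the product of the
numbers \<open>2 b\<close>, so that divided differences of a constant remain, which vanish for more than one node.\<close>

lemma sum_shift_spin:
  fixes I :: "nat set"
  assumes fin: "finite I" and pos: "0 \<notin> I"
  shows "(\<Sum>i\<in>I. of_nat i * (\<Prod>b\<in>I-{i}. (of_nat i - 1 - of_nat b) * (of_nat i + of_nat b) /
            ((of_nat i - 1 + of_nat b) * (of_nat i - of_nat b)))) = (of_nat (\<Sum>I) :: 'a::field_char_0)"
proof -
  define u :: "nat \<Rightarrow> 'a" where "u i = of_nat i * (of_nat i - 1)" for i
  have du: "u i - u b = (of_nat i - 1 + of_nat b) * (of_nat i - of_nat b)" for i b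
    by (simp add: u_def algebra_simps)
  have ne: "u i - u b \<noteq> 0" if "i \<in> I" "b \<in> I" "i \<noteq> b" for i b
  proof -
    have "i + b \<noteq> 1" using that pos by (cases i; cases b) auto
    then have "of_nat i + of_nat b \<noteq> (1::'a)" by (metis of_nat_1 of_nat_add of_nat_eq_iff)
    then have "of_nat i - 1 + of_nat b \<noteq> (0::'a)" by (simp add: algebra_simps)
    then show ?thesis using that by (simp add: du)
  qed
  then have inj: "inj_on u I" by (auto simp: inj_on_def)
  have numer: "(of_nat i - 1 - of_nat b) * (of_nat i + of_nat b) = u i - u b - 2 * of_nat b" for i b
    by (simp add: u_def algebra_simps)
  have "(\<Sum>i\<in>I. of_nat i * (\<Prod>b\<in>I-{i}. (of_nat i - 1 - of_nat b) * (of_nat i + of_nat b) /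
            ((of_nat i - 1 + of_nat b) * (of_nat i - of_nat b))))
      = (\<Sum>i\<in>I. of_nat i * (\<Prod>b\<in>I-{i}. 1 + (- 2 * of_nat b) / (u i - u b)))"
  proof (intro sum.cong arg_cong2[of _ _ _ _ "(*)"] refl prod.cong)
    fix i b assume "i \<in> I" "b \<in> I - {i}"
    then show "(of_nat i - 1 - of_nat b) * (of_nat i + of_nat b) /
            ((of_nat i - 1 + of_nat b) * (of_nat i - of_nat b)) = 1 + (- 2 * of_nat b) / (u i - u b)"
      using ne[of i b] numer[of i b] unfolding du[symmetric] by (simp add: diff_divide_distrib)
  qed
  also have "\<dots> = (\<Sum>K\<in>Pow I - {{}}. \<Sum>i\<in>K. of_nat i * (\<Prod>b\<in>K-{i}. (- 2 * of_nat b) / (u i - u b)))"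
    by (rule sum_prod_one_plus[OF fin])
  also have "\<dots> = (\<Sum>K | K \<subseteq> I \<and> card K = 1. \<Sum>i\<in>K. of_nat i * (\<Prod>b\<in>K-{i}. (- 2 * of_nat b) / (u i - u b)))"
  proof (rule sum.mono_neutral_right)
    show "\<forall>K\<in>Pow I - {{}} - {K. K \<subseteq> I \<and> card K = 1}.
      (\<Sum>i\<in>K. of_nat i * (\<Prod>b\<in>K-{i}. (- 2 * of_nat b) / (u i - u b))) = 0"
    proof
      fix K assume K: "K\<in>Pow I - {{}} - {K. K \<subseteq> I \<and> card K = 1}"
      then have fK: "finite K" using fin finite_subset by blast
      have iK: "inj_on u K" using inj K inj_on_subset by blast
      have c2: "card K \<ge> 2" using K fK
        using card_0_eq[of K] by fastforce
      have "(\<Sum>i\<in>K. of_nat i * (\<Prod>b\<in>K-{i}. (- 2 * of_nat b) / (u i - u b)))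
        = (\<Sum>i\<in>K. (- 2) ^ (card K - 1) * (\<Prod>b\<in>K. of_nat b) * (poly [:1:] (u i) / (\<Prod>b\<in>K-{i}. (u i - u b))))"
        using fK by (intro sum.cong refl) (simp only: prod_dividef prod.distrib prod_constant
            card_Diff_singleton prod.remove poly_pCons, simp)
      also have "\<dots> = (- 2) ^ (card K - 1) * (\<Prod>b\<in>K. of_nat b) * coeff [:1:] (card K - 1)"
        using c2 unfolding sum_distrib_left[symmetric]
        by (subst divided_difference[OF fK iK]) auto
      also have "\<dots> = 0" using c2 by (auto simp: coeff_pCons split: nat.splits)
      finally show "(\<Sum>i\<in>K. of_nat i * (\<Prod>b\<in>K-{i}. (- 2 * of_nat b) / (u i - u b))) = 0" .
    qed
  qed (use fin in auto)
  also have "\<dots> = (\<Sum>i\<in>I. of_nat i)"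
    by (rule sum.reindex_bij_witness[of _ "\<lambda>i. {i}" "\<lambda>K. the_elem K"])
       (auto simp: card_1_singleton_iff)
  finally show ?thesis by simp
qed

section \<open>Schur's P-functions as iterated sums\<close>

text \<open>The factor \<open>(x\<^sub>i - t x\<^sub>j) / (x\<^sub>i - x\<^sub>j)\<close> of the Hall-Littlewood functions at \<open>t = -1\<close>.\<close>

definition tau :: "(nat \<Rightarrow> 'a::field) \<Rightarrow> nat \<Rightarrow> nat \<Rightarrow> 'a" where
  "tau x i j = (x i + x j) / (x i - x j)"

lemma tau_swap: "tau x j i = - tau x i j"
  unfolding tau_def by (metis add.commute minus_diff_eq minus_divide_right)

text \<open>Schur's P-function with the variables indexed by \<open>S\<close>, for an arbitrary sequence of exponents. Admitting
sequences that are not decreasing makes the product with a power sum a sum over simple changes of the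
sequence; the alternating law below brings the result back to strict partitions.\<close>

fun seqP :: "(nat \<Rightarrow> 'a::field) \<Rightarrow> nat set \<Rightarrow> nat list \<Rightarrow> 'a" where
  "seqP x S [] = 1"
| "seqP x S (v # \<alpha>) = (\<Sum>i\<in>S. x i ^ v * (\<Prod>j\<in>S-{i}. tau x i j) * seqP x (S - {i}) \<alpha>)"

lemma seqP_two:
  assumes "finite S"
  shows "seqP x S (u # v # \<alpha>) = (\<Sum>(i,j)\<in>{(i,j). i \<in> S \<and> j \<in> S \<and> i \<noteq> j}. x i ^ u * x j ^ v * tau x i j *
    (\<Prod>l\<in>S-{i}-{j}. tau x i l * tau x j l) * seqP x (S-{i}-{j}) \<alpha>)"
proof -
  have "seqP x S (u # v # \<alpha>) = (\<Sum>i\<in>S. \<Sum>j\<in>S-{i}. x i ^ u * x j ^ v * tau x i j *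
    (\<Prod>l\<in>S-{i}-{j}. tau x i l * tau x j l) * seqP x (S-{i}-{j}) \<alpha>)"
    unfolding seqP.simps sum_distrib_left
  proof (intro sum.cong refl)
    fix i j assume "i \<in> S" "j \<in> S - {i}"
    then have "(\<Prod>l\<in>S-{i}. tau x i l) = tau x i j * (\<Prod>l\<in>S-{i}-{j}. tau x i l)"
      using assms by (intro prod.remove) auto
    then show "x i ^ u * (\<Prod>j\<in>S - {i}. tau x i j) *
        (x j ^ v * (\<Prod>l\<in>S - {i} - {j}. tau x j l) * seqP x (S - {i} - {j}) \<alpha>) =
      x i ^ u * x j ^ v * tau x i j * (\<Prod>l\<in>S - {i} - {j}. tau x i l * tau x j l) *
        seqP x (S - {i} - {j}) \<alpha>"
      by (simp add: prod.distrib mult_ac)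
  qed
  also have "\<dots> = (\<Sum>(i,j)\<in>(SIGMA i:S. S-{i}). x i ^ u * x j ^ v * tau x i j *
    (\<Prod>l\<in>S-{i}-{j}. tau x i l * tau x j l) * seqP x (S-{i}-{j}) \<alpha>)"
    using assms by (intro sum.Sigma) auto
  also have "(SIGMA i:S. S-{i}) = {(i,j). i \<in> S \<and> j \<in> S \<and> i \<noteq> j}" by auto
  finally show ?thesis .
qed

text \<open>The factor \<open>tau x i j\<close> is antisymmetric in the two variables that carry the exponents \<open>u\<close> and \<open>v\<close>.\<close>

lemma seqP_swap_front:
  assumes "finite S"
  shows "seqP x S (u # v # \<alpha>) = - seqP x S (v # u # \<alpha>)"
  unfolding seqP_two[OF assms] sum_negf[symmetric]
proof (rule sum.reindex_bij_witness[of _ prod.swap prod.swap], goal_cases)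
  case (5 a)
  obtain i j where a: "a = (i,j)" by force
  have "S - {j} - {i} = S - {i} - {j}" by auto
  then show ?case unfolding a by (simp add: tau_swap[of x j i] mult_ac)
qed auto

lemma seqP_swap:
  assumes "finite S"
  shows "seqP x S (\<beta> @ u # v # \<alpha>) = - seqP x S (\<beta> @ v # u # \<alpha>)"
  using assms
proof (induction \<beta> arbitrary: S)
  case Nil
  then show ?case using seqP_swap_front by (metis append_Nil)
next
  case (Cons b \<beta>)
  show ?case unfolding append_Cons seqP.simps(2)[of x S b] sum_negf[symmetric]
    by (intro sum.cong refl) (simp add: Cons)
qed

lemma seqP_repeat:
  fixes x :: "nat \<Rightarrow> 'a::field"
  assumes "finite S" "(2::'a) \<noteq> 0"
  shows "seqP x S (\<beta> @ u # \<gamma> @ u # \<alpha>) = 0"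
proof (induction \<gamma> arbitrary: \<beta>)
  case Nil
  have "seqP x S (\<beta> @ u # u # \<alpha>) = - seqP x S (\<beta> @ u # u # \<alpha>)"
    using seqP_swap[OF assms(1)] by blast
  then have "2 * seqP x S (\<beta> @ u # u # \<alpha>) = 0" by (metis add.right_inverse mult_2)
  then show ?case using assms(2) by simp
next
  case (Cons c \<gamma>)
  show ?case using seqP_swap[OF assms(1), of x \<beta> u c "\<gamma> @ u # \<alpha>"] Cons[of "\<beta> @ [c]"] by simp
qed

lemma seqP_not_distinct:
  fixes x :: "nat \<Rightarrow> 'a::field"
  assumes "finite S" "(2::'a) \<noteq> 0" "\<not> distinct \<alpha>"
  shows "seqP x S \<alpha> = 0"
proof -
  obtain xs ys zs y where "\<alpha> = xs @ [y] @ ys @ [y] @ zs"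
    using assms(3) not_distinct_decomp by blast
  then show ?thesis using seqP_repeat[OF assms(1,2), of x xs y ys zs] by simp
qed

lemma seqP_long:
  assumes "finite S" "card S < length \<alpha>"
  shows "seqP x S \<alpha> = 0"
  using assms
proof (induction \<alpha> arbitrary: S)
  case (Cons v \<alpha>)
  have "seqP x (S - {i}) \<alpha> = 0" if "i \<in> S" for i
    using Cons.prems that card_gt_0_iff[of S] by (intro Cons.IH) auto
  then show ?case by simp
qed simp

lemma move_front:
  assumes "\<And>\<beta> u v \<alpha>. f (\<beta> @ u # v # \<alpha>) = - (f (\<beta> @ v # u # \<alpha>) :: 'a::comm_ring_1)"
  shows "f (\<beta> @ c # \<gamma>) = (- 1) ^ length \<beta> * f (c # \<beta> @ \<gamma>)"
proof (induction \<beta> arbitrary: \<gamma> rule: rev_induct)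
  case (snoc b \<beta>)
  have "f ((\<beta> @ [b]) @ c # \<gamma>) = - f (\<beta> @ c # b # \<gamma>)" using assms[of \<beta> b c \<gamma>] by simp
  also have "\<dots> = - ((- 1) ^ length \<beta> * f (c # \<beta> @ b # \<gamma>))" using snoc by simp
  finally show ?case by simp
qed simp

lemma swap_invariant_mset:
  assumes sw: "\<And>\<beta> u v \<alpha>. f (\<beta> @ u # v # \<alpha>) = f (\<beta> @ v # u # \<alpha>)"
    and "mset \<alpha> = mset \<alpha>'"
  shows "f \<alpha> = f \<alpha>'"
proof -
  have mv: "f (\<beta> @ \<delta> @ c # \<gamma>) = f (\<beta> @ c # \<delta> @ \<gamma>)" for \<beta> c \<gamma> \<delta>
  proof (induction \<delta> arbitrary: \<gamma> rule: rev_induct)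
    case (snoc b \<delta>)
    have "f (\<beta> @ (\<delta> @ [b]) @ c # \<gamma>) = f (\<beta> @ \<delta> @ c # b # \<gamma>)" using sw[of "\<beta> @ \<delta>" b c \<gamma>] by simp
    then show ?case using snoc by simp
  qed simp
  have "mset \<alpha> = mset \<alpha>' \<Longrightarrow> f (\<beta> @ \<alpha>) = f (\<beta> @ \<alpha>')" for \<beta>
  proof (induction \<alpha> arbitrary: \<beta> \<alpha>')
    case (Cons a \<alpha>)
    then have "a \<in> set \<alpha>'" by (metis list.set_intros(1) mset_eq_setD)
    then obtain ys zs where y: "\<alpha>' = ys @ a # zs" by (meson split_list)
    then have "mset \<alpha> = mset (ys @ zs)" using Cons.prems by simp
    then have "f ((\<beta> @ [a]) @ \<alpha>) = f ((\<beta> @ [a]) @ ys @ zs)" by (rule Cons.IH)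
    then show ?case using mv[of \<beta> ys a zs] y by simp
  qed simp
  from this[of "[]"] assms(2) show ?thesis by simp
qed

section \<open>Products of odd power sums with P-functions\<close>

text \<open>The sign pattern telescopes after multiplication with \<open>x + y\<close>. For odd \<open>k\<close> both ends have opposite
signs, which is where the oddness of \<open>k\<close> enters on the spin side.\<close>

lemma alternating_geometric:
  fixes x y :: "'a::comm_ring_1"
  assumes "odd k"
  shows "(x + y) * (\<Sum>b=1..<k. (- 1) ^ b * (x ^ (k - b) * y ^ b)) = x * y ^ k - x ^ k * y"
proof -
  have k: "k \<ge> 1" using odd_pos[OF assms] by simp
  have tele: "(x + y) * ((- 1) ^ b * (x ^ (k - b) * y ^ b))
     = (- 1) ^ b * x ^ (Suc k - b) * y ^ b - (- 1) ^ Suc b * x ^ (Suc k - Suc b) * y ^ Suc b"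
    if "b \<in> {1..<k}" for b
  proof -
    have "Suc k - b = Suc (k - b)" using that by auto
    then show ?thesis by (simp add: algebra_simps)
  qed
  have "(x + y) * (\<Sum>b=1..<k. (- 1) ^ b * (x ^ (k - b) * y ^ b))
      = - (\<Sum>b=1..<k. (- 1) ^ Suc b * x ^ (Suc k - Suc b) * y ^ Suc b - (- 1) ^ b * x ^ (Suc k - b) * y ^ b)"
    unfolding sum_distrib_left sum_negf[symmetric] by (rule sum.cong[OF refl]) (simp only: tele minus_diff_eq)
  also have "\<dots> = - ((- 1) ^ k * x ^ (Suc k - k) * y ^ k - (- 1) ^ 1 * x ^ (Suc k - 1) * y ^ 1)"
    by (subst sum_Suc_diff'[OF k]) (rule refl)
  finally show ?thesis using assms by simp
qed

text \<open>The difference of the products of \<open>x\<^sub>i - x\<^sub>j\<close> and of \<open>x\<^sub>i + x\<^sub>j\<close> over \<open>j\<close>, as a polynomial in \<open>x\<^sub>i\<close>, has degree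
less than the number of the \<open>j\<close>, because both products are monic; Lagrange interpolation at the nodes
\<open>- x\<^sub>j\<close>, where the second product vanishes, gives the expansion.\<close>

lemma tau_partial_fraction:
  fixes x :: "nat \<Rightarrow> 'a::field"
  assumes fin: "finite S" and inj: "inj_on x S" and i: "i \<in> S"
  shows "1 = (\<Prod>j\<in>S-{i}. tau x i j) - 2 * (\<Sum>j\<in>S-{i}. x j / (x i - x j) *
        (\<Prod>l\<in>S-{i}-{j}. tau x i l * tau x j l))"
proof (cases "S - {i} = {}")
  case False
  define K where "K = S - {i}"
  have fK: "finite K" and cK: "card K > 0" using fin False by (auto simp: K_def card_gt_0_iff)
  \<comment> \<open>The two monic products differ by a polynomial of smaller degree.\<close>
  define f where "f = (\<Prod>j\<in>K. [:- x j, 1:]) - (\<Prod>j\<in>K. [:- (- x j), 1:])"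
  have inj': "inj_on (\<lambda>j. - x j) K" using inj by (auto simp: inj_on_def K_def)
  have "degree f \<le> card K" unfolding f_def
    using fK by (intro degree_diff_le order.trans[OF degree_prod_sum_le]) auto
  moreover have c0: "coeff f (card K) = 0"
    unfolding f_def coeff_diff coeff_prod_linear[OF fK] by simp
  ultimately have deg: "degree f < card K"
    using cK by (metis degree_0 le_neq_implies_less leading_coeff_0_iff)
  have dne: "x i - x j \<noteq> 0" if "j \<in> K" for j using that inj i by (auto simp: K_def inj_on_def)
  have "poly f (x i) = poly (\<Sum>j\<in>K. smult (poly f (- x j) / (\<Prod>l\<in>K-{j}. - x j - - x l))
         (\<Prod>l\<in>K-{j}. [:- (- x l), 1:])) (x i)"
    by (rule arg_cong[OF lagrange_interpolation[OF fK inj' deg], of "\<lambda>p. poly p (x i)"])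
  also have "\<dots> = (\<Sum>j\<in>K. poly f (- x j) / (\<Prod>l\<in>K-{j}. - x j - - x l) * (\<Prod>l\<in>K-{j}. x i + x l))"
    by (simp only: poly_sum poly_prod poly_smult) (simp add: add.commute)
  also have "\<dots> = (\<Sum>j\<in>K. - 2 * x j * ((\<Prod>l\<in>K-{j}. x j + x l) / (\<Prod>l\<in>K-{j}. x j - x l) * (\<Prod>l\<in>K-{j}. x i + x l)))"
  proof (rule sum.cong[OF refl])
    fix j assume j: "j \<in> K"
    have "poly f (- x j) = (\<Prod>l\<in>K. - x j - x l) - (\<Prod>l\<in>K. x l - x j)"
      unfolding f_def poly_diff poly_prod by (intro arg_cong2[of _ _ _ _ "(-)"] prod.cong refl) auto
    also have "(\<Prod>l\<in>K. x l - x j) = 0" using fK j by (intro prod_zero) auto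
    also have "(\<Prod>l\<in>K. - x j - x l) = (\<Prod>l\<in>K. (-1) * (x j + x l))" by (rule prod.cong[OF refl]) simp
    also have "\<dots> = (-1) ^ card K * (\<Prod>l\<in>K. x j + x l)" by (simp only: prod.distrib prod_constant)
    also have "(\<Prod>l\<in>K. x j + x l) = 2 * x j * (\<Prod>l\<in>K-{j}. x j + x l)"
      unfolding prod.remove[OF fK j] by simp
    finally have a: "poly f (- x j) = (-1) ^ card K * (2 * x j * (\<Prod>l\<in>K-{j}. x j + x l))"
      by (simp only: diff_0_right)
    have "(\<Prod>l\<in>K-{j}. - x j - - x l) = (\<Prod>l\<in>K-{j}. (-1) * (x j - x l))" by (rule prod.cong[OF refl]) simp
    also have "\<dots> = (-1) ^ (card K - 1) * (\<Prod>l\<in>K-{j}. x j - x l)"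
      using fK j by (simp only: prod.distrib prod_constant card_Diff_singleton)
    finally have b: "(\<Prod>l\<in>K-{j}. - x j - - x l) = (-1) ^ (card K - 1) * (\<Prod>l\<in>K-{j}. x j - x l)" .
    have c: "(-1 :: 'a) ^ card K = - ((-1) ^ (card K - 1))" using cK by (cases "card K") auto
    show "poly f (- x j) / (\<Prod>l\<in>K-{j}. - x j - - x l) * (\<Prod>l\<in>K-{j}. x i + x l)
       = - 2 * x j * ((\<Prod>l\<in>K-{j}. x j + x l) / (\<Prod>l\<in>K-{j}. x j - x l) * (\<Prod>l\<in>K-{j}. x i + x l))"
      unfolding a b c by simp
  qed
  finally have main: "(\<Prod>j\<in>K. x i - x j) - (\<Prod>j\<in>K. x i + x j)
    = (\<Sum>j\<in>K. - 2 * x j * ((\<Prod>l\<in>K-{j}. x j + x l) / (\<Prod>l\<in>K-{j}. x j - x l) * (\<Prod>l\<in>K-{j}. x i + x l)))"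
    by (simp only: f_def poly_diff poly_prod) (simp add: add.commute)
  have P: "(\<Prod>j\<in>K. x i - x j) \<noteq> 0" using dne fK by (simp add: prod_zero_iff)
  have "1 - (\<Prod>j\<in>K. tau x i j) = ((\<Prod>j\<in>K. x i - x j) - (\<Prod>j\<in>K. x i + x j)) / (\<Prod>j\<in>K. x i - x j)"
    using P by (simp add: tau_def prod_dividef diff_divide_distrib)
  also have "\<dots> = (\<Sum>j\<in>K. - 2 * (x j / (x i - x j) * (\<Prod>l\<in>K-{j}. tau x i l * tau x j l)))"
    unfolding main sum_divide_distrib
  proof (rule sum.cong[OF refl])
    fix j assume j: "j \<in> K"
    have "(\<Prod>j\<in>K. x i - x j) = (x i - x j) * (\<Prod>l\<in>K-{j}. x i - x l)"
      by (rule prod.remove[OF fK j])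
    then show "- 2 * x j * ((\<Prod>l\<in>K-{j}. x j + x l) / (\<Prod>l\<in>K-{j}. x j - x l) * (\<Prod>l\<in>K-{j}. x i + x l)) / (\<Prod>j\<in>K. x i - x j)
       = - 2 * (x j / (x i - x j) * (\<Prod>l\<in>K-{j}. tau x i l * tau x j l))"
      by (simp add: tau_def prod_dividef prod.distrib mult_ac)
  qed
  also have "\<dots> = - 2 * (\<Sum>j\<in>K. x j / (x i - x j) * (\<Prod>l\<in>K-{j}. tau x i l * tau x j l))"
    by (simp add: sum_distrib_left sum_negf)
  finally have "1 - (\<Prod>j\<in>K. tau x i j) = - 2 * (\<Sum>j\<in>K. x j / (x i - x j) * (\<Prod>l\<in>K-{j}. tau x i l * tau x j l))" .
  then show ?thesis unfolding K_def[symmetric] by (simp only: diff_eq_eq) simp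
next
  case True
  then show ?thesis by (simp only: True) simp
qed

text \<open>Each \<open>x\<^sub>i\<^sup>k\<close> is multiplied with the expansion of 1 from the previous lemma. The first term gives the
P-function of one row; the others, after symmetrization in \<open>i\<close> and \<open>j\<close>, are the alternating sum of
two-row functions by the geometric sum.\<close>

lemma power_sum_expansion:
  fixes x :: "nat \<Rightarrow> 'a::field"
  assumes fin: "finite S" and inj: "inj_on x S"
    and nz: "\<And>i j. i \<in> S \<Longrightarrow> j \<in> S \<Longrightarrow> x i + x j \<noteq> 0" and k: "odd k"
  shows "(\<Sum>i\<in>S. x i ^ k) = seqP x S [k] + (\<Sum>b=1..<k. (-1) ^ b * seqP x S [k - b, b])"
proof -
  define W where "W i j = (\<Prod>l\<in>S-{i}-{j}. tau x i l * tau x j l)" for i j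
  have Wsym: "W j i = W i j" for i j
  proof -
    have "S - {j} - {i} = S - {i} - {j}" by auto
    then show ?thesis by (simp add: W_def mult.commute)
  qed
  define T where "T = {(i,j). i \<in> S \<and> j \<in> S \<and> i \<noteq> j}"
  have ST: "(SIGMA i:S. S-{i}) = T" by (auto simp: T_def)
  have "(\<Sum>b=1..<k. (-1) ^ b * seqP x S [k - b, b])
    = (\<Sum>b=1..<k. \<Sum>(i,j)\<in>T. (-1) ^ b * (x i ^ (k - b) * x j ^ b) * (tau x i j * W i j))"
    unfolding seqP_two[OF fin] T_def[symmetric] W_def[symmetric] sum_distrib_left
    by (intro sum.cong refl) (auto simp: mult_ac)
  also have "\<dots> = (\<Sum>(i,j)\<in>T. (\<Sum>b=1..<k. (-1) ^ b * (x i ^ (k - b) * x j ^ b)) * (tau x i j * W i j))"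
    by (subst sum.swap) (simp add: case_prod_unfold sum_distrib_right)
  also have "\<dots> = (\<Sum>(i,j)\<in>T. x i * x j ^ k / (x i - x j) * W i j - x i ^ k * x j / (x i - x j) * W i j)"
  proof (intro sum.cong refl, clarify)
    fix i j assume ij: "(i,j) \<in> T"
    then have n: "x i + x j \<noteq> 0" using nz by (auto simp: T_def)
    have "(\<Sum>b=1..<k. (-1) ^ b * (x i ^ (k - b) * x j ^ b)) = (x i * x j ^ k - x i ^ k * x j) / (x i + x j)"
      using alternating_geometric[OF k, of "x i" "x j"] n by (simp add: field_simps)
    then show "(\<Sum>b=1..<k. (-1) ^ b * (x i ^ (k - b) * x j ^ b)) * (tau x i j * W i j)
      = x i * x j ^ k / (x i - x j) * W i j - x i ^ k * x j / (x i - x j) * W i j"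
      using n by (simp add: tau_def diff_divide_distrib left_diff_distrib mult.assoc)
  qed
  also have "\<dots> = (\<Sum>(i,j)\<in>T. x i * x j ^ k / (x i - x j) * W i j) - (\<Sum>(i,j)\<in>T. x i ^ k * x j / (x i - x j) * W i j)"
    by (simp add: case_prod_unfold sum_subtractf)
  also have "(\<Sum>(i,j)\<in>T. x i * x j ^ k / (x i - x j) * W i j) = - (\<Sum>(i,j)\<in>T. x i ^ k * x j / (x i - x j) * W i j)"
    unfolding sum_negf[symmetric]
  proof (rule sum.reindex_bij_witness[of _ prod.swap prod.swap], goal_cases)
    case (5 a)
    obtain i j where a: "a = (i,j)" by force
    have "y / (x i - x j) = - (y / (x j - x i))" for y by (metis minus_diff_eq minus_divide_right)
    then show ?case unfolding a by (simp add: Wsym[of i j] mult_ac)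
  qed (auto simp: T_def)
  also have "- (\<Sum>(i,j)\<in>T. x i ^ k * x j / (x i - x j) * W i j) - (\<Sum>(i,j)\<in>T. x i ^ k * x j / (x i - x j) * W i j)
    = - 2 * (\<Sum>(i,j)\<in>T. x i ^ k * x j / (x i - x j) * W i j)" by simp
  also have "(\<Sum>(i,j)\<in>T. x i ^ k * x j / (x i - x j) * W i j)
    = (\<Sum>i\<in>S. \<Sum>j\<in>S-{i}. x i ^ k * x j / (x i - x j) * W i j)"
    unfolding ST[symmetric] using fin by (intro sum.Sigma[symmetric]) auto
  finally have B: "(\<Sum>b=1..<k. (-1) ^ b * seqP x S [k - b, b])
     = - 2 * (\<Sum>i\<in>S. \<Sum>j\<in>S-{i}. x i ^ k * x j / (x i - x j) * W i j)" .
  have "(\<Sum>i\<in>S. x i ^ k) = (\<Sum>i\<in>S. x i ^ k * ((\<Prod>j\<in>S-{i}. tau x i j) - 2 * (\<Sum>j\<in>S-{i}. x j / (x i - x j) * W i j)))"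
  proof (rule sum.cong[OF refl])
    fix i assume i: "i \<in> S"
    have e: "(\<Prod>j\<in>S-{i}. tau x i j) - 2 * (\<Sum>j\<in>S-{i}. x j / (x i - x j) * W i j) = 1"
      unfolding W_def by (rule tau_partial_fraction[OF fin inj i, symmetric])
    show "x i ^ k = x i ^ k * ((\<Prod>j\<in>S-{i}. tau x i j) - 2 * (\<Sum>j\<in>S-{i}. x j / (x i - x j) * W i j))"
      by (simp only: e mult_1_right)
  qed
  also have "\<dots> = seqP x S [k] + - 2 * (\<Sum>i\<in>S. \<Sum>j\<in>S-{i}. x i ^ k * x j / (x i - x j) * W i j)"
  proof -
    have a: "seqP x S [k] = (\<Sum>i\<in>S. x i ^ k * (\<Prod>j\<in>S-{i}. tau x i j))" by simp
    have c: "(\<Sum>j\<in>S-{i}. x i ^ k * x j / (x i - x j) * W i j) = x i ^ k * (\<Sum>j\<in>S-{i}. x j / (x i - x j) * W i j)" for i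
      by (simp add: sum_distrib_left mult.assoc)
    show ?thesis unfolding a c sum_distrib_left[of "- 2"] sum.distrib[symmetric]
      by (rule sum.cong[OF refl]) (simp add: right_diff_distrib mult.left_commute)
  qed
  finally show ?thesis unfolding B .
qed

text \<open>By induction on the sequence: the power sum splits into the \<open>k\<close>-th power of the variable that carries the
first exponent and the power sum in the other variables.\<close>

lemma power_sum_times_seqP:
  fixes x :: "nat \<Rightarrow> 'a::field"
  assumes fin: "finite S" and inj: "inj_on x S"
    and nz: "\<And>i j. i \<in> S \<Longrightarrow> j \<in> S \<Longrightarrow> x i + x j \<noteq> 0" and k: "odd k"
  shows "(\<Sum>i\<in>S. x i ^ k) * seqP x S \<alpha> = (\<Sum>r<length \<alpha>. seqP x S (\<alpha>[r := \<alpha> ! r + k]))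
     + seqP x S (\<alpha> @ [k]) + (\<Sum>b=1..<k. (-1) ^ b * seqP x S (\<alpha> @ [k - b, b]))"
  using fin inj nz
proof (induction \<alpha> arbitrary: S)
  case Nil
  then show ?case using power_sum_expansion[of S x k] k by simp
next
  case (Cons v \<alpha>)
  define p where "p T = (\<Sum>i\<in>T. x i ^ k)" for T
  let ?c = "\<lambda>i. x i ^ v * (\<Prod>j\<in>S-{i}. tau x i j)"
  have p: "p S = x i ^ k + p (S - {i})" if "i \<in> S" for i
    unfolding p_def using Cons.prems(1) that by (rule sum.remove)
  have "p S * seqP x S (v # \<alpha>) = (\<Sum>i\<in>S. ?c i * (p S * seqP x (S - {i}) \<alpha>))"
    by (simp add: sum_distrib_left mult_ac)
  also have "\<dots> = (\<Sum>i\<in>S. ?c i * (x i ^ k * seqP x (S - {i}) \<alpha>) + ?c i * (p (S - {i}) * seqP x (S - {i}) \<alpha>))"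
  proof (rule sum.cong[OF refl])
    fix i assume "i \<in> S"
    show "?c i * (p S * seqP x (S - {i}) \<alpha>) = ?c i * (x i ^ k * seqP x (S - {i}) \<alpha>) + ?c i * (p (S - {i}) * seqP x (S - {i}) \<alpha>)"
      unfolding p[OF \<open>i \<in> S\<close>] distrib_right distrib_left ..
  qed
  also have "\<dots> = seqP x S ((v + k) # \<alpha>) + (\<Sum>i\<in>S. ?c i * (p (S - {i}) * seqP x (S - {i}) \<alpha>))"
    by (simp add: sum.distrib power_add mult_ac)
  also have "(\<Sum>i\<in>S. ?c i * (p (S - {i}) * seqP x (S - {i}) \<alpha>))
    = (\<Sum>i\<in>S. ?c i * ((\<Sum>r<length \<alpha>. seqP x (S-{i}) (\<alpha>[r := \<alpha> ! r + k]))
     + seqP x (S-{i}) (\<alpha> @ [k]) + (\<Sum>b=1..<k. (-1) ^ b * seqP x (S-{i}) (\<alpha> @ [k - b, b]))))"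
    unfolding p_def
    using Cons.prems by (intro sum.cong refl arg_cong2[of _ _ _ _ "(*)"] Cons.IH) (auto intro: inj_on_subset)
  also have "\<dots> = (\<Sum>r<length \<alpha>. seqP x S (v # \<alpha>[r := \<alpha> ! r + k])) + seqP x S (v # \<alpha> @ [k])
     + (\<Sum>b=1..<k. (-1) ^ b * seqP x S (v # \<alpha> @ [k - b, b]))"
  proof -
    have a: "(\<Sum>i\<in>S. ?c i * (\<Sum>r<length \<alpha>. seqP x (S-{i}) (\<alpha>[r := \<alpha> ! r + k])))
        = (\<Sum>r<length \<alpha>. seqP x S (v # \<alpha>[r := \<alpha> ! r + k]))"
      unfolding seqP.simps sum_distrib_left by (rule sum.swap)
    have "(\<Sum>b=1..<k. (-1) ^ b * seqP x S (v # \<alpha> @ [k - b, b]))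
      = (\<Sum>b=1..<k. \<Sum>i\<in>S. ?c i * ((-1) ^ b * seqP x (S-{i}) (\<alpha> @ [k - b, b])))"
      unfolding seqP.simps(2)[of x S v] sum_distrib_left by (intro sum.cong refl) (simp add: mult_ac)
    also have "\<dots> = (\<Sum>i\<in>S. ?c i * (\<Sum>b=1..<k. (-1) ^ b * seqP x (S-{i}) (\<alpha> @ [k - b, b])))"
      unfolding sum_distrib_left by (rule sum.swap)
    finally have b: "(\<Sum>i\<in>S. ?c i * (\<Sum>b=1..<k. (-1) ^ b * seqP x (S-{i}) (\<alpha> @ [k - b, b])))
       = (\<Sum>b=1..<k. (-1) ^ b * seqP x S (v # \<alpha> @ [k - b, b]))" by simp
    show ?thesis unfolding distrib_left sum.distrib a b by simp
  qed
  finally have "p S * seqP x S (v # \<alpha>) = seqP x S ((v + k) # \<alpha>) +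
     ((\<Sum>r<length \<alpha>. seqP x S (v # \<alpha>[r := \<alpha> ! r + k])) + seqP x S (v # \<alpha> @ [k])
     + (\<Sum>b=1..<k. (-1) ^ b * seqP x S (v # \<alpha> @ [k - b, b])))" .
  moreover have "(\<Sum>r<length (v # \<alpha>). seqP x S ((v # \<alpha>)[r := (v # \<alpha>) ! r + k]))
    = seqP x S ((v + k) # \<alpha>) + (\<Sum>r<length \<alpha>. seqP x S (v # \<alpha>[r := \<alpha> ! r + k]))"
    by (simp only: length_Cons sum.lessThan_Suc_shift nth_Cons_0 nth_Cons_Suc list_update.simps nat.case)
  ultimately show ?case unfolding p_def append_Cons by (simp only: add.assoc)
qed

section \<open>Coefficients of power sums in the normalized P-functions\<close>

text \<open>The weight of a strict partition of \<open>n\<close>, times \<open>n!\<close>, is the value \<open>X\<close> at the identity, that is, the number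
of standard shifted tableaux. The formula is also used for sequences in any order, where it alternates
in the same way as the P-functions.\<close>

fun weight :: "nat list \<Rightarrow> complex" where
  "weight [] = 1"
| "weight (v # \<alpha>) = (\<Prod>b\<leftarrow>\<alpha>. (of_nat v - of_nat b) / (of_nat v + of_nat b)) / fact v * weight \<alpha>"

lemma weight_swap: "weight (\<beta> @ u # v # \<alpha>) = - weight (\<beta> @ v # u # \<alpha>)"
proof (induction \<beta>)
  case Nil
  have "(of_nat u - of_nat v) / (of_nat u + of_nat v) = - ((of_nat v - of_nat u) / (of_nat v + of_nat u) :: complex)"
    by (metis add.commute minus_diff_eq minus_divide_left)
  then show ?case by (simp add: mult_ac)
qed (simp add: mult_ac)

lemma weight_Cons_set:
  "distinct \<alpha> \<Longrightarrow> weight (v # \<alpha>) =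
     (\<Prod>b\<in>set \<alpha>. (of_nat v - of_nat b) / (of_nat v + of_nat b)) / fact v * weight \<alpha>"
  by (simp add: prod.distinct_set_conv_list)

lemma weight_nonzero: "distinct \<alpha> \<Longrightarrow> 0 \<notin> set \<alpha> \<Longrightarrow> weight \<alpha> \<noteq> 0"
proof (induction \<alpha>)
  case (Cons v \<alpha>)
  have "of_nat v + of_nat b \<noteq> (0::complex)" if "b \<in> set \<alpha>" for b
    using Cons.prems by (metis add_is_0 list.set_intros(1) of_nat_add of_nat_eq_0_iff)
  then show ?case using Cons by (auto simp: prod_list_zero_iff)
qed simp

lemma sign_cancel:
  "((- 1) ^ n * a) * ((- 1) ^ n * b) = (a * b :: 'a::comm_ring_1)"
proof -
  have "((- 1) ^ n * a) * ((- 1) ^ n * b) = ((- 1) ^ n * (- 1) ^ n) * (a * b)" by (simp only: mult_ac)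
  then show ?thesis by (simp flip: power_add)
qed

text \<open>The quotient of the weights before and after a part is raised to \<open>d\<close> from \<open>d - k\<close>, in the presence of the
other parts \<open>Z\<close>.\<close>

definition shift_ratio :: "nat \<Rightarrow> nat \<Rightarrow> nat set \<Rightarrow> complex" where
  "shift_ratio d k Z = fact d / fact (d - k) *
     (\<Prod>b\<in>Z. (of_nat (d - k) - of_nat b) * (of_nat d + of_nat b) /
             ((of_nat (d - k) + of_nat b) * (of_nat d - of_nat b)))"

text \<open>The quotient of the weights before and after the parts \<open>u\<close> and \<open>w\<close> are inserted, with the sign of the
two-row term in the product with a power sum.\<close>

definition pair_ratio :: "nat \<Rightarrow> nat \<Rightarrow> nat set \<Rightarrow> complex" where
  "pair_ratio u w Z = (- 1) ^ w * fact u * fact w * (of_nat u + of_nat w) / (of_nat u - of_nat w) *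
     (\<Prod>b\<in>Z. (of_nat u + of_nat b) * (of_nat w + of_nat b) /
             ((of_nat u - of_nat b) * (of_nat w - of_nat b)))"

text \<open>This turns out to be the normalized spin character at a cycle of length \<open>k\<close>; the second sum runs over
ordered pairs, and both orders have the same value.\<close>

definition spin_phi :: "nat \<Rightarrow> nat set \<Rightarrow> complex" where
  "spin_phi k Z = (\<Sum>d | d \<in> Z \<and> k \<le> d. shift_ratio d k (Z - {d})) +
     (\<Sum>(u, w) | u \<in> Z \<and> w \<in> Z \<and> u + w = k. pair_ratio u w (Z - {u} - {w}))"

definition pos_sets :: "nat \<Rightarrow> nat set set" where
  "pos_sets m = {Z. finite Z \<and> 0 \<notin> Z \<and> \<Sum>Z = m}"

lemma finite_pos_sets [simp]: "finite (pos_sets m)"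
proof -
  have "i \<le> \<Sum>Z" if "finite Z" "i \<in> Z" for i and Z :: "nat set"
    using member_le_sum[of i Z "\<lambda>i. i"] that by simp
  then have "pos_sets m \<subseteq> Pow {..m}" unfolding pos_sets_def by auto
  then show ?thesis using finite_subset by blast
qed

text \<open>There are no pairs of parts with sum 1, and the first sum was evaluated above. This is the branching rule
for the number of standard shifted tableaux.\<close>

lemma spin_phi_one:
  assumes "finite Z" "0 \<notin> Z"
  shows "spin_phi 1 Z = of_nat (\<Sum>Z)"
proof -
  have e: "{(u, w). u \<in> Z \<and> w \<in> Z \<and> u + w = 1} = {}"
    using assms(2) by (auto simp: add_is_1 intro!: gr0I)
  have f: "{d. d \<in> Z \<and> 1 \<le> d} = Z" using assms(2) by (auto simp: Suc_le_eq intro: gr0I)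
  have "spin_phi 1 Z = (\<Sum>d\<in>Z. shift_ratio d 1 (Z - {d}))"
    unfolding spin_phi_def e f by simp
  also have "\<dots> = (\<Sum>d\<in>Z. of_nat d * (\<Prod>b\<in>Z-{d}. (of_nat d - 1 - of_nat b) * (of_nat d + of_nat b) /
            ((of_nat d - 1 + of_nat b) * (of_nat d - of_nat b))))"
  proof (rule sum.cong[OF refl])
    fix d assume "d \<in> Z"
    then obtain e where "d = Suc e" using assms(2) by (cases d) auto
    then show "shift_ratio d 1 (Z - {d}) = of_nat d * (\<Prod>b\<in>Z-{d}. (of_nat d - 1 - of_nat b) * (of_nat d + of_nat b) /
            ((of_nat d - 1 + of_nat b) * (of_nat d - of_nat b)))"
      by (simp add: shift_ratio_def)
  qed
  also have "\<dots> = of_nat (\<Sum>Z)" by (rule sum_shift_spin[OF assms])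
  finally show ?thesis .
qed

text \<open>The map \<open>h\<close> embeds the complex coefficients into the field that contains the variables.\<close>

locale spin_variables =
  fixes x :: "nat \<Rightarrow> 'a::field" and S :: "nat set" and h :: "complex \<Rightarrow> 'a"
  assumes finite_S: "finite S" and inj_x: "inj_on x S"
    and sum_nz: "\<And>i j. i \<in> S \<Longrightarrow> j \<in> S \<Longrightarrow> x i + x j \<noteq> 0"
    and h_one: "h 1 = 1" and h_add: "\<And>a b. h (a + b) = h a + h b"
    and h_mult: "\<And>a b. h (a * b) = h a * h b"
begin

lemma h_zero: "h 0 = 0" using h_add[of 0 0] by (metis add_0 add_cancel_right_right)

lemma h_minus: "h (- a) = - h a"
  using h_add[of a "- a"] h_zero by (simp add: eq_neg_iff_add_eq_0 add.commute)

lemma h_sum: "h (sum f A) = (\<Sum>i\<in>A. h (f i))"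
  by (induction A rule: infinite_finite_induct) (auto simp: h_zero h_add)

lemma two_nz: "(2::'a) \<noteq> 0"
proof
  assume "(2::'a) = 0"
  moreover have "h 2 = 2" using h_add[of 1 1] h_one by simp
  ultimately have "h (2 * (1/2)) = 0" unfolding h_mult by simp
  then show False using h_one by simp
qed

lemma h_sign: "h ((- 1) ^ b * a) = (- 1) ^ b * h a"
  by (induction b arbitrary: a) (auto simp: h_minus)

abbreviation R :: "nat list \<Rightarrow> 'a" where "R \<equiv> seqP x S"

text \<open>Since both factors change their sign when two entries are exchanged, the product depends only on the
set of the parts. Sets of parts replace strict partitions in the computations below.\<close>

definition Hs :: "nat set \<Rightarrow> 'a" where
  "Hs Z = h (weight (sorted_list_of_set Z)) * R (sorted_list_of_set Z)"

lemma Hs_list: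
  assumes "distinct \<alpha>"
  shows "h (weight \<alpha>) * R \<alpha> = Hs (set \<alpha>)"
  unfolding Hs_def
proof (rule swap_invariant_mset[of "\<lambda>\<alpha>. h (weight \<alpha>) * R \<alpha>"])
  show "h (weight (\<beta> @ u # v # \<alpha>)) * R (\<beta> @ u # v # \<alpha>) = h (weight (\<beta> @ v # u # \<alpha>)) * R (\<beta> @ v # u # \<alpha>)"
    for \<beta> u v \<alpha>
    unfolding weight_swap[of \<beta> u v] seqP_swap[OF finite_S, of x \<beta> u v] h_minus by simp
  show "mset \<alpha> = mset (sorted_list_of_set (set \<alpha>))"
    using assms by (metis List.finite_set distinct_sorted_list_of_set set_eq_iff_mset_eq_distinct set_sorted_list_of_set)
qed

lemma term_replace:
  assumes "distinct \<alpha>'" "0 \<notin> set \<alpha>'"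
  shows "h a * R \<alpha>' = h (a / weight \<alpha>') * Hs (set \<alpha>')"
proof -
  have "a = a / weight \<alpha>' * weight \<alpha>'" using weight_nonzero[OF assms] by simp
  then have "h a = h (a / weight \<alpha>') * h (weight \<alpha>')" by (metis h_mult)
  then show ?thesis using Hs_list[OF assms(1)] by (simp add: mult.assoc)
qed

lemma term_shift:
  assumes "finite Z" "c \<notin> Z" "0 \<notin> Z" "c > 0" "k > 0"
  shows "h (weight (c # sorted_list_of_set Z)) * R ((c + k) # sorted_list_of_set Z) =
    (if c + k \<in> Z then 0 else h (shift_ratio (c + k) k Z) * Hs (insert (c + k) Z))"
proof (cases "c + k \<in> Z")
  case True
  then show ?thesis using seqP_not_distinct[OF finite_S two_nz, of "(c + k) # sorted_list_of_set Z"] assms by simp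
next
  case False
  let ?Z = "sorted_list_of_set Z"
  have w: "weight ?Z \<noteq> 0" using assms by (intro weight_nonzero) auto
  have "weight (c # ?Z) / weight ((c + k) # ?Z) = shift_ratio (c + k) k Z"
    using w assms(1) by (simp add: weight_Cons_set shift_ratio_def prod_dividef prod.distrib mult_ac del: weight.simps)
  then show ?thesis
    using term_replace[of "(c + k) # ?Z" "weight (c # ?Z)"] False assms by simp
qed

lemma term_single:
  assumes "finite Z" "0 \<notin> Z" "k > 0"
  shows "h (weight (sorted_list_of_set Z)) * R (sorted_list_of_set Z @ [k]) =
    (if k \<in> Z then 0 else h (shift_ratio k k Z) * Hs (insert k Z))"
proof (cases "k \<in> Z")
  case True
  then show ?thesis using seqP_not_distinct[OF finite_S two_nz, of "sorted_list_of_set Z @ [k]"] assms by simp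
next
  case False
  let ?Z = "sorted_list_of_set Z"
  have w: "weight ?Z \<noteq> 0" using assms by (intro weight_nonzero) auto
  have "(\<Prod>b\<in>Z. - of_nat b * (of_nat k + of_nat b) / (of_nat b * (of_nat k - of_nat b)))
     = (\<Prod>b\<in>Z. (-1) * ((of_nat k + of_nat b) / (of_nat k - of_nat b)) :: complex)"
    using assms(2) by (intro prod.cong refl) (auto intro!: gr0I)
  also have "\<dots> = (-1) ^ card Z * (\<Prod>b\<in>Z. (of_nat k + of_nat b) / (of_nat k - of_nat b))"
    by (simp only: prod.distrib prod_constant)
  finally have e: "shift_ratio k k Z = (-1) ^ card Z * (weight ?Z / weight (k # ?Z))"
    using w assms(1) by (simp add: weight_Cons_set shift_ratio_def prod_dividef del: weight.simps)
  have "R (?Z @ [k]) = (-1) ^ card Z * R (k # ?Z)"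
    using move_front[of "seqP x S", OF seqP_swap[OF finite_S], of ?Z k "[]"] assms(1) by simp
  then have "h (weight ?Z) * R (?Z @ [k]) = (-1) ^ card Z * (h (weight ?Z) * R (k # ?Z))" by simp
  also have "\<dots> = (-1) ^ card Z * (h (weight ?Z / weight (k # ?Z)) * Hs (insert k Z))"
    using term_replace[of "k # ?Z" "weight ?Z"] False assms by simp
  finally show ?thesis using False unfolding e h_sign by simp
qed

lemma term_pair:
  assumes "finite Z" "0 \<notin> Z" "u > 0" "w > 0" "u \<noteq> w"
  shows "(-1) ^ w * (h (weight (sorted_list_of_set Z)) * R (sorted_list_of_set Z @ [u, w])) =
    (if u \<in> Z \<or> w \<in> Z then 0 else h (pair_ratio u w Z) * Hs (insert u (insert w Z)))"
proof (cases "u \<in> Z \<or> w \<in> Z")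
  case True
  then show ?thesis using seqP_not_distinct[OF finite_S two_nz, of "sorted_list_of_set Z @ [u,w]"] assms by auto
next
  case False
  let ?Z = "sorted_list_of_set Z"
  have w: "weight ?Z \<noteq> 0" using assms by (intro weight_nonzero) auto
  have uw: "of_nat u - of_nat w \<noteq> (0::complex)" "of_nat u + of_nat w \<noteq> (0::complex)"
    using assms(3-5) by (auto simp flip: of_nat_add)
  have "weight (u # w # ?Z) = (of_nat u - of_nat w) / (of_nat u + of_nat w) *
      (\<Prod>b\<in>Z. (of_nat u - of_nat b) / (of_nat u + of_nat b)) / fact u *
      ((\<Prod>b\<in>Z. (of_nat w - of_nat b) / (of_nat w + of_nat b)) / fact w * weight ?Z)"
    using assms False by (simp add: weight_Cons_set[of "w # _"] weight_Cons_set[of ?Z] del: weight.simps)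
  then have e: "(-1) ^ w * (weight ?Z / weight (u # w # ?Z)) = pair_ratio u w Z"
    using w uw by (simp add: pair_ratio_def prod_dividef prod.distrib mult_ac)
  note mv = move_front[of "seqP x S", OF seqP_swap[OF finite_S]]
  have "R (?Z @ [u, w]) = (-1) ^ card Z * R ((u # ?Z) @ [w])"
    using mv[of ?Z u "[w]"] assms(1) by simp
  also have "R ((u # ?Z) @ [w]) = (-1) ^ Suc (card Z) * R (w # u # ?Z)"
    using mv[of "u # ?Z" w "[]"] assms(1) by simp
  also have "R (w # u # ?Z) = - R (u # w # ?Z)" using seqP_swap[OF finite_S, of x "[]" w u] by simp
  finally have "R (?Z @ [u, w]) = ((-1) ^ card Z * 1) * ((-1) ^ card Z * R (u # w # ?Z))" by simp
  then have "R (?Z @ [u, w]) = R (u # w # ?Z)" unfolding sign_cancel by simp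
  then have "h (weight ?Z) * R (?Z @ [u, w]) = h (weight ?Z / weight (u # w # ?Z)) * Hs (insert u (insert w Z))"
    using term_replace[of "u # w # ?Z" "weight ?Z"] False assms by simp
  then show ?thesis using False unfolding e[symmetric] h_sign by simp
qed

text \<open>The three kinds of terms are those of the product rule for sequences: an existing part is raised by \<open>k\<close>,
a part \<open>k\<close> is added, or two parts with sum \<open>k\<close> are added. Terms with a repeated part vanish. In the last sum
the two orders of a pair of parts occur separately.\<close>

lemma power_sum_times_Hs:
  assumes Z: "finite Z" "0 \<notin> Z" and k: "odd k"
  shows "(\<Sum>i\<in>S. x i ^ k) * Hs Z =
     (\<Sum>c | c \<in> Z \<and> c + k \<notin> Z. h (shift_ratio (c + k) k (Z - {c})) * Hs (insert (c + k) (Z - {c})))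
     + (if k \<in> Z then 0 else h (shift_ratio k k Z) * Hs (insert k Z))
     + (\<Sum>w | w \<in> {1..<k} \<and> k - w \<notin> Z \<and> w \<notin> Z. h (pair_ratio (k - w) w Z) * Hs (insert (k - w) (insert w Z)))"
proof -
  let ?Z = "sorted_list_of_set Z"
  have k0: "k > 0" using k by (rule odd_pos)
  have "(\<Sum>i\<in>S. x i ^ k) * Hs Z = h (weight ?Z) * ((\<Sum>i\<in>S. x i ^ k) * R ?Z)"
    by (simp add: Hs_def mult_ac)
  also have "\<dots> = (\<Sum>r<length ?Z. h (weight ?Z) * R (?Z[r := ?Z ! r + k])) + h (weight ?Z) * R (?Z @ [k])
     + (\<Sum>b=1..<k. (-1) ^ b * (h (weight ?Z) * R (?Z @ [k - b, b])))"
  proof -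
    have e: "(\<Sum>i\<in>S. x i ^ k) * R ?Z = (\<Sum>r<length ?Z. R (?Z[r := ?Z ! r + k])) + R (?Z @ [k])
       + (\<Sum>b=1..<k. (-1) ^ b * R (?Z @ [k - b, b]))"
      by (rule power_sum_times_seqP[OF finite_S inj_x sum_nz k])
    show ?thesis unfolding e by (simp only: distrib_left sum_distrib_left mult.left_commute)
  qed
  also have "(\<Sum>b=1..<k. (-1) ^ b * (h (weight ?Z) * R (?Z @ [k - b, b]))) =
     (\<Sum>w=1..<k. if k - w \<notin> Z \<and> w \<notin> Z then h (pair_ratio (k - w) w Z) * Hs (insert (k - w) (insert w Z)) else 0)"
  proof (rule sum.cong[OF refl])
    fix w assume w: "w \<in> {1..<k}"
    then have "k - w \<noteq> w" using k by auto presburger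
    then show "(-1) ^ w * (h (weight ?Z) * R (?Z @ [k - w, w])) =
      (if k - w \<notin> Z \<and> w \<notin> Z then h (pair_ratio (k - w) w Z) * Hs (insert (k - w) (insert w Z)) else 0)"
      using term_pair[OF Z, of "k - w" w] w by auto
  qed
  also have "\<dots> = (\<Sum>w | w \<in> {1..<k} \<and> k - w \<notin> Z \<and> w \<notin> Z. h (pair_ratio (k - w) w Z) * Hs (insert (k - w) (insert w Z)))"
    by (simp only: sum.inter_filter[symmetric] finite_atLeastLessThan)
  also have "(\<Sum>r<length ?Z. h (weight ?Z) * R (?Z[r := ?Z ! r + k]))
     = (\<Sum>c\<in>Z. h (weight (c # sorted_list_of_set (Z - {c}))) * R ((c + k) # sorted_list_of_set (Z - {c})))"
  proof (rule sum.reindex_bij_witness[of _ "\<lambda>c. THE r. r < length ?Z \<and> ?Z ! r = c" "\<lambda>r. ?Z ! r"], goal_cases)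
    case (1 r)
    then show ?case using Z by (intro the_equality) (auto simp: nth_eq_iff_index_eq)
  next
    case (2 r)
    then show ?case using Z by (metis lessThan_iff nth_mem set_sorted_list_of_set)
  next
    case (3 c)
    then obtain r where r: "r < length ?Z" "?Z ! r = c" using Z by (metis in_set_conv_nth set_sorted_list_of_set)
    then have "(THE r. r < length ?Z \<and> ?Z ! r = c) = r"
      using Z by (intro the_equality) (auto simp: nth_eq_iff_index_eq)
    then show ?case using r by simp
  next
    case (4 c)
    then obtain r where r: "r < length ?Z" "?Z ! r = c" using Z by (metis in_set_conv_nth set_sorted_list_of_set)
    then have "(THE r. r < length ?Z \<and> ?Z ! r = c) = r"
      using Z by (intro the_equality) (auto simp: nth_eq_iff_index_eq)
    then show ?case using r by simp
  next
    case (5 r)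
    define c where "c = ?Z ! r"
    define A B where "A = take r ?Z" and "B = drop (Suc r) ?Z"
    have r: "r < length ?Z" using 5 by simp
    have AB: "?Z = A @ c # B" using r by (simp add: A_def B_def c_def id_take_nth_drop)
    have upd: "?Z[r := c + k] = A @ (c + k) # B" using r by (simp add: upd_conv_take_nth_drop A_def B_def)
    have dist: "distinct (A @ c # B)" using AB by (metis distinct_sorted_list_of_set)
    have setAB: "set (A @ B) = Z - {c}"
    proof -
      have "set (A @ c # B) = Z" using AB Z by (metis set_sorted_list_of_set)
      then show ?thesis using dist by auto
    qed
    have "h (weight ?Z) * R (?Z[r := ?Z ! r + k]) = h (weight (c # A @ B)) * R ((c + k) # A @ B)"
      unfolding c_def[symmetric] upd
      unfolding AB move_front[of weight, OF weight_swap] move_front[of "seqP x S", OF seqP_swap[OF finite_S]] h_sign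
      by (rule sign_cancel)
    also have "\<dots> = h (weight (c # sorted_list_of_set (Z - {c}))) * R ((c + k) # sorted_list_of_set (Z - {c}))"
    proof (rule swap_invariant_mset[of "\<lambda>\<alpha>. h (weight (c # \<alpha>)) * R ((c + k) # \<alpha>)"])
      show "h (weight (c # \<beta> @ u # v # \<alpha>)) * R ((c + k) # \<beta> @ u # v # \<alpha>)
        = h (weight (c # \<beta> @ v # u # \<alpha>)) * R ((c + k) # \<beta> @ v # u # \<alpha>)" for \<beta> u v \<alpha>
        using weight_swap[of "c # \<beta>" u v \<alpha>] seqP_swap[OF finite_S, of x "(c + k) # \<beta>" u v \<alpha>]
        by (simp add: h_minus del: weight.simps seqP.simps)
      show "mset (A @ B) = mset (sorted_list_of_set (Z - {c}))"
        using dist setAB Z by (subst set_eq_iff_mset_eq_distinct[symmetric]) auto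
    qed
    finally show ?case unfolding c_def by simp
  qed
  also have "\<dots> = (\<Sum>c\<in>Z. if c + k \<notin> Z then h (shift_ratio (c + k) k (Z - {c})) * Hs (insert (c + k) (Z - {c})) else 0)"
  proof (rule sum.cong[OF refl])
    fix c assume c: "c \<in> Z"
    then have "c > 0" using Z by (metis gr0I)
    then show "h (weight (c # sorted_list_of_set (Z - {c}))) * R ((c + k) # sorted_list_of_set (Z - {c})) =
      (if c + k \<notin> Z then h (shift_ratio (c + k) k (Z - {c})) * Hs (insert (c + k) (Z - {c})) else 0)"
      using term_shift[of "Z - {c}" c k] Z k0 by simp
  qed
  also have "\<dots> = (\<Sum>c | c \<in> Z \<and> c + k \<notin> Z. h (shift_ratio (c + k) k (Z - {c})) * Hs (insert (c + k) (Z - {c})))"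
    by (simp only: sum.inter_filter[symmetric] Z)
  finally show ?thesis using term_single[OF Z k0] by simp
qed

text \<open>The coefficients are collected at the resulting set \<open>Y\<close>. A new part \<open>k\<close> counts as a part that was raised
from 0, which is why the sum in \<open>spin_phi\<close> includes the case \<open>d = k\<close>.\<close>

lemma power_sum_times_sum_Hs:
  assumes k: "odd k"
  shows "(\<Sum>i\<in>S. x i ^ k) * (\<Sum>Z\<in>pos_sets m. Hs Z) = (\<Sum>Y\<in>pos_sets (m + k). h (spin_phi k Y) * Hs Y)"
proof -
  have k0: "k > 0" using k by (rule odd_pos)
  let ?T = "\<lambda>d Y. h (shift_ratio d k (Y - {d})) * Hs Y"
  have fZ: "finite Z" if "Z \<in> pos_sets n" for Z n using that by (simp add: pos_sets_def)
  have A: "(\<Sum>Z\<in>pos_sets m. \<Sum>c | c \<in> Z \<and> c + k \<notin> Z. h (shift_ratio (c + k) k (Z - {c})) * Hs (insert (c + k) (Z - {c})))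
    = (\<Sum>Y\<in>pos_sets (m + k). \<Sum>d | d \<in> Y \<and> k < d \<and> d - k \<notin> Y. ?T d Y)"
  proof -
    have "(\<Sum>Z\<in>pos_sets m. \<Sum>c | c \<in> Z \<and> c + k \<notin> Z. h (shift_ratio (c + k) k (Z - {c})) * Hs (insert (c + k) (Z - {c})))
      = (\<Sum>(Z,c)\<in>(SIGMA Z:pos_sets m. {c \<in> Z. c + k \<notin> Z}). h (shift_ratio (c + k) k (Z - {c})) * Hs (insert (c + k) (Z - {c})))"
      using fZ by (intro sum.Sigma) auto
    also have "\<dots> = (\<Sum>(Y,d)\<in>(SIGMA Y:pos_sets (m + k). {d \<in> Y. k < d \<and> d - k \<notin> Y}). ?T d Y)"
    proof (rule sum.reindex_bij_witness[of _ "\<lambda>(Y,d). (insert (d - k) (Y - {d}), d - k)"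
          "\<lambda>(Z,c). (insert (c + k) (Z - {c}), c + k)"], goal_cases)
      case (2 a)
      then show ?case using k0 by (auto simp: pos_sets_def sum.remove intro!: gr0I)
    next
      case (4 b)
      then show ?case using k0 by (auto simp: pos_sets_def sum.remove intro!: gr0I)
    next
      case (5 a)
      then show ?case using k0 by (auto simp: pos_sets_def)
    qed (use k0 in auto)
    also have "\<dots> = (\<Sum>Y\<in>pos_sets (m + k). \<Sum>d | d \<in> Y \<and> k < d \<and> d - k \<notin> Y. ?T d Y)"
      using fZ by (intro sum.Sigma[symmetric]) auto
    finally show ?thesis .
  qed
  have B: "(\<Sum>Z\<in>pos_sets m. if k \<in> Z then 0 else h (shift_ratio k k Z) * Hs (insert k Z))
    = (\<Sum>Y\<in>pos_sets (m + k). if k \<in> Y then ?T k Y else 0)"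
  proof -
    have "(\<Sum>Z\<in>pos_sets m. if k \<in> Z then 0 else h (shift_ratio k k Z) * Hs (insert k Z))
      = (\<Sum>Z | Z \<in> pos_sets m \<and> k \<notin> Z. h (shift_ratio k k Z) * Hs (insert k Z))"
      by (simp add: sum.inter_filter if_distrib)  (rule sum.cong, auto)
    also have "\<dots> = (\<Sum>Y | Y \<in> pos_sets (m + k) \<and> k \<in> Y. ?T k Y)"
      by (rule sum.reindex_bij_witness[of _ "\<lambda>Y. Y - {k}" "insert k"])
         (use k0 in \<open>auto simp: pos_sets_def sum.remove\<close>)
    finally show ?thesis by (simp add: sum.inter_filter)
  qed
  let ?P = "\<lambda>u w Y. h (pair_ratio u w (Y - {u} - {w})) * Hs Y"
  have C: "(\<Sum>Z\<in>pos_sets m. \<Sum>w | w \<in> {1..<k} \<and> k - w \<notin> Z \<and> w \<notin> Z. h (pair_ratio (k - w) w Z) * Hs (insert (k - w) (insert w Z)))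
    = (\<Sum>Y\<in>pos_sets (m + k). \<Sum>(u,w) | u \<in> Y \<and> w \<in> Y \<and> u + w = k. ?P u w Y)"
  proof -
    have "(\<Sum>Z\<in>pos_sets m. \<Sum>w | w \<in> {1..<k} \<and> k - w \<notin> Z \<and> w \<notin> Z. h (pair_ratio (k - w) w Z) * Hs (insert (k - w) (insert w Z)))
      = (\<Sum>(Z,w)\<in>(SIGMA Z:pos_sets m. {w. w \<in> {1..<k} \<and> k - w \<notin> Z \<and> w \<notin> Z}). h (pair_ratio (k - w) w Z) * Hs (insert (k - w) (insert w Z)))"
      by (intro sum.Sigma) auto
    also have "\<dots> = (\<Sum>(Y,(u,w))\<in>(SIGMA Y:pos_sets (m + k). {(u,w). u \<in> Y \<and> w \<in> Y \<and> u + w = k}). ?P u w Y)"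
    proof (rule sum.reindex_bij_witness[of _ "\<lambda>(Y,(u,w)). (Y - {u} - {w}, w)"
          "\<lambda>(Z,w). (insert (k - w) (insert w Z), (k - w, w))"], goal_cases)
      case (1 a)
      then show ?case by auto
    next
      case (2 a)
      then obtain Z w where a: "a = (Z,w)" "Z \<in> pos_sets m" "1 \<le> w" "w < k" "k - w \<notin> Z" "w \<notin> Z" by auto
      have "k - w \<noteq> w" using k a by presburger
      then show ?case using a by (auto simp: pos_sets_def)
    next
      case (3 b)
      then obtain Y u w where b: "b = (Y,(u,w))" "Y \<in> pos_sets (m+k)" "u \<in> Y" "w \<in> Y" "u + w = k" by auto
      have "u \<noteq> w" using k b by auto
      then show ?case using b by auto
    next
      case (4 b)
      then obtain Y u w where b: "b = (Y,(u,w))" "Y \<in> pos_sets (m+k)" "u \<in> Y" "w \<in> Y" "u + w = k" by auto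
      have uw: "u \<noteq> w" using k b by auto
      have pos: "u > 0" "w > 0" using b by (auto simp: pos_sets_def intro: gr0I)
      have "\<Sum>Y = u + (w + \<Sum>(Y - {u} - {w}))" using b uw
        by (auto simp: pos_sets_def sum.remove[of Y u] sum.remove[of "Y - {u}" w])
      then show ?case using b pos by (auto simp: pos_sets_def)
    next
      case (5 a)
      then obtain Z w where a: "a = (Z,w)" "Z \<in> pos_sets m" "1 \<le> w" "w < k" "k - w \<notin> Z" "w \<notin> Z" by auto
      have "k - w \<noteq> w" using k a by presburger
      then have "insert (k - w) (insert w Z) - {k - w} - {w} = Z" using a by auto
      then show ?case using a by simp
    qed
    also have "\<dots> = (\<Sum>Y\<in>pos_sets (m + k). \<Sum>(u,w) | u \<in> Y \<and> w \<in> Y \<and> u + w = k. ?P u w Y)"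
      by (subst sum.Sigma) (auto intro: finite_subset[OF _ finite_cartesian_product[OF fZ fZ]] simp: case_prod_unfold)
    finally show ?thesis .
  qed
  have "(\<Sum>i\<in>S. x i ^ k) * (\<Sum>Z\<in>pos_sets m. Hs Z) = (\<Sum>Z\<in>pos_sets m. (\<Sum>i\<in>S. x i ^ k) * Hs Z)"
    by (rule sum_distrib_left)
  also have "\<dots> = (\<Sum>Y\<in>pos_sets (m + k). \<Sum>d | d \<in> Y \<and> k < d \<and> d - k \<notin> Y. ?T d Y)
     + (\<Sum>Y\<in>pos_sets (m + k). if k \<in> Y then ?T k Y else 0)
     + (\<Sum>Y\<in>pos_sets (m + k). \<Sum>(u,w) | u \<in> Y \<and> w \<in> Y \<and> u + w = k. ?P u w Y)"
    unfolding A[symmetric] B[symmetric] C[symmetric] sum.distrib[symmetric]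
    by (intro sum.cong refl power_sum_times_Hs k) (auto simp: pos_sets_def)
  also have "\<dots> = (\<Sum>Y\<in>pos_sets (m + k). h (spin_phi k Y) * Hs Y)"
    unfolding sum.distrib[symmetric]
  proof (rule sum.cong[OF refl])
    fix Y assume Y: "Y \<in> pos_sets (m + k)"
    have 1: "(\<Sum>d | d \<in> Y \<and> k \<le> d. ?T d Y) = (\<Sum>d | d \<in> Y \<and> k < d \<and> d - k \<notin> Y. ?T d Y) + (if k \<in> Y then ?T k Y else 0)"
    proof -
      have "shift_ratio d k (Y - {d}) = 0" if "d \<in> Y" "k < d" "d - k \<in> Y" for d
      proof -
        have "(\<Prod>b\<in>Y - {d}. (of_nat (d - k) - of_nat b) * (of_nat d + of_nat b) /
             ((of_nat (d - k) + of_nat b) * (of_nat d - of_nat b))) = (0::complex)"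
          by (rule prod_zero) (use that k0 fZ[OF Y] in \<open>auto intro!: bexI[of _ "d - k"]\<close>)
        then show ?thesis unfolding shift_ratio_def by simp
      qed
      then have "(\<Sum>d | d \<in> Y \<and> k < d \<and> d - k \<notin> Y. ?T d Y) = (\<Sum>d | d \<in> Y \<and> k < d. ?T d Y)"
        using fZ[OF Y] by (intro sum.mono_neutral_left) (auto simp: h_zero)
      moreover have "{d. d \<in> Y \<and> k \<le> d} = (if k \<in> Y then insert k {d. d \<in> Y \<and> k < d} else {d. d \<in> Y \<and> k < d})"
        by (auto simp: le_less)
      ultimately show ?thesis using fZ[OF Y] by auto
    qed
    show "(\<Sum>d | d \<in> Y \<and> k < d \<and> d - k \<notin> Y. ?T d Y) + (if k \<in> Y then ?T k Y else 0)
       + (\<Sum>(u,w) | u \<in> Y \<and> w \<in> Y \<and> u + w = k. ?P u w Y) = h (spin_phi k Y) * Hs Y"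
      unfolding 1[symmetric] spin_phi_def h_add h_sum distrib_right sum_distrib_right
      by (intro arg_cong2[of _ _ _ _ "(+)"] sum.cong refl) (auto simp: h_sum)
  qed
  finally show ?thesis .
qed

text \<open>By the previous lemma with \<open>k = 1\<close>, where \<open>spin_phi\<close> is the sum of the parts, hence constant on the sets of a
given sum.\<close>

lemma power_one_expansion: "(\<Sum>i\<in>S. x i) ^ m = h (fact m) * (\<Sum>Z\<in>pos_sets m. Hs Z)"
proof (induction m)
  case 0
  have "pos_sets 0 = {{}}" by (auto simp: pos_sets_def)
  then show ?case by (simp add: Hs_def h_one)
next
  case (Suc m)
  have "(\<Sum>i\<in>S. x i) ^ Suc m = h (fact m) * ((\<Sum>i\<in>S. x i ^ 1) * (\<Sum>Z\<in>pos_sets m. Hs Z))"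
    using Suc by (simp add: mult_ac)
  also have "\<dots> = h (fact m) * (\<Sum>Y\<in>pos_sets (m + 1). h (of_nat (m + 1)) * Hs Y)"
    unfolding power_sum_times_sum_Hs[of 1, simplified odd_one]
    by (subst power_sum_times_sum_Hs, simp, intro arg_cong2[of _ _ _ _ "(*)"] refl sum.cong)
       (auto simp: spin_phi_one[unfolded One_nat_def] pos_sets_def)
  also have "\<dots> = h (fact (Suc m)) * (\<Sum>Z\<in>pos_sets (Suc m). Hs Z)"
    unfolding sum_distrib_left[symmetric] fact_Suc h_mult by (simp add: mult_ac)
  finally show ?case .
qed

lemma power_sum_one_expansion:
  assumes "odd k"
  shows "(\<Sum>i\<in>S. x i ^ k) * (\<Sum>i\<in>S. x i) ^ m = (\<Sum>Y\<in>pos_sets (m + k). h (fact m * spin_phi k Y) * Hs Y)"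
proof -
  have "(\<Sum>i\<in>S. x i ^ k) * (\<Sum>i\<in>S. x i) ^ m
    = h (fact m) * ((\<Sum>i\<in>S. x i ^ k) * (\<Sum>Z\<in>pos_sets m. Hs Z))"
    unfolding power_one_expansion by (rule mult.left_commute)
  then show ?thesis unfolding power_sum_times_sum_Hs[OF assms] by (simp only: h_mult sum_distrib_left mult.assoc)
qed

end

section \<open>Comparison with the Hall-Littlewood functions at t = -1\<close>

text \<open>The ways to distribute the parts of \<open>\<xi>\<close> to the variables; the variables without a part have exponent 0.\<close>

definition arrangements :: "nat set \<Rightarrow> nat list \<Rightarrow> (nat \<Rightarrow> nat) set" where
  "arrangements S \<xi> = {a. (\<forall>i. i \<notin> S \<longrightarrow> a i = 0) \<and> bij_betw a {i. a i \<noteq> 0} (set \<xi>)}"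

definition arrP :: "(nat \<Rightarrow> 'a::field) \<Rightarrow> nat set \<Rightarrow> nat list \<Rightarrow> 'a" where
  "arrP x S \<xi> = (\<Sum>a\<in>arrangements S \<xi>. (\<Prod>i\<in>S. x i ^ a i) *
     (\<Prod>(i, j)\<in>{(i, j). i \<in> S \<and> j \<in> S \<and> a j < a i}. tau x i j))"

lemma finite_arrangements: assumes "finite S" shows "finite (arrangements S \<xi>)"
proof -
  have "arrangements S \<xi> \<subseteq> {f. \<forall>i. (i \<in> S \<longrightarrow> f i \<in> insert 0 (set \<xi>)) \<and> (i \<notin> S \<longrightarrow> f i = 0)}"
    by (auto simp: arrangements_def bij_betw_def)
  moreover have "finite {f. \<forall>i. (i \<in> S \<longrightarrow> f i \<in> insert 0 (set \<xi>)) \<and> (i \<notin> S \<longrightarrow> f i = 0)}"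
    by (rule finite_set_of_finite_funs) (use assms in auto)
  ultimately show ?thesis by (rule finite_subset)
qed

text \<open>The largest part \<open>v\<close> sits at a variable \<open>i\<close>, and all pairs that start with \<open>i\<close> contribute a factor.\<close>

lemma arrP_Cons:
  assumes S: "finite S" and v: "\<And>u. u \<in> set \<xi> \<Longrightarrow> 0 < u \<and> u < v" "0 < v"
  shows "arrP x S (v # \<xi>) = (\<Sum>i\<in>S. x i ^ v * (\<Prod>j\<in>S-{i}. tau x i j) * arrP x (S - {i}) \<xi>)"
proof -
  let ?f = "\<lambda>S a. (\<Prod>i\<in>S. x i ^ a i) * (\<Prod>(i, j)\<in>{(i, j). i \<in> S \<and> j \<in> S \<and> a j < a i}. tau x i j)"
  have vx: "v \<notin> set \<xi>" "0 \<notin> set \<xi>" using v by auto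
  have key: "a(i := v) \<in> arrangements S (v # \<xi>) \<and> (THE j. (a(i := v)) j = v) = i \<and> a i = 0 \<and> (\<forall>j. a j < v)"
    if "i \<in> S" "a \<in> arrangements (S - {i}) \<xi>" for i a
  proof -
    have ai: "a i = 0" and az: "\<And>j. j \<notin> S \<Longrightarrow> a j = 0" and b: "bij_betw a {j. a j \<noteq> 0} (set \<xi>)"
      using that by (auto simp: arrangements_def)
    have lt: "a j < v" for j
      by (cases "a j = 0") (use v b in \<open>auto simp: bij_betw_def\<close>)
    have s: "{j. (a(i := v)) j \<noteq> 0} = insert i {j. a j \<noteq> 0}" using v ai by auto
    have "bij_betw (a(i := v)) {j. a j \<noteq> 0} (set \<xi>)"
      using b ai by (subst bij_betw_cong[of _ _ a]) auto
    moreover have "bij_betw (a(i := v)) {i} {v}" by simp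
    ultimately have "bij_betw (a(i := v)) ({i} \<union> {j. a j \<noteq> 0}) ({v} \<union> set \<xi>)"
      using vx by (intro bij_betw_combine) auto
    then have "bij_betw (a(i := v)) (insert i {j. a j \<noteq> 0}) (insert v (set \<xi>))" by simp
    moreover have "(THE j. (a(i := v)) j = v) = i"
    proof (rule the_equality)
      show "j = i" if "(a(i := v)) j = v" for j
        using lt[of j] that by (cases "j = i") auto
    qed simp
    ultimately show ?thesis using that az ai lt s by (auto simp: arrangements_def)
  qed
  have key2: "\<exists>i\<in>S. a i = v \<and> (\<forall>j. a j = v \<longrightarrow> j = i) \<and> a(i := 0) \<in> arrangements (S - {i}) \<xi>"
    if a: "a \<in> arrangements S (v # \<xi>)" for a
  proof -
    have az: "\<And>j. j \<notin> S \<Longrightarrow> a j = 0" and b: "bij_betw a {j. a j \<noteq> 0} (insert v (set \<xi>))"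
      using a by (auto simp: arrangements_def)
    obtain i where i: "a i = v" using b by (auto simp: bij_betw_def) (metis (mono_tags) imageE insertI1)
    have u: "j = i" if "a j = v" for j
      using b i that v by (auto simp: bij_betw_def inj_on_def)
    have iS: "i \<in> S" using i az v by (metis less_irrefl)
    have s: "{j. (a(i := 0)) j \<noteq> 0} = {j. a j \<noteq> 0} - {i}" using v i by auto
    have "bij_betw a ({j. a j \<noteq> 0} - {i}) (insert v (set \<xi>) - {a i})"
      using b by (rule bij_betw_DiffI) (use i v in \<open>auto simp: bij_betw_def\<close>)
    then have "bij_betw (a(i := 0)) ({j. a j \<noteq> 0} - {i}) (set \<xi>)"
      using vx i by (subst bij_betw_cong[of _ _ a]) auto
    then have "a(i := 0) \<in> arrangements (S - {i}) \<xi>"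
      unfolding arrangements_def mem_Collect_eq s using az by simp
    then show ?thesis using i u iS by blast
  qed
  have "(\<Sum>i\<in>S. x i ^ v * (\<Prod>j\<in>S-{i}. tau x i j) * arrP x (S - {i}) \<xi>)
    = (\<Sum>(i,a)\<in>(SIGMA i:S. arrangements (S - {i}) \<xi>). x i ^ v * (\<Prod>j\<in>S-{i}. tau x i j) * ?f (S - {i}) a)"
    unfolding arrP_def sum_distrib_left
    by (rule sum.Sigma) (use S finite_arrangements in auto)
  also have "\<dots> = (\<Sum>a\<in>arrangements S (v # \<xi>). ?f S a)"
  proof (rule sum.reindex_bij_witness[of _ "\<lambda>a. (THE i. a i = v, a((THE i. a i = v) := 0))" "\<lambda>(i,a). a(i := v)"], goal_cases)
    case (1 p)
    obtain i a where p: "p = (i,a)" by force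
    then show ?case using key[of i a] 1 by auto
  next
    case (2 p)
    obtain i a where p: "p = (i,a)" by force
    then show ?case using key[of i a] 2 by auto
  next
    case (3 a)
    then obtain i where i: "i \<in> S" "a i = v" "\<And>j. a j = v \<Longrightarrow> j = i" using key2 by blast
    have "(THE i. a i = v) = i" by (rule the_equality) (rule i(2), erule i(3))
    then show ?case using i(1,2) by auto
  next
    case (4 a)
    then obtain i where i: "i \<in> S" "a i = v" "\<And>j. a j = v \<Longrightarrow> j = i" "a(i := 0) \<in> arrangements (S - {i}) \<xi>"
      using key2 by blast
    have "(THE i. a i = v) = i" by (rule the_equality) (rule i(2), erule i(3))
    then show ?case using i(1,4) by auto
  next
    case (5 p)
    obtain i a where p: "p = (i,a)" by force
    then have i: "i \<in> S" and ai: "a i = 0" and lt: "\<And>j. a j < v" using 5 key[of i a] by auto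
    have e: "{(k, j). k \<in> S \<and> j \<in> S \<and> (a(i := v)) j < (a(i := v)) k}
      = {(k, j). k \<in> S - {i} \<and> j \<in> S - {i} \<and> a j < a k} \<union> Pair i ` (S - {i})"
      using i ai lt by (auto split: if_splits) (metis not_less_iff_gr_or_eq)+
    have fin: "finite {(k, j). k \<in> S - {i} \<and> j \<in> S - {i} \<and> a j < a k}"
      by (rule finite_subset[of _ "S \<times> S"]) (use S in auto)
    have "(\<Prod>(k, j)\<in>{(k, j). k \<in> S \<and> j \<in> S \<and> (a(i := v)) j < (a(i := v)) k}. tau x k j)
      = (\<Prod>(k, j)\<in>{(k, j). k \<in> S - {i} \<and> j \<in> S - {i} \<and> a j < a k}. tau x k j) * (\<Prod>j\<in>S-{i}. tau x i j)"
      unfolding e using S fin by (subst prod.union_disjoint) (auto simp: prod.reindex inj_on_def)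
    moreover have "(\<Prod>j\<in>S. x j ^ (a(i := v)) j) = x i ^ v * (\<Prod>j\<in>S-{i}. x j ^ a j)"
      using S i by (simp add: prod.remove)
    ultimately show ?case unfolding p prod.case by (simp only: mult_ac)
  qed
  finally show ?thesis unfolding arrP_def by simp
qed

lemma arrP_Nil: assumes "finite S" shows "arrP x S [] = 1"
proof -
  have "arrangements S [] = {\<lambda>_. 0}" by (auto simp: arrangements_def bij_betw_def)
  then show ?thesis by (simp add: arrP_def)
qed

lemma strict_sorted: "strict_partition \<xi> \<longleftrightarrow> sorted_wrt (>) \<xi> \<and> 0 \<notin> set \<xi>"
proof -
  have "sorted_wrt (\<ge>) \<xi> \<and> distinct \<xi> \<longleftrightarrow> sorted_wrt (>) \<xi>"
    by (induction \<xi>) (auto simp: le_less)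
  then show ?thesis by (auto simp: strict_partition_def is_partition_def) (metis gr0I)
qed

lemma seqP_eq_arrP:
  assumes "strict_partition \<xi>" "finite S"
  shows "seqP x S \<xi> = arrP x S \<xi>"
  using assms
proof (induction \<xi> arbitrary: S)
  case Nil
  then show ?case by (simp add: arrP_Nil)
next
  case (Cons v \<xi>)
  have v: "0 < v" and u: "\<And>u. u \<in> set \<xi> \<Longrightarrow> 0 < u \<and> u < v" and s: "strict_partition \<xi>"
    using Cons.prems(1) by (auto simp: strict_sorted intro!: gr0I)
  have "seqP x (S - {i}) \<xi> = arrP x (S - {i}) \<xi>" for i
    by (rule Cons.IH) (use s Cons.prems(2) in auto)
  moreover have "arrP x S (v # \<xi>) = (\<Sum>i\<in>S. x i ^ v * (\<Prod>j\<in>S-{i}. tau x i j) * arrP x (S - {i}) \<xi>)"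
    by (rule arrP_Cons[OF Cons.prems(2) u v])
  ultimately show ?case by simp
qed

lemma arrangements_lessThan:
  assumes s: "strict_partition \<xi>" and len: "length \<xi> \<le> N"
  shows "{(\<lambda>i. if w i < length \<xi> then \<xi> ! w i else 0) | w. w permutes {..<N}} = arrangements {..<N} \<xi>"
proof (intro equalityI subsetI)
  have d: "distinct \<xi>" and z: "0 \<notin> set \<xi>" using s by (auto simp: strict_partition_def is_partition_def)
  have nz: "\<xi> ! j \<noteq> 0" if "j < length \<xi>" for j using z that by (metis nth_mem)
  fix a assume "a \<in> {(\<lambda>i. if w i < length \<xi> then \<xi> ! w i else 0) | w. w permutes {..<N}}"
  then obtain w where w: "w permutes {..<N}" and a: "a = (\<lambda>i. if w i < length \<xi> then \<xi> ! w i else 0)" by auto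
  have A: "{i. a i \<noteq> 0} = {i. w i < length \<xi>}" using nz by (auto simp: a)
  have "bij_betw w {i. w i < length \<xi>} {..<length \<xi>}"
    using permutes_bij[OF w] unfolding bij_betw_def by (auto intro: inj_on_subset)
  moreover have "bij_betw ((!) \<xi>) {..<length \<xi>} (set \<xi>)" using d by (intro bij_betw_nth) auto
  ultimately have "bij_betw ((!) \<xi> \<circ> w) {i. w i < length \<xi>} (set \<xi>)" by (rule bij_betw_trans)
  then have "bij_betw a {i. a i \<noteq> 0} (set \<xi>)" unfolding A by (subst bij_betw_cong[of _ _ "(!) \<xi> \<circ> w"]) (auto simp: a)
  moreover have "a i = 0" if "i \<notin> {..<N}" for i
    using permutes_not_in[OF w that] that len by (auto simp: a)
  ultimately show "a \<in> arrangements {..<N} \<xi>" by (auto simp: arrangements_def)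
next
  have d: "distinct \<xi>" and z: "0 \<notin> set \<xi>" using s by (auto simp: strict_partition_def is_partition_def)
  fix a assume "a \<in> arrangements {..<N} \<xi>"
  then have az: "\<And>i. i \<notin> {..<N} \<Longrightarrow> a i = 0" and b: "bij_betw a {i. a i \<noteq> 0} (set \<xi>)" by (auto simp: arrangements_def)
  let ?A = "{i. a i \<noteq> 0}"
  have AN: "?A \<subseteq> {..<N}" by (rule subsetI, rule ccontr) (use az in auto)
  have nb: "bij_betw ((!) \<xi>) {..<length \<xi>} (set \<xi>)" using d by (intro bij_betw_nth) auto
  obtain f where f: "bij_betw f ?A {..<length \<xi>}" and fa: "\<And>i. i \<in> ?A \<Longrightarrow> \<xi> ! f i = a i"
  proof
    show "bij_betw (inv_into {..<length \<xi>} ((!) \<xi>) \<circ> a) ?A {..<length \<xi>}"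
      using bij_betw_trans[OF b bij_betw_inv_into[OF nb]] .
    show "\<xi> ! (inv_into {..<length \<xi>} ((!) \<xi>) \<circ> a) i = a i" if "i \<in> ?A" for i
      using bij_betw_inv_into_right[OF nb, of "a i"] b that by (auto simp: bij_betw_def)
  qed
  have "card ?A = length \<xi>" using bij_betw_same_card[OF f] by simp
  then have "card ({..<N} - ?A) = card ({..<N} - {..<length \<xi>})"
    using AN len finite_subset[OF AN] by (simp add: card_Diff_subset)
  then obtain g where g: "bij_betw g ({..<N} - ?A) ({..<N} - {..<length \<xi>})"
    using finite_same_card_bij by (metis finite_Diff finite_lessThan)
  define w where "w i = (if i \<in> ?A then f i else if i < N then g i else i)" for i
  have w1: "bij_betw w ?A {..<length \<xi>}" using f by (subst bij_betw_cong[of _ _ f]) (auto simp: w_def)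
  have w2: "bij_betw w ({..<N} - ?A) ({..<N} - {..<length \<xi>})"
    using g by (subst bij_betw_cong[of _ _ g]) (auto simp: w_def)
  have "bij_betw w (?A \<union> ({..<N} - ?A)) ({..<length \<xi>} \<union> ({..<N} - {..<length \<xi>}))"
    by (rule bij_betw_combine[OF w1 w2]) auto
  moreover have "?A \<union> ({..<N} - ?A) = {..<N}" using AN by auto
  moreover have "{..<length \<xi>} \<union> ({..<N} - {..<length \<xi>}) = {..<N}" using len by auto
  ultimately have "w permutes {..<N}"
    using az by (intro bij_imp_permutes) (auto simp: w_def)
  moreover have "a i = (if w i < length \<xi> then \<xi> ! w i else 0)" for i
  proof (cases "i \<in> ?A")
    case True
    then have "w i = f i" "f i < length \<xi>" using f by (auto simp: w_def bij_betw_def)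
    then show ?thesis using fa[OF True] by simp
  next
    case False
    then have "w i \<ge> length \<xi>" using g len by (auto simp: w_def bij_betw_def)
    then show ?thesis using False by simp
  qed
  ultimately show "a \<in> {(\<lambda>i. if w i < length \<xi> then \<xi> ! w i else 0) | w. w permutes {..<N}}" by blast
qed

text \<open>If the partition is longer than the number of variables, both sides are zero.\<close>

lemma schur_P_eq_seqP:
  assumes "strict_partition \<xi>"
  shows "schur_P N x \<xi> = seqP x {..<N} \<xi>"
proof (cases "length \<xi> \<le> N")
  case True
  then show ?thesis unfolding seqP_eq_arrP[OF assms finite_lessThan] schur_P_def hall_littlewood_P_def arrP_def
    by (simp add: arrangements_lessThan[OF assms] tau_def case_prod_unfold)
next
  case False
  then show ?thesis by (simp add: schur_P_def hall_littlewood_P_def seqP_long)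
qed

lemma bij_strict_partitions: "bij_betw set (strict_partitions_of n) (pos_sets n)"
proof (rule bij_betwI[of _ _ _ "\<lambda>Z. rev (sorted_list_of_set Z)"])
  show "set \<in> strict_partitions_of n \<rightarrow> pos_sets n"
  proof
    fix \<xi> assume "\<xi> \<in> strict_partitions_of n"
    then have "distinct \<xi>" "0 \<notin> set \<xi>" "sum_list \<xi> = n"
      by (auto simp: strict_partitions_of_def strict_partition_def is_partition_def)
    then show "set \<xi> \<in> pos_sets n" by (simp add: pos_sets_def distinct_sum_list_conv_Sum)
  qed
  show "(\<lambda>Z. rev (sorted_list_of_set Z)) \<in> pos_sets n \<rightarrow> strict_partitions_of n"
  proof
    fix Z assume "Z \<in> pos_sets n"
    then have Z: "finite Z" "0 \<notin> Z" "\<Sum>Z = n" by (auto simp: pos_sets_def)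
    then have "sum_list (sorted_list_of_set Z) = n"
      using distinct_sum_list_conv_Sum[of "sorted_list_of_set Z"] by simp
    moreover have "sorted_wrt (<) (sorted_list_of_set Z)" by simp
    ultimately show "rev (sorted_list_of_set Z) \<in> strict_partitions_of n"
      using Z by (simp add: strict_partitions_of_def strict_sorted sorted_wrt_rev)
  qed
  show "rev (sorted_list_of_set (set \<xi>)) = \<xi>" if "\<xi> \<in> strict_partitions_of n" for \<xi>
  proof -
    have "sorted_wrt (<) (rev \<xi>)" using that by (simp add: strict_partitions_of_def strict_sorted sorted_wrt_rev)
    then have "sorted_list_of_set (set (rev \<xi>)) = rev \<xi>"
      using sorted_list_of_set.idem_if_sorted_distinct strict_sorted_iff by blast
    then show ?thesis by simp
  qed
  show "set (rev (sorted_list_of_set Z)) = Z" if "Z \<in> pos_sets n" for Z using that by (simp add: pos_sets_def)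
qed

section \<open>Indeterminates and monomials in the field of rational functions\<close>

type_synonym polyfun = "(nat \<Rightarrow>\<^sub>0 nat) \<Rightarrow>\<^sub>0 complex"

definition emb :: "polyfun \<Rightarrow> ratfun" where "emb p = Fract p 1"

lemma emb_hom [simp]: "emb 0 = 0" "emb 1 = 1" "emb (p + q) = emb p + emb q" "emb (p * q) = emb p * emb q"
  by (auto simp: emb_def Zero_fract_def One_fract_def)

lemma emb_inj: "emb p = emb q \<longleftrightarrow> p = q" by (simp add: emb_def eq_fract)

lemma emb_prod: "emb (prod f A) = (\<Prod>i\<in>A. emb (f i))"
  by (induction A rule: infinite_finite_induct) auto

lemma emb_sum: "emb (sum f A) = (\<Sum>i\<in>A. emb (f i))"
  by (induction A rule: infinite_finite_induct) auto

lemma emb_power: "emb (p ^ n) = emb p ^ n" by (induction n) auto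

lemma const_fun_emb: "const_fun c = emb (Poly_Mapping.single 0 c)" by (simp add: const_fun_def emb_def)
lemma indet_emb: "indet i = emb (Poly_Mapping.single (Poly_Mapping.single i 1) 1)" by (simp add: indet_def emb_def)

definition mon :: "nat \<Rightarrow> (nat \<Rightarrow> nat) \<Rightarrow> nat \<Rightarrow>\<^sub>0 nat" where
  "mon N a = (\<Sum>i<N. Poly_Mapping.single i (a i))"

lemma lookup_mon: "Poly_Mapping.lookup (mon N a) i = (if i < N then a i else 0)"
  by (simp add: mon_def lookup_sum lookup_single when_def)

lemma single_power: "Poly_Mapping.single (Poly_Mapping.single i 1) (1::complex) ^ m = Poly_Mapping.single (Poly_Mapping.single i m) 1"
  for i :: nat
proof (induction m)
  case (Suc m)
  then show ?case by (simp add: mult_single flip: single_add)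
qed simp

lemma single_prod: "(\<Prod>i\<in>A. Poly_Mapping.single (f i) (1::complex)) = Poly_Mapping.single (sum f A) 1"
  for f :: "'b \<Rightarrow> nat \<Rightarrow>\<^sub>0 nat"
  by (induction A rule: infinite_finite_induct) (auto simp: mult_single)

lemma monomial_emb: "(\<Prod>i<N. indet i ^ a i) = emb (Poly_Mapping.single (mon N a) 1)"
  unfolding indet_emb emb_power[symmetric] single_power emb_prod[symmetric] single_prod mon_def ..

text \<open>Distinct monomials are distinct basis elements of the ring of polynomials, which embeds into its field
of fractions.\<close>

lemma monomials_independent:
  assumes fin: "finite I" and supp: "\<And>t i. t \<in> I \<Longrightarrow> i \<ge> N \<Longrightarrow> a t i = 0" and inj: "inj_on a I"
    and zero: "(\<Sum>t\<in>I. const_fun (c t) * (\<Prod>i<N. indet i ^ a t i)) = 0" and t: "t \<in> I"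
  shows "c t = 0"
proof -
  have "emb (\<Sum>t\<in>I. Poly_Mapping.single (mon N (a t)) (c t)) = emb 0"
    using zero by (simp add: emb_sum const_fun_emb monomial_emb mult_single flip: emb_hom(4))
  then have z: "(\<Sum>t\<in>I. Poly_Mapping.single (mon N (a t)) (c t)) = 0" by (simp only: emb_inj)
  have m: "mon N (a s) = mon N (a t) \<longleftrightarrow> s = t" if "s \<in> I" for s
  proof
    assume e: "mon N (a s) = mon N (a t)"
    have "a s i = a t i" for i
      using arg_cong[OF e, of "\<lambda>f. Poly_Mapping.lookup f i"] supp[OF \<open>s \<in> I\<close>, of i] supp[OF t, of i]
      by (cases "i < N") (auto simp: lookup_mon)
    then have "a s = a t" by (rule ext)
    then show "s = t" using inj_onD[OF inj _ that t] by simp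
  qed simp
  have "0 = (\<Sum>s\<in>I. Poly_Mapping.lookup (Poly_Mapping.single (mon N (a s)) (c s)) (mon N (a t)))"
    using arg_cong[OF z, of "\<lambda>f. Poly_Mapping.lookup f (mon N (a t))"] by (simp add: lookup_sum)
  also have "\<dots> = (\<Sum>s\<in>I. if s = t then c t else 0)"
    using m by (intro sum.cong refl) (auto simp: lookup_single when_def)
  also have "\<dots> = c t" using fin t by simp
  finally show ?thesis by simp
qed

lemma lookup_single_single:
  "Poly_Mapping.lookup (Poly_Mapping.single (Poly_Mapping.single i 1) 1 :: polyfun) (Poly_Mapping.single j 1)
    = (if i = j then 1 else 0)" for i j :: nat
proof -
  have "i = j" if "Poly_Mapping.single i (1::nat) = Poly_Mapping.single j 1"
    using that by (metis lookup_single_eq lookup_single_not_eq one_neq_zero)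
  then show ?thesis by (auto simp: lookup_single when_def)
qed

lemma indet_add_nonzero: "indet i + indet j \<noteq> 0"
proof -
  let ?s = "\<lambda>i. Poly_Mapping.single (Poly_Mapping.single i 1) 1 :: polyfun"
  have "Poly_Mapping.lookup (?s i + ?s j) (Poly_Mapping.single i 1) \<noteq> 0"
    by (simp only: lookup_add lookup_single_single) auto
  then have "?s i + ?s j \<noteq> 0" by (metis lookup_zero)
  then have "emb (?s i + ?s j) \<noteq> emb 0" by (simp only: emb_inj) simp
  then show "indet i + indet j \<noteq> 0" by (simp add: indet_emb)
qed

lemma indet_inj: "indet i = indet j \<Longrightarrow> i = j"
proof -
  let ?s = "\<lambda>i. Poly_Mapping.single (Poly_Mapping.single i 1) 1 :: polyfun"
  assume "indet i = indet j"
  then have "?s i = ?s j" by (simp only: indet_emb emb_inj)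
  then have "Poly_Mapping.lookup (?s i) (Poly_Mapping.single i 1) = Poly_Mapping.lookup (?s j) (Poly_Mapping.single i 1)" by simp
  then show "i = j" unfolding lookup_single_single by (simp split: if_splits)
qed

interpretation sv: spin_variables indet "{..<N}" const_fun for N
proof
  show "inj_on indet {..<N}" by (intro inj_onI indet_inj)
  show "const_fun 1 = 1" by (simp add: const_fun_emb)
  show "const_fun (a + b) = const_fun a + const_fun b" for a b
    by (simp add: const_fun_emb single_add flip: emb_hom(3))
  show "const_fun (a * b) = const_fun a * const_fun b" for a b
    by (simp add: const_fun_emb mult_single flip: emb_hom(4))
qed (auto simp: indet_add_nonzero)

section \<open>Linear independence of the P-functions\<close>

lemma finite_strict_partitions_of [simp]: "finite (strict_partitions_of n)"
  using bij_strict_partitions finite_pos_sets by (metis bij_betw_finite)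

text \<open>For injective exponents the product contains exactly one of \<open>tau x i j\<close> and \<open>tau x j i\<close> for every pair,
and they differ by the sign.\<close>

lemma alternant_sign:
  assumes "inj_on a {..<N}"
  shows "\<exists>s\<in>{1,-1}. (\<Prod>(i, j)\<in>{(i, j). i \<in> {..<N} \<and> j \<in> {..<N} \<and> a j < (a i :: nat)}. tau x i j)
    = s * (\<Prod>(i, j)\<in>{(i, j). i < j \<and> j < N}. tau x i j :: 'a::field)"
proof -
  let ?e = "\<lambda>(i, j). if a j < a i then 1 else - 1 :: 'a"
  have fin: "finite {(i, j). i < j \<and> j < N}" by (rule finite_subset[of _ "{..<N} \<times> {..<N}"]) auto
  have "(\<Prod>(i, j)\<in>{(i, j). i \<in> {..<N} \<and> j \<in> {..<N} \<and> a j < a i}. tau x i j)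
     = (\<Prod>p\<in>{(i, j). i < j \<and> j < N}. ?e p * (case p of (i, j) \<Rightarrow> tau x i j))"
  proof (rule prod.reindex_bij_witness[of _ "\<lambda>(i, j). if a j < a i then (i, j) else (j, i)"
        "\<lambda>(i, j). if i < j then (i, j) else (j, i)"], goal_cases)
    case (1 p)
    then show ?case by (auto split: if_splits)
  next
    case (2 p)
    obtain i j where p: "p = (i, j)" by force
    then have "i \<noteq> j" using 2 by auto
    then show ?case using 2 p by auto
  next
    case (3 p)
    then show ?case by (auto split: if_splits)
  next
    case (4 p)
    obtain i j where p: "p = (i, j)" by force
    then have "a i \<noteq> a j" using 4 inj_onD[OF assms, of i j] by auto
    then show ?case using 4 p by auto
  next
    case (5 p)
    obtain i j where p: "p = (i, j)" by force
    then have "i \<noteq> j" using 5 by auto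
    then show ?case using 5 p tau_swap[of x i j] by auto
  qed
  also have "\<dots> = prod ?e {(i, j). i < j \<and> j < N} * (\<Prod>(i, j)\<in>{(i, j). i < j \<and> j < N}. tau x i j)"
    by (rule prod.distrib)
  finally have "(\<Prod>(i, j)\<in>{(i, j). i \<in> {..<N} \<and> j \<in> {..<N} \<and> a j < a i}. tau x i j)
     = prod ?e {(i, j). i < j \<and> j < N} * (\<Prod>(i, j)\<in>{(i, j). i < j \<and> j < N}. tau x i j)" .
  moreover have "prod ?e A \<in> {1, - 1}" for A :: "(nat \<times> nat) set"
    by (induction A rule: infinite_finite_induct) auto
  ultimately show ?thesis by blast
qed

text \<open>By induction on the length \<open>N\<close> of the partition. With exactly \<open>N\<close> variables, the longer P-functions
vanish, and the shorter ones have zero coefficients by induction. In those of length \<open>N\<close> every variable has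
a positive exponent, all the exponents are distinct, and up to sign a common factor splits off; the
remaining monomials are distinct.\<close>

lemma schur_P_independent:
  assumes zero: "\<And>N. (\<Sum>\<zeta>\<in>strict_partitions_of n. const_fun (d \<zeta>) * schur_P N indet \<zeta>) = 0"
    and "\<zeta> \<in> strict_partitions_of n"
  shows "d \<zeta> = 0"
  using assms(2)
proof (induction "length \<zeta>" arbitrary: \<zeta> rule: less_induct)
  case less
  define N where "N = length \<zeta>"
  let ?P = "{\<zeta> \<in> strict_partitions_of n. length \<zeta> = N}"
  let ?I = "SIGMA \<zeta>:?P. arrangements {..<N} \<zeta>"
  define V where "V = (\<Prod>(i, j)\<in>{(i, j). i < j \<and> j < N}. tau indet i j)"
  have "tau indet i j \<noteq> 0" if "i < j" for i j
    unfolding tau_def using indet_add_nonzero[of i j] indet_inj[of i j] that by auto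
  moreover have fin: "finite {(i, j). i < j \<and> j < N}" by (rule finite_subset[of _ "{..<N} \<times> {..<N}"]) auto
  ultimately have V: "V \<noteq> 0" unfolding V_def by (auto simp: prod_zero_iff)
  have full: "inj_on a {..<N}" "a ` {..<N} = set \<xi>" "\<And>i. i \<ge> N \<Longrightarrow> a i = 0"
    if "\<xi> \<in> ?P" "a \<in> arrangements {..<N} \<xi>" for \<xi> a
  proof -
    have b: "bij_betw a {i. a i \<noteq> 0} (set \<xi>)" and az: "\<And>i. i \<notin> {..<N} \<Longrightarrow> a i = 0"
      using that by (auto simp: arrangements_def)
    have "distinct \<xi>" using that by (simp add: strict_partitions_of_def strict_partition_def)
    then have "card {i. a i \<noteq> 0} = N" using bij_betw_same_card[OF b] that distinct_card[of \<xi>] by simp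
    moreover have "{i. a i \<noteq> 0} \<subseteq> {..<N}" by (rule subsetI, rule ccontr) (use az in auto)
    ultimately have "{i. a i \<noteq> 0} = {..<N}" by (intro card_subset_eq) auto
    then show "inj_on a {..<N}" "a ` {..<N} = set \<xi>" using b by (auto simp: bij_betw_def)
    show "a i = 0" if "i \<ge> N" for i using az that by simp
  qed
  define s where "s a = (SOME s. s \<in> {1, - 1} \<and> (\<Prod>(i, j)\<in>{(i, j). i \<in> {..<N} \<and> j \<in> {..<N} \<and> a j < (a i :: nat)}. tau indet i j)
    = const_fun s * V)" for a
  have s: "s a \<in> {1, - 1} \<and> (\<Prod>(i, j)\<in>{(i, j). i \<in> {..<N} \<and> j \<in> {..<N} \<and> a j < (a i :: nat)}. tau indet i j)
    = const_fun (s a) * V" if "inj_on a {..<N}" for a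
  proof -
    note inj_a = that
    have c: "const_fun 1 = 1" "const_fun (- 1) = - 1" by (simp_all add: sv.h_one sv.h_minus)
    then have "\<exists>s. s \<in> {1, - 1} \<and> (\<Prod>(i, j)\<in>{(i, j). i \<in> {..<N} \<and> j \<in> {..<N} \<and> a j < (a i :: nat)}. tau indet i j)
      = const_fun s * V"
    proof -
      obtain t where t: "t \<in> {1, - 1}" "(\<Prod>(i, j)\<in>{(i, j). i \<in> {..<N} \<and> j \<in> {..<N} \<and> a j < (a i :: nat)}. tau indet i j) = t * V"
        using alternant_sign[OF inj_a, of indet] unfolding V_def by blast
      show ?thesis
      proof (cases "t = 1")
        case True
        then show ?thesis using t(2) c by (intro exI[of _ 1]) simp
      next
        case False
        then have "t = - 1" using t(1) by simp
        then show ?thesis using t(2) c by (intro exI[of _ "- 1"]) simp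
      qed
    qed
    then show ?thesis unfolding s_def by (rule someI_ex)
  qed
  have P: "schur_P N indet \<xi> = V * (\<Sum>a\<in>arrangements {..<N} \<xi>. const_fun (s a) * (\<Prod>i<N. indet i ^ a i))"
    if "\<xi> \<in> ?P" for \<xi>
  proof -
    have "schur_P N indet \<xi> = arrP indet {..<N} \<xi>"
      using that by (simp add: schur_P_eq_seqP seqP_eq_arrP strict_partitions_of_def)
    also have "\<dots> = (\<Sum>a\<in>arrangements {..<N} \<xi>. V * (const_fun (s a) * (\<Prod>i<N. indet i ^ a i)))"
      unfolding arrP_def
    proof (rule sum.cong[OF refl])
      fix a assume "a \<in> arrangements {..<N} \<xi>"
      then have "(\<Prod>(i, j)\<in>{(i, j). i \<in> {..<N} \<and> j \<in> {..<N} \<and> a j < (a i :: nat)}. tau indet i j)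
        = const_fun (s a) * V" using s full(1)[OF that] by blast
      then show "(\<Prod>i<N. indet i ^ a i) * (\<Prod>(i, j)\<in>{(i, j). i \<in> {..<N} \<and> j \<in> {..<N} \<and> a j < (a i :: nat)}. tau indet i j)
        = V * (const_fun (s a) * (\<Prod>i<N. indet i ^ a i))" by (simp only: mult_ac)
    qed
    finally show ?thesis by (simp only: sum_distrib_left)
  qed
  have "0 = (\<Sum>\<xi>\<in>strict_partitions_of n. const_fun (d \<xi>) * schur_P N indet \<xi>)" using zero by simp
  also have "\<dots> = (\<Sum>\<xi>\<in>?P. const_fun (d \<xi>) * schur_P N indet \<xi>)"
  proof (rule sum.mono_neutral_right)
    show "\<forall>\<xi>\<in>strict_partitions_of n - ?P. const_fun (d \<xi>) * schur_P N indet \<xi> = 0"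
    proof
      fix \<xi> assume x: "\<xi> \<in> strict_partitions_of n - ?P"
      show "const_fun (d \<xi>) * schur_P N indet \<xi> = 0"
      proof (cases "length \<xi> < N")
        case True
        then have "d \<xi> = 0" using less.hyps[of \<xi>] x by (auto simp: N_def)
        then show ?thesis by (simp add: sv.h_zero)
      next
        case False
        then show ?thesis using x by (simp add: schur_P_def hall_littlewood_P_def)
      qed
    qed
  qed auto
  also have "\<dots> = V * (\<Sum>\<xi>\<in>?P. \<Sum>a\<in>arrangements {..<N} \<xi>. const_fun (d \<xi> * s a) * (\<Prod>i<N. indet i ^ a i))"
    unfolding sum_distrib_left
  proof (rule sum.cong[OF refl])
    fix \<xi> assume "\<xi> \<in> ?P"
    then show "const_fun (d \<xi>) * schur_P N indet \<xi>
      = (\<Sum>a\<in>arrangements {..<N} \<xi>. V * (const_fun (d \<xi> * s a) * (\<Prod>i<N. indet i ^ a i)))"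
      by (simp only: P sum_distrib_left sv.h_mult mult_ac)
  qed
  also have "(\<Sum>\<xi>\<in>?P. \<Sum>a\<in>arrangements {..<N} \<xi>. const_fun (d \<xi> * s a) * (\<Prod>i<N. indet i ^ a i))
    = (\<Sum>p\<in>?I. const_fun (d (fst p) * s (snd p)) * (\<Prod>i<N. indet i ^ snd p i))"
    by (subst sum.Sigma) (auto simp: finite_arrangements case_prod_unfold)
  finally have z: "(\<Sum>p\<in>?I. const_fun (d (fst p) * s (snd p)) * (\<Prod>i<N. indet i ^ snd p i)) = 0"
    using V by simp
  have inj: "inj_on snd ?I"
  proof (rule inj_onI)
    fix p q assume pq: "p \<in> ?I" "q \<in> ?I" "snd p = snd q"
    then have "set (fst p) = set (fst q)" using full(2)[of "fst p" "snd p"] full(2)[of "fst q" "snd q"] by force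
    moreover have "fst p \<in> strict_partitions_of n" "fst q \<in> strict_partitions_of n" using pq by auto
    ultimately have "fst p = fst q" using bij_strict_partitions by (auto simp: bij_betw_def inj_on_def)
    then show "p = q" using pq(3) by (simp add: prod_eq_iff)
  qed
  have zP: "\<zeta> \<in> ?P" using less.prems by (simp add: N_def)
  have d0: "d (fst p) * s (snd p) = 0" if "p \<in> ?I" for p
    by (rule monomials_independent[OF _ _ inj z that])
       (use full(3) in \<open>auto intro!: finite_SigmaI simp: finite_arrangements\<close>)
  define a where "a i = (if i < N then \<zeta> ! i else 0)" for i
  have nz: "\<zeta> ! i \<noteq> 0" if "i < N" for i
  proof -
    have "\<zeta> ! i \<in> set \<zeta>" using that by (simp add: N_def)
    then show ?thesis using less.prems by (auto simp: strict_partitions_of_def strict_sorted intro!: gr0I)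
  qed
  have A: "{i. a i \<noteq> 0} = {..<N}" using nz by (auto simp: a_def)
  have "bij_betw a {..<N} (set \<zeta>)"
    using less.prems by (subst bij_betw_cong[of _ _ "(!) \<zeta>"])
      (auto simp: a_def N_def strict_partitions_of_def strict_partition_def intro: bij_betw_nth)
  then have aa: "a \<in> arrangements {..<N} \<zeta>" unfolding arrangements_def mem_Collect_eq A by (simp add: a_def)
  have "d \<zeta> * s a = 0" using d0[of "(\<zeta>, a)"] zP aa by simp
  moreover have "s a \<noteq> 0" using s[OF full(1)[OF zP aa]] by auto
  ultimately show "d \<zeta> = 0" by simp
qed

section \<open>The normalized spin character\<close>

text \<open>Any family of coefficients that satisfies the defining equations is the one that the definite
description denotes.\<close>

lemma spin_X_eqI:
  assumes "\<And>N. power_sum N indet \<pi> = (\<Sum>\<zeta>\<in>strict_partitions_of (sum_list \<pi>). const_fun (Y \<zeta>) * schur_P N indet \<zeta>)"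
    and "\<xi> \<in> strict_partitions_of (sum_list \<pi>)"
  shows "spin_X \<xi> \<pi> = Y \<xi>"
proof -
  let ?A = "\<lambda>X. (\<forall>\<zeta>. \<zeta> \<notin> strict_partitions_of (sum_list \<pi>) \<longrightarrow> X \<zeta> = 0) \<and>
        (\<forall>N. power_sum N indet \<pi> =
           (\<Sum>\<zeta>\<in>strict_partitions_of (sum_list \<pi>). const_fun (X \<zeta>) * schur_P N indet \<zeta>))"
  define Z where "Z \<zeta> = (if \<zeta> \<in> strict_partitions_of (sum_list \<pi>) then Y \<zeta> else 0)" for \<zeta>
  have "(THE X. ?A X) = Z"
  proof (rule the_equality)
    show "?A Z" using assms(1) by (auto simp: Z_def)
    fix X assume X: "?A X"
    show "X = Z"
    proof
      fix \<zeta>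
      show "X \<zeta> = Z \<zeta>"
      proof (cases "\<zeta> \<in> strict_partitions_of (sum_list \<pi>)")
        case True
        have "X \<zeta> + - Y \<zeta> = 0"
        proof (rule schur_P_independent[OF _ True])
          fix N
          show "(\<Sum>\<zeta>\<in>strict_partitions_of (sum_list \<pi>). const_fun (X \<zeta> + - Y \<zeta>) * schur_P N indet \<zeta>) = 0"
            using X assms(1)[of N] by (simp add: sv.h_add sv.h_minus distrib_right sum.distrib sum_negf del: add_uminus_conv_diff)
        qed
        then show ?thesis using True by (simp add: Z_def)
      qed (use X in \<open>simp add: Z_def\<close>)
    qed
  qed
  then show ?thesis unfolding spin_X_def using assms(2) by (simp add: Z_def)
qed

lemma sum_Hs_strict_partitions:
  "(\<Sum>Y\<in>pos_sets n. const_fun (f Y) * sv.Hs N Y)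
    = (\<Sum>\<zeta>\<in>strict_partitions_of n. const_fun (f (set \<zeta>) * weight \<zeta>) * schur_P N indet \<zeta>)"
proof -
  have "(\<Sum>Y\<in>pos_sets n. const_fun (f Y) * sv.Hs N Y)
    = (\<Sum>\<zeta>\<in>strict_partitions_of n. const_fun (f (set \<zeta>)) * sv.Hs N (set \<zeta>))"
    by (rule sum.reindex_bij_betw[OF bij_strict_partitions, symmetric])
  also have "\<dots> = (\<Sum>\<zeta>\<in>strict_partitions_of n. const_fun (f (set \<zeta>) * weight \<zeta>) * schur_P N indet \<zeta>)"
    by (rule sum.cong[OF refl])
      (simp add: strict_partitions_of_def schur_P_eq_seqP strict_partition_def sv.h_mult mult.assoc sv.Hs_list[symmetric])
  finally show ?thesis .
qed

lemma falling_power_fact: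
  "k \<le> n \<Longrightarrow> falling_power n k * fact (n - k) = fact n"
proof (induction k)
  case (Suc k)
  have "n - k = Suc (n - Suc k)" using Suc.prems by simp
  then have "fact (n - k) = of_nat (n - k) * (fact (n - Suc k) :: complex)" by (metis fact_Suc)
  then have "falling_power n (Suc k) * fact (n - Suc k) = falling_power n k * fact (n - k)"
    using Suc.prems by (simp add: falling_power_def of_nat_diff)
  then show ?case using Suc by simp
qed (simp add: falling_power_def)

text \<open>Both \<open>X\<close> values are read off from the expansions of \<open>p\<^sub>k p\<^sub>1\<^sup>m\<close> and \<open>p\<^sub>1\<^sup>n\<close>; the weight cancels in the
quotient. If \<open>k\<close> exceeds the size of \<open>\<xi>\<close>, both sides are empty sums.\<close>

theorem Ch_spin_formula:
  assumes k: "odd k" and xi: "strict_partition \<xi>"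
  shows "Ch_spin [k] \<xi> = spin_phi k (set \<xi>)"
proof -
  define n where "n = sum_list \<xi>"
  have xn: "\<xi> \<in> strict_partitions_of n" using xi by (simp add: strict_partitions_of_def n_def)
  have xZ: "set \<xi> \<in> pos_sets n" using bij_strict_partitions xn by (auto simp: bij_betw_def)
  show ?thesis
  proof (cases "k \<le> n")
    case True
    define m where "m = n - k"
    have n: "n = m + k" using True by (simp add: m_def)
    have p1: "(\<Prod>r\<leftarrow>replicate j (Suc 0). \<Sum>i<N. indet i ^ r) = (\<Sum>i<N. indet i) ^ j" for j N
      by (induction j) auto
    have w: "weight \<xi> \<noteq> 0" using xi by (intro weight_nonzero) (auto simp: strict_partition_def is_partition_def)
    have 1: "spin_X \<xi> ([k] @ replicate m 1) = fact m * spin_phi k (set \<xi>) * weight \<xi>"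
    proof (rule spin_X_eqI[where Y = "\<lambda>\<xi>. fact m * spin_phi k (set \<xi>) * weight \<xi>"])
      have s: "sum_list ([k] @ replicate m 1) = m + k" by (simp add: sum_list_replicate)
      fix N
      show "power_sum N indet ([k] @ replicate m 1) =
        (\<Sum>\<zeta>\<in>strict_partitions_of (sum_list ([k] @ replicate m 1)).
          const_fun (fact m * spin_phi k (set \<zeta>) * weight \<zeta>) * schur_P N indet \<zeta>)"
        unfolding s sum_Hs_strict_partitions[of "\<lambda>Y. fact m * spin_phi k Y" N, symmetric]
          sv.power_sum_one_expansion[OF k, symmetric]
        by (simp add: power_sum_def p1)
    qed (use xn n in \<open>simp add: sum_list_replicate add.commute\<close>)
    have 2: "spin_X \<xi> (replicate n 1) = fact n * weight \<xi>"
    proof (rule spin_X_eqI[where Y = "\<lambda>\<xi>. fact n * weight \<xi>"])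
      have s: "sum_list (replicate n 1) = n" by (simp add: sum_list_replicate)
      fix N
      show "power_sum N indet (replicate n 1) =
        (\<Sum>\<zeta>\<in>strict_partitions_of (sum_list (replicate n 1)).
          const_fun (fact n * weight \<zeta>) * schur_P N indet \<zeta>)"
        unfolding s sum_Hs_strict_partitions[of "\<lambda>Y. fact n" N, symmetric] sum_distrib_left[symmetric]
          sv.power_one_expansion[symmetric]
        by (simp add: power_sum_def p1)
    qed (use xn in \<open>simp add: sum_list_replicate\<close>)
    have "Ch_spin [k] \<xi> = falling_power n k * (fact m * spin_phi k (set \<xi>) * weight \<xi>) / (fact n * weight \<xi>)"
      unfolding Ch_spin_def Let_def n_def[symmetric] 2[symmetric] 1[symmetric] using True by (simp add: m_def)
    also have "\<dots> = spin_phi k (set \<xi>) * (falling_power n k * fact (n - k)) * weight \<xi> / (fact n * weight \<xi>)"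
      by (simp add: m_def)
    also have "\<dots> = spin_phi k (set \<xi>)"
      unfolding falling_power_fact[OF True] using w by simp
    finally show ?thesis .
  next
    case False
    have fx: "finite (set \<xi>)" by simp
    have le: "d \<le> n" if "d \<in> set \<xi>" for d using that member_le_sum_list[of d \<xi>] by (simp add: n_def)
    have a: "{d. d \<in> set \<xi> \<and> k \<le> d} = {}" using le False by force
    have b: "{(u, w). u \<in> set \<xi> \<and> w \<in> set \<xi> \<and> u + w = k} = {}"
    proof -
      have "u + w \<le> n" if "u \<in> set \<xi>" "w \<in> set \<xi>" "u \<noteq> w" for u w
      proof -
        have "\<Sum>{u, w} \<le> \<Sum>(set \<xi>)" using that by (intro sum_mono2) auto
        then show ?thesis using that xZ by (simp add: pos_sets_def)
      qed
      moreover have "u \<noteq> w" if "u + w = k" for u w using k that by auto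
      ultimately show ?thesis using False by blast
    qed
    show ?thesis using False unfolding spin_phi_def a b by (simp add: Ch_spin_def n_def)
  qed
qed

section \<open>Sums of distinct natural numbers\<close>

text \<open>The numbers below \<open>card S\<close> are the unique set of this size with the smallest sum.\<close>

lemma sum_nat_set_ge:
  fixes S :: "nat set"
  assumes "finite S"
  shows "\<Sum>{..<card S} \<le> \<Sum>S \<and> (\<Sum>S = \<Sum>{..<card S} \<longrightarrow> S = {..<card S})"
  using assms
proof (induction "card S" arbitrary: S)
  case 0
  then show ?case by simp
next
  case (Suc n)
  define m where "m = Max S"
  have ne: "S \<noteq> {}" and fin: "finite S" using Suc by auto
  have mS: "m \<in> S" unfolding m_def using fin ne by simp
  have c: "card (S - {m}) = n" using Suc.hyps(2) mS fin by simp
  have IH: "\<Sum>{..<n} \<le> \<Sum>(S - {m}) \<and> (\<Sum>(S - {m}) = \<Sum>{..<n} \<longrightarrow> S - {m} = {..<n})"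
    using Suc.hyps(1)[of "S - {m}"] c fin by simp
  have "S \<subseteq> {..m}" unfolding m_def using fin by auto
  then have "card S \<le> Suc m" using card_mono[of "{..m}" S] by simp
  then have mn: "n \<le> m" using Suc.hyps(2) by simp
  have sS: "\<Sum>S = m + \<Sum>(S - {m})" using fin mS by (rule sum.remove)
  have sn: "\<Sum>{..<Suc n} = n + \<Sum>{..<n}" by simp
  show ?case unfolding Suc.hyps(2)[symmetric]
  proof (intro conjI impI)
    show "\<Sum>{..<Suc n} \<le> \<Sum>S" unfolding sS sn using IH mn by linarith
    assume "\<Sum>S = \<Sum>{..<Suc n}"
    then have e: "m = n" "\<Sum>(S - {m}) = \<Sum>{..<n}" unfolding sS sn using IH mn by linarith+
    then have "S - {m} = {..<n}" using IH by simp
    then have "insert m (S - {m}) = insert n {..<n}" using e by simp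
    moreover have "insert m (S - {m}) = S" using mS by auto
    ultimately show "S = {..<Suc n}" by (simp add: lessThan_Suc)
  qed
qed

text \<open>If \<open>v\<close> is missing from \<open>S\<close>, then at least \<open>N - v\<close> elements lie one step above their minimal positions,
which costs more than \<open>m\<close>.\<close>

lemma mem_of_small_sum:
  fixes S :: "nat set"
  assumes "finite S" "card S = N" "\<Sum>S = \<Sum>{..<N} + m" "v + m < N"
  shows "v \<in> S"
proof (rule ccontr)
  assume v: "v \<notin> S"
  have "\<Sum>{..<Suc N} \<le> \<Sum>(insert v S)"
    using sum_nat_set_ge[of "insert v S"] assms v by simp
  then show False using assms v by simp
qed

section \<open>Adding and removing on alternating functions\<close>

type_synonym fock = "(nat \<Rightarrow> nat) \<Rightarrow> int"

text \<open>Exponent vectors of \<open>N\<close> variables whose degree exceeds that of the Vandermonde determinant by \<open>d\<close>.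
Entries outside of the range are fixed to 0, so that the set is finite.\<close>

definition states :: "nat \<Rightarrow> nat \<Rightarrow> (nat \<Rightarrow> nat) set" where
  "states N d = {l. (\<forall>i\<ge>N. l i = 0) \<and> (\<Sum>i<N. l i) = \<Sum>{..<N} + d}"

text \<open>A function of exponent vectors stands for the polynomial with these coefficients; it is alternating
if the polynomial is antisymmetric in the \<open>N\<close> variables.\<close>

definition alternating :: "nat \<Rightarrow> fock \<Rightarrow> bool" where
  "alternating N F \<longleftrightarrow> (\<forall>l. \<forall>i<N. \<forall>j<N. i \<noteq> j \<longrightarrow> F (l \<circ> transpose i j) = - F l)"

definition homogeneous :: "nat \<Rightarrow> nat \<Rightarrow> fock \<Rightarrow> bool" where
  "homogeneous N d F \<longleftrightarrow> (\<forall>l. F l \<noteq> 0 \<longrightarrow> l \<in> states N d)"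

text \<open>On coefficients: multiplication with the \<open>r\<close>-th power sum.\<close>

definition add_op :: "nat \<Rightarrow> nat \<Rightarrow> fock \<Rightarrow> fock" where
  "add_op N r F l = (\<Sum>i<N. if r \<le> l i then F (l(i := l i - r)) else 0)"

text \<open>The adjoint of the multiplication with the \<open>r\<close>-th power sum. On antisymmetric polynomials it acts as
\<open>r\<close> times the derivative with respect to the power sum, by the commutation relation below.\<close>

definition rem_op :: "nat \<Rightarrow> nat \<Rightarrow> fock \<Rightarrow> fock" where
  "rem_op N r F l = (\<Sum>i<N. F (l(i := l i + r)))"

lemma finite_states: "finite (states N d)"
proof -
  have "states N d \<subseteq> {f. \<forall>i. (i \<in> {..<N} \<longrightarrow> f i \<in> {..\<Sum>{..<N} + d}) \<and> (i \<notin> {..<N} \<longrightarrow> f i = 0)}"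
  proof
    fix l assume l: "l \<in> states N d"
    have "l i \<le> \<Sum>{..<N} + d" if "i < N" for i
    proof -
      have "l i \<le> (\<Sum>i<N. l i)" using that by (intro member_le_sum) auto
      then show ?thesis using l by (simp add: states_def)
    qed
    then show "l \<in> {f. \<forall>i. (i \<in> {..<N} \<longrightarrow> f i \<in> {..\<Sum>{..<N} + d}) \<and> (i \<notin> {..<N} \<longrightarrow> f i = 0)}"
      using l by (auto simp: states_def)
  qed
  moreover have "finite {f. \<forall>i. (i \<in> {..<N} \<longrightarrow> f i \<in> {..\<Sum>{..<N} + d}) \<and> (i \<notin> {..<N} \<longrightarrow> f i = (0::nat))}"
    by (rule finite_set_of_finite_funs) auto
  ultimately show ?thesis by (rule finite_subset)
qed

lemma alternating_repeat:
  assumes "alternating N F" "i < N" "j < N" "i \<noteq> j" "l i = l j"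
  shows "F l = 0"
proof -
  have "l \<circ> transpose i j = l" using assms(5) by (auto simp: fun_eq_iff transpose_def)
  then have "F l = - F l" using assms unfolding alternating_def by metis
  then show ?thesis by simp
qed

lemma alternating_inj:
  assumes "alternating N F" "F l \<noteq> 0"
  shows "inj_on l {..<N}"
  using alternating_repeat[OF assms(1)] assms(2) by (intro inj_onI) (metis lessThan_iff)

lemma alternating_exchange:
  assumes "alternating N F" "i < N" "j < N" "i \<noteq> j" "l i = l j"
  shows "F (l(i := v)) = - F (l(j := v))"
proof -
  have "l(i := v) = l(j := v) \<circ> transpose i j"
    using assms(4,5) by (auto simp: fun_eq_iff transpose_def)
  then show ?thesis using assms(1-4) unfolding alternating_def by metis
qed

lemma upd_transpose: "(l \<circ> transpose i j)(k := v) = l(transpose i j k := v) \<circ> transpose i j"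
  by (auto simp: fun_eq_iff transpose_def)

lemma sum_transpose:
  assumes "i < N" "j < (N::nat)"
  shows "(\<Sum>k<N. f (transpose i j k)) = (\<Sum>k<N. f k)"
  by (rule sum.reindex_bij_betw) (use assms in \<open>simp add: permutes_imp_bij permutes_swap_id\<close>)

lemma alternating_add_op:
  assumes "alternating N F" shows "alternating N (add_op N r F)"
  unfolding alternating_def
proof (intro allI impI)
  fix l i j assume ij: "i < N" "j < N" "i \<noteq> j"
  have "add_op N r F (l \<circ> transpose i j)
    = (\<Sum>k<N. if r \<le> l (transpose i j k) then F (l(transpose i j k := l (transpose i j k) - r) \<circ> transpose i j) else 0)"
    by (simp add: add_op_def upd_transpose cong: if_cong)
  also have "\<dots> = (\<Sum>k<N. if r \<le> l k then F (l(k := l k - r) \<circ> transpose i j) else 0)"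
    by (rule sum_transpose[OF ij(1,2), of "\<lambda>k. if r \<le> l k then F (l(k := l k - r) \<circ> transpose i j) else 0"])
  also have "\<dots> = - add_op N r F l"
    using assms ij unfolding alternating_def add_op_def sum_negf[symmetric] by (intro sum.cong refl) simp
  finally show "add_op N r F (l \<circ> transpose i j) = - add_op N r F l" .
qed

lemma alternating_rem_op:
  assumes "alternating N F" shows "alternating N (rem_op N r F)"
  unfolding alternating_def
proof (intro allI impI)
  fix l i j assume ij: "i < N" "j < N" "i \<noteq> j"
  have "rem_op N r F (l \<circ> transpose i j)
    = (\<Sum>k<N. F (l(transpose i j k := l (transpose i j k) + r) \<circ> transpose i j))"
    by (simp add: rem_op_def upd_transpose)
  also have "\<dots> = (\<Sum>k<N. F (l(k := l k + r) \<circ> transpose i j))"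
    by (rule sum_transpose[OF ij(1,2), of "\<lambda>k. F (l(k := l k + r) \<circ> transpose i j)"])
  also have "\<dots> = - rem_op N r F l"
    using assms ij unfolding alternating_def rem_op_def sum_negf[symmetric] by (intro sum.cong refl) simp
  finally show "rem_op N r F (l \<circ> transpose i j) = - rem_op N r F l" .
qed

lemma sum_upd:
  fixes l :: "nat \<Rightarrow> nat"
  assumes "i < N" shows "(\<Sum>j<N. (l(i := v)) j) + l i = (\<Sum>j<N. l j) + (v::nat)"
proof -
  have "(\<Sum>j<N. (l(i := v)) j) = v + (\<Sum>j\<in>{..<N}-{i}. l j)"
    using assms by (subst sum.remove[of _ i]) (auto intro!: sum.cong)
  moreover have "(\<Sum>j<N. l j) = l i + (\<Sum>j\<in>{..<N}-{i}. l j)" using assms by (subst sum.remove[of _ i]) auto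
  ultimately show ?thesis by simp
qed

lemma states_sub:
  assumes "i < N" "r \<le> l i"
  shows "l(i := l i - r) \<in> states N d \<longleftrightarrow> l \<in> states N (d + r)"
  using sum_upd[OF assms(1), of l "l i - r"] assms by (auto simp: states_def)

lemma states_add:
  assumes "i < N"
  shows "l(i := l i + r) \<in> states N (d + r) \<longleftrightarrow> l \<in> states N d"
  using sum_upd[OF assms(1), of l "l i + r"] assms by (auto simp: states_def)

lemma homogeneous_add_op:
  assumes "homogeneous N d F" shows "homogeneous N (d + r) (add_op N r F)"
  unfolding homogeneous_def
proof (intro allI impI)
  fix l assume "add_op N r F l \<noteq> 0"
  then obtain i where i: "i \<in> {..<N}" and "(if r \<le> l i then F (l(i := l i - r)) else 0) \<noteq> 0"
    unfolding add_op_def by (rule sum.not_neutral_contains_not_neutral)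
  then have r: "r \<le> l i" and nz: "F (l(i := l i - r)) \<noteq> 0" by (auto split: if_splits)
  have "l(i := l i - r) \<in> states N d" using assms nz unfolding homogeneous_def by blast
  then show "l \<in> states N (d + r)" using states_sub[of i N r l d] i r by simp
qed

text \<open>The Heisenberg relation of the boson-fermion correspondence. The two compositions differ only where the
same entry is raised and then lowered past 0. For \<open>r = s\<close> the difference counts the entries below \<open>s\<close>;
these take all values below \<open>s\<close>, once each, because the vector is close to the minimal one. For
\<open>r \<noteq> s\<close> the terms vanish or cancel in pairs, because the function is alternating.\<close>

lemma commutator:
  assumes alt: "alternating N F" and hom: "homogeneous N m F" and mN: "m + s \<le> N"
  shows "rem_op N r (add_op N s F) l = add_op N s (rem_op N r F) l + (if r = s then int r * F l else 0)"
proof -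
  define T where "T i j = (if s \<le> (l(i := l i + r)) j then F ((l(i := l i + r))(j := (l(i := l i + r)) j - s)) else 0)" for i j
  define U where "U i j = (if s \<le> l j then F ((l(j := l j - s))(i := (l(j := l j - s)) i + r)) else 0)" for i j
  \<comment> \<open>The terms that occur only if the entry is raised first: without raising, the entry is too small to be lowered.\<close>
  define G where "G i = (if l i < s \<and> s \<le> l i + r then F (l(i := l i + r - s)) else 0)" for i
  have TU: "T i j = U i j + (if i = j then G i else 0)" for i j
  proof (cases "i = j")
    case True
    then show ?thesis by (auto simp: T_def U_def G_def)
  next
    case False
    then show ?thesis by (simp add: T_def U_def fun_upd_twist)
  qed
  have "rem_op N r (add_op N s F) l = (\<Sum>i<N. \<Sum>j<N. T i j)"
    by (simp only: rem_op_def add_op_def T_def)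
  also have "\<dots> = (\<Sum>i<N. (\<Sum>j<N. U i j) + G i)"
    by (simp add: TU sum.distrib)
  also have "\<dots> = (\<Sum>i<N. \<Sum>j<N. U i j) + (\<Sum>i<N. G i)" by (rule sum.distrib)
  also have "(\<Sum>i<N. \<Sum>j<N. U i j) = (\<Sum>j<N. \<Sum>i<N. U i j)" by (rule sum.swap)
  also have "\<dots> = add_op N s (rem_op N r F) l"
    unfolding add_op_def rem_op_def U_def by (intro sum.cong refl) simp
  also have "(\<Sum>i<N. G i) = (if r = s then int r * F l else 0)"
  proof -
    have full: "\<exists>j<N. l' j = v" if "F l' \<noteq> 0" "v < s" for l' v
    proof -
      have inj: "inj_on l' {..<N}" using alternating_inj[OF alt that(1)] .
      have "l' \<in> states N m" using hom that(1) by (simp add: homogeneous_def)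
      then have "\<Sum>(l' ` {..<N}) = \<Sum>{..<N} + m" using inj by (simp add: sum.reindex states_def)
      then have "v \<in> l' ` {..<N}"
        using that(2) mN inj by (intro mem_of_small_sum[of _ N m]) (auto simp: card_image)
      then show ?thesis by auto
    qed
    show ?thesis
    proof (cases "r = s")
      case True
      have "(\<Sum>i<N. G i) = (\<Sum>i<N. if l i < s then F l else 0)"
        by (intro sum.cong refl) (simp add: G_def True)
      also have "\<dots> = int (card {i. i < N \<and> l i < s}) * F l"
        by (simp add: sum.inter_filter[symmetric])
      also have "\<dots> = int r * F l"
      proof (cases "F l = 0")
        case False
        have "l ` {i. i < N \<and> l i < s} = {..<s}" using full[OF False] by force
        moreover have "inj_on l {i. i < N \<and> l i < s}"
          using alternating_inj[OF alt False] by (rule inj_on_subset) auto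
        ultimately have "card {i. i < N \<and> l i < s} = s" by (metis card_image card_lessThan)
        then show ?thesis using True by simp
      qed simp
      finally show ?thesis using True by simp
    next
      case ne: False
      show ?thesis
      proof (cases "inj_on l {..<N}")
        case True
        have "G i = 0" if i: "i < N" for i
        proof (rule ccontr)
          assume G: "G i \<noteq> 0"
          then have li: "l i < s" "s \<le> l i + r" and nz: "F (l(i := l i + r - s)) \<noteq> 0"
            by (auto simp: G_def split: if_splits)
          obtain j where j: "j < N" "(l(i := l i + r - s)) j = l i" using full[OF nz li(1)] by blast
          have "j \<noteq> i" using j(2) ne li by auto
          then have "l j = l i" using j by simp
          then show False using True i j(1) \<open>j \<noteq> i\<close> by (auto simp: inj_on_def)
        qed
        then show ?thesis using ne by simp
      next
        case False
        then obtain i j where ij: "i < N" "j < N" "i \<noteq> j" "l i = l j" by (auto simp: inj_on_def)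
        have z: "G c = 0" if "c < N" "c \<noteq> i" "c \<noteq> j" for c
          using alternating_repeat[OF alt ij(1,2,3), of "l(c := l c + r - s)"] that ij(4) by (simp add: G_def)
        have "(\<Sum>c<N. G c) = (\<Sum>c\<in>{i, j}. G c)"
          by (rule sum.mono_neutral_right) (use ij z in auto)
        also have "\<dots> = G i + G j" using ij by simp
        also have "\<dots> = 0" using alternating_exchange[OF alt ij] ij(4) by (simp add: G_def)
        finally show ?thesis using ne by simp
      qed
    qed
  qed
  finally show ?thesis .
qed

definition pairing :: "nat \<Rightarrow> nat \<Rightarrow> fock \<Rightarrow> fock \<Rightarrow> int" where
  "pairing N d F G = (\<Sum>l\<in>states N d. F l * G l)"

lemma pairing_adjoint:
  "pairing N (d + r) (add_op N r F) G = pairing N d F (rem_op N r G)"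
proof -
  have "pairing N (d + r) (add_op N r F) G
    = (\<Sum>i<N. \<Sum>l\<in>states N (d + r). if r \<le> l i then F (l(i := l i - r)) * G l else 0)"
    unfolding pairing_def add_op_def sum_distrib_right by (subst sum.swap) (intro sum.cong refl, simp)
  also have "\<dots> = (\<Sum>i<N. \<Sum>l\<in>states N d. F l * G (l(i := l i + r)))"
  proof (rule sum.cong[OF refl])
    fix i assume "i \<in> {..<N}"
    then have i: "i < N" by simp
    have "(\<Sum>l\<in>states N (d + r). if r \<le> l i then F (l(i := l i - r)) * G l else 0)
       = (\<Sum>l\<in>{l \<in> states N (d + r). r \<le> l i}. F (l(i := l i - r)) * G l)"
      by (rule sum.inter_filter[symmetric, OF finite_states])
    also have "\<dots> = (\<Sum>l\<in>states N d. F l * G (l(i := l i + r)))"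
      by (rule sum.reindex_bij_witness[of _ "\<lambda>l. l(i := l i + r)" "\<lambda>l. l(i := l i - r)"])
         (use i states_sub[OF i] states_add[OF i] in auto)
    finally show "(\<Sum>l\<in>states N (d + r). if r \<le> l i then F (l(i := l i - r)) * G l else 0)
       = (\<Sum>l\<in>states N d. F l * G (l(i := l i + r)))" .
  qed
  also have "\<dots> = pairing N d F (rem_op N r G)"
    unfolding pairing_def rem_op_def sum_distrib_left by (rule sum.swap)
  finally show ?thesis .
qed

section \<open>The Vandermonde product and the vacuum\<close>

definition vander :: "nat \<Rightarrow> (nat \<Rightarrow> nat) \<Rightarrow> int" where
  "vander N l = (\<Prod>(i, j)\<in>{(i, j). i < j \<and> j < N}. int (l i) - int (l j))"

lemma finite_pairs: "finite {(i, j). i < j \<and> j < (N::nat)}"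
  by (rule finite_subset[of _ "{..<N} \<times> {..<N}"]) auto

lemma vander_nonzero: "vander N l \<noteq> 0 \<longleftrightarrow> inj_on l {..<N}"
proof
  assume nz: "vander N l \<noteq> 0"
  show "inj_on l {..<N}"
  proof (rule inj_onI, rule ccontr)
    fix i j assume ij: "i \<in> {..<N}" "j \<in> {..<N}" "l i = l j" "i \<noteq> j"
    have "\<exists>p\<in>{(i, j). i < j \<and> j < N}. (case p of (i, j) \<Rightarrow> int (l i) - int (l j)) = 0"
    proof (cases "i < j")
      case True
      then show ?thesis using ij by (intro bexI[of _ "(i, j)"]) auto
    next
      case False
      then show ?thesis using ij by (intro bexI[of _ "(j, i)"]) auto
    qed
    then have "vander N l = 0" unfolding vander_def by (rule prod_zero[OF finite_pairs])
    then show False using nz by simp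
  qed
next
  assume "inj_on l {..<N}"
  then show "vander N l \<noteq> 0" using finite_pairs by (auto simp: vander_def prod_zero_iff inj_on_def)
qed

lemma vander_transpose:
  assumes "a < N" "b < N" "a \<noteq> b"
  shows "vander N (l \<circ> transpose a b) = - vander N l"
proof -
  have main: "vander N (l \<circ> transpose a b) = - vander N l" if ab: "a < b" "b < N" for a b
  proof -
    let ?t = "transpose a b"
    let ?P = "{(i, j). i < j \<and> j < N}"
    let ?e = "\<lambda>p. if ?t (fst p) < ?t (snd p) then 1 else - 1 :: int"
    have tt: "?t i < N \<longleftrightarrow> i < N" for i using ab by (auto simp: transpose_def)
    have te: "?t i = ?t j \<longleftrightarrow> i = j" for i j by (auto simp: transpose_def)
    have "vander N (l \<circ> ?t) = (\<Prod>(i, j)\<in>?P. int (l (?t i)) - int (l (?t j)))" by (simp add: vander_def)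
    also have "\<dots> = (\<Prod>(i, j)\<in>?P. ?e (i, j) * (int (l i) - int (l j)))"
    proof (rule prod.reindex_bij_witness[of _ "\<lambda>(i, j). if ?t i < ?t j then (?t i, ?t j) else (?t j, ?t i)"
          "\<lambda>(i, j). if ?t i < ?t j then (?t i, ?t j) else (?t j, ?t i)"], goal_cases)
      case (2 p)
      obtain i j where "p = (i, j)" by force
      then show ?case using 2 te[of i j] by (auto simp: tt)
    next
      case (4 p)
      obtain i j where "p = (i, j)" by force
      then show ?case using 4 te[of i j] by (auto simp: tt)
    qed auto
    also have "\<dots> = prod ?e ?P * vander N l"
      unfolding vander_def prod.distrib[symmetric] by (intro prod.cong) auto
    also have "prod ?e ?P = (\<Prod>p\<in>{p \<in> ?P. \<not> ?t (fst p) < ?t (snd p)}. - 1)"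
      using finite_pairs by (subst prod.inter_filter) (auto intro!: prod.cong)
    also have "{p \<in> ?P. \<not> ?t (fst p) < ?t (snd p)} = {(a, b)} \<union> (Pair a ` {a<..<b} \<union> (\<lambda>c. (c, b)) ` {a<..<b})"
    proof -
      have eq: "i < j \<and> j < N \<and> \<not> ?t i < ?t j \<longleftrightarrow> i = a \<and> j = b \<or> i = a \<and> a < j \<and> j < b \<or> j = b \<and> a < i \<and> i < b" for i j
        using ab unfolding transpose_def
        by (cases "i = a"; cases "i = b"; cases "j = a"; cases "j = b"; simp; linarith)
      have L: "(i, j) \<in> {p \<in> ?P. \<not> ?t (fst p) < ?t (snd p)} \<longleftrightarrow> i < j \<and> j < N \<and> \<not> ?t i < ?t j" for i j
        by simp
      have R: "(i, j) \<in> {(a, b)} \<union> (Pair a ` {a<..<b} \<union> (\<lambda>c. (c, b)) ` {a<..<b})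
        \<longleftrightarrow> i = a \<and> j = b \<or> i = a \<and> a < j \<and> j < b \<or> j = b \<and> a < i \<and> i < b" for i j
        by auto
      show ?thesis
      proof (rule set_eqI)
        fix p :: "nat \<times> nat"
        obtain i j where p: "p = (i, j)" by force
        show "p \<in> {p \<in> ?P. \<not> ?t (fst p) < ?t (snd p)} \<longleftrightarrow> p \<in> {(a, b)} \<union> (Pair a ` {a<..<b} \<union> (\<lambda>c. (c, b)) ` {a<..<b})"
          unfolding p L R eq ..
      qed
    qed
    also have "(\<Prod>p\<in>\<dots>. - 1 :: int) = - 1"
    proof -
      have "card ({(a, b)} \<union> (Pair a ` {a<..<b} \<union> (\<lambda>c. (c, b)) ` {a<..<b}))
        = 1 + (card {a<..<b} + card {a<..<b})"
        by (subst card_Un_disjoint, simp, simp, force, subst card_Un_disjoint)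
           (auto simp: card_image inj_on_def)
      then show ?thesis by simp
    qed
    finally show ?thesis by (simp add: comp_def)
  qed
  show ?thesis
  proof (cases "a < b")
    case True
    then show ?thesis using main assms by blast
  next
    case False
    then show ?thesis using main[of b a] assms by (metis linorder_neqE_nat transpose_commute)
  qed
qed

text \<open>Changing one entry changes the factors of the pairs that contain its index; this is how a cycle
acts on the product formula for the dimension.\<close>

lemma vander_upd:
  assumes i: "i < N" and inj: "inj_on l {..<N}"
  shows "real_of_int (vander N (l(i := y))) = vander N l * (\<Prod>j\<in>{..<N}-{i}. (real y - real (l j)) / (real (l i) - real (l j)))"
proof -
  let ?P = "{(i, j). i < j \<and> j < N}"
  let ?Q = "{p \<in> ?P. fst p \<noteq> i \<and> snd p \<noteq> i}"
  have dec: "real_of_int (vander N f) = (\<Prod>j\<in>{..<N}-{i}. (if i < j then 1 else - 1) * (real (f i) - real (f j))) *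
     (\<Prod>(p, q)\<in>?Q. real (f p) - real (f q))" for f
  proof -
    have "real_of_int (vander N f) = (\<Prod>(p, q)\<in>?P. real (f p) - real (f q))"
      by (simp add: vander_def case_prod_unfold)
    also have "\<dots> = (\<Prod>(p, q)\<in>?P - ?Q. real (f p) - real (f q)) * (\<Prod>(p, q)\<in>?Q. real (f p) - real (f q))"
      using finite_pairs by (intro prod.subset_diff) auto
    also have "(\<Prod>(p, q)\<in>?P - ?Q. real (f p) - real (f q))
      = (\<Prod>j\<in>{..<N}-{i}. (if i < j then 1 else - 1) * (real (f i) - real (f j)))"
      by (rule prod.reindex_bij_witness[of _ "\<lambda>j. if i < j then (i, j) else (j, i)" "\<lambda>(p, q). if p = i then q else p"])
         (use i in \<open>auto split: if_splits\<close>)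
    finally show ?thesis .
  qed
  have d: "real (l i) - real (l j) \<noteq> 0" if "j \<in> {..<N} - {i}" for j
    using inj i that by (auto simp: inj_on_def)
  have Q: "(\<Prod>(p, q)\<in>?Q. real ((l(i := y)) p) - real ((l(i := y)) q)) = (\<Prod>(p, q)\<in>?Q. real (l p) - real (l q))"
    by (rule prod.cong[OF refl]) auto
  have "(\<Prod>j\<in>{..<N}-{i}. (if i < j then 1 else - 1) * (real ((l(i := y)) i) - real ((l(i := y)) j)))
    = (\<Prod>j\<in>{..<N}-{i}. ((if i < j then 1 else - 1) * (real (l i) - real (l j))) * ((real y - real (l j)) / (real (l i) - real (l j))))"
    by (rule prod.cong[OF refl]) (use d in auto)
  also have "\<dots> = (\<Prod>j\<in>{..<N}-{i}. (if i < j then 1 else - 1) * (real (l i) - real (l j))) *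
      (\<Prod>j\<in>{..<N}-{i}. (real y - real (l j)) / (real (l i) - real (l j)))"
    by (rule prod.distrib)
  finally show ?thesis unfolding dec[of "l(i := y)"] dec[of l] Q by (simp only: mult_ac)
qed

text \<open>A multiple of the coefficient function of the Vandermonde determinant: supported on the permutations of
0, ..., \<open>N - 1\<close>, where \<open>vander\<close> is a constant times the sign.\<close>

definition vacuum :: "nat \<Rightarrow> fock" where
  "vacuum N l = (if (\<forall>i\<ge>N. l i = 0) \<and> l ` {..<N} = {..<N} then vander N l else 0)"

lemma alternating_vacuum: "alternating N (vacuum N)"
  unfolding alternating_def
proof (intro allI impI)
  fix l :: "nat \<Rightarrow> nat" and i j assume ij: "i < N" "j < N" "i \<noteq> j"
  let ?t = "transpose i j"
  have "?t ` {..<N} = {..<N}" using ij by (intro permutes_image permutes_swap_id) auto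
  then have a: "(l \<circ> ?t) ` {..<N} = l ` {..<N}" by (metis image_comp)
  have b: "(\<forall>k\<ge>N. (l \<circ> ?t) k = 0) \<longleftrightarrow> (\<forall>k\<ge>N. l k = 0)" using ij by (auto simp: transpose_def)
  show "vacuum N (l \<circ> ?t) = - vacuum N l"
    unfolding vacuum_def a b vander_transpose[OF ij] if_distrib[of uminus] minus_zero ..
qed

lemma homogeneous_vacuum: "homogeneous N 0 (vacuum N)"
  unfolding homogeneous_def
proof (intro allI impI)
  fix l assume nz: "vacuum N l \<noteq> 0"
  then have l: "\<forall>i\<ge>N. l i = 0" "l ` {..<N} = {..<N}" "vander N l \<noteq> 0" by (auto simp: vacuum_def split: if_splits)
  then have inj: "inj_on l {..<N}" by (simp add: vander_nonzero)
  have "(\<Sum>i<N. l i) = \<Sum>{..<N}" using sum.reindex[OF inj, of "\<lambda>x. x"] l(2) by simp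
  then show "l \<in> states N 0" using l(1) by (simp add: states_def)
qed

text \<open>The vacuum has the least possible degree of an alternating function.\<close>

lemma rem_op_vacuum:
  assumes "r > 0" shows "rem_op N r (vacuum N) l = 0"
proof (rule ccontr)
  assume nz: "rem_op N r (vacuum N) l \<noteq> 0"
  then have inj: "inj_on l {..<N}"
    using alternating_inj[OF alternating_rem_op[OF alternating_vacuum]] by blast
  from nz obtain i where "i \<in> {..<N}" "vacuum N (l(i := l i + r)) \<noteq> 0"
    unfolding rem_op_def by (rule sum.not_neutral_contains_not_neutral)
  then have i: "i < N" "vacuum N (l(i := l i + r)) \<noteq> 0" by auto
  then have "l(i := l i + r) \<in> states N 0" using homogeneous_vacuum by (simp add: homogeneous_def)
  then have "(\<Sum>j<N. l j) + r = \<Sum>{..<N}" using sum_upd[OF i(1), of l "l i + r"] by (simp add: states_def)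
  moreover have "\<Sum>(l ` {..<N}) = (\<Sum>j<N. l j)" using inj by (simp add: sum.reindex)
  moreover have "\<Sum>{..<card (l ` {..<N})} \<le> \<Sum>(l ` {..<N})" using sum_nat_set_ge[of "l ` {..<N}"] by simp
  moreover have "card (l ` {..<N}) = N" using inj by (simp add: card_image)
  ultimately show False using assms by simp
qed

section \<open>Alternating functions attached to permutations\<close>

definition inv_set :: "(nat \<Rightarrow> nat) \<Rightarrow> nat set \<Rightarrow> bool" where
  "inv_set g S \<longleftrightarrow> finite S \<and> permutation g \<and> (\<forall>t\<in>S. g t \<in> S)"

lemma orbit_eq_of_mem: "permutation g \<Longrightarrow> t \<in> orbit g c \<Longrightarrow> orbit g t = orbit g c"
  by (rule orbit_cyclic_eq3[OF cyclic_on_orbit'])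

lemma orbits_disjoint: "permutation g \<Longrightarrow> t \<notin> orbit g c \<Longrightarrow> orbit g t \<inter> orbit g c = {}"
  using orbit_eq_of_mem[of g _ t] orbit_eq_of_mem[of g _ c] permutation_self_in_orbit[of g t] by blast

lemma orbit_sub_inv_set:
  assumes "inv_set g S" "c \<in> S" shows "orbit g c \<subseteq> S"
proof
  fix x assume "x \<in> orbit g c"
  then show "x \<in> S" using assms by induction (auto simp: inv_set_def)
qed

lemma inv_set_Diff:
  assumes S: "inv_set g S"
  shows "inv_set g (S - orbit g c)"
proof -
  have "g t \<notin> orbit g c" if t: "t \<notin> orbit g c" for t
  proof
    assume a: "g t \<in> orbit g c"
    have p: "permutation g" using S by (simp add: inv_set_def)
    have "orbit g (g t) = orbit g c" using p a by (rule orbit_eq_of_mem)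
    moreover have "orbit g (g t) = orbit g t" using p orbit.base[of g t] by (rule orbit_eq_of_mem)
    ultimately show False using t permutation_self_in_orbit[OF p, of t] by simp
  qed
  then show ?thesis using S by (simp add: inv_set_def)
qed

lemma finite_orbit_inv: "inv_set g S \<Longrightarrow> c \<in> S \<Longrightarrow> finite (orbit g c)"
  using orbit_sub_inv_set[of g S c] finite_subset[of "orbit g c" S] by (simp add: inv_set_def)

text \<open>A word gives a letter below \<open>N\<close>, that is, a variable, to every element of \<open>S\<close>. Words fixed by \<open>g\<close> have one
letter for every cycle, and correspond to the terms in the product of the power sums of the cycle
lengths.\<close>

definition fixed_words :: "nat \<Rightarrow> nat set \<Rightarrow> (nat \<Rightarrow> nat) \<Rightarrow> (nat \<Rightarrow> nat) set" where
  "fixed_words N S g = {w \<in> S \<rightarrow>\<^sub>E {..<N}. \<forall>t\<in>S. w (g t) = w t}"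

definition letter_count :: "nat set \<Rightarrow> (nat \<Rightarrow> nat) \<Rightarrow> nat \<Rightarrow> nat" where
  "letter_count S w i = card {t \<in> S. w t = i}"

definition word_term :: "nat \<Rightarrow> nat set \<Rightarrow> (nat \<Rightarrow> nat) \<Rightarrow> fock" where
  "word_term N S w l = (if \<forall>i<N. letter_count S w i \<le> l i then vacuum N (\<lambda>i. l i - letter_count S w i) else 0)"

text \<open>The coefficients of the product of the Vandermonde determinant with the power sums of the cycle lengths
of \<open>g\<close> on \<open>S\<close>. The definition by words, instead of by cycle type, allows sums over the group to be
exchanged with sums over words.\<close>

definition char_fn :: "nat \<Rightarrow> nat set \<Rightarrow> (nat \<Rightarrow> nat) \<Rightarrow> fock" where
  "char_fn N S g l = (\<Sum>w\<in>fixed_words N S g. word_term N S w l)"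

lemma char_fn_empty: "char_fn N {} g = vacuum N"
proof
  fix l
  have "fixed_words N {} g = {\<lambda>_. undefined}" by (auto simp: fixed_words_def)
  then show "char_fn N {} g l = vacuum N l" by (simp add: char_fn_def word_term_def letter_count_def)
qed

lemma letter_count_cong: "(\<And>t. t \<in> S \<Longrightarrow> w t = w' t) \<Longrightarrow> letter_count S w = letter_count S w'"
  unfolding letter_count_def by (intro ext arg_cong[of _ _ card]) auto

lemma letter_count_split:
  assumes "finite S" "O' \<subseteq> S" "\<And>t. t \<in> O' \<Longrightarrow> w t = i"
  shows "letter_count S w j = (if j = i then card O' else 0) + letter_count (S - O') w j"
proof -
  have fO: "finite O'" using assms finite_subset by blast
  have "{t \<in> S. w t = j} = {t \<in> O'. w t = j} \<union> {t \<in> S - O'. w t = j}" using assms(2) by auto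
  then have "letter_count S w j = card {t \<in> O'. w t = j} + letter_count (S - O') w j"
    unfolding letter_count_def using assms(1) fO by (simp add: card_Un_disjoint disjoint_iff)
  moreover have "{t \<in> O'. w t = j} = (if j = i then O' else {})" using assms(3) by auto
  ultimately show ?thesis by simp
qed

text \<open>The letter of a fixed word on the cycle of \<open>c\<close> can be chosen independently of the other letters.\<close>

lemma char_fn_step:
  assumes S: "inv_set g S" and c: "c \<in> S"
  shows "char_fn N S g = add_op N (card (orbit g c)) (char_fn N (S - orbit g c) g)"
proof
  fix l
  let ?O = "orbit g c"
  let ?S = "S - orbit g c"
  let ?r = "card ?O"
  have finS: "finite S" and perm: "permutation g" and gS: "\<And>t. t \<in> S \<Longrightarrow> g t \<in> S"
    using S by (auto simp: inv_set_def)
  have OS: "?O \<subseteq> S" by (rule orbit_sub_inv_set[OF S c])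
  have cO: "c \<in> ?O" by (rule permutation_self_in_orbit[OF perm])
  have gO: "g t \<in> ?O \<longleftrightarrow> t \<in> ?O" if "t \<in> S" for t
    using inv_set_Diff[OF S, of c] that orbit.step[of t g c] by (auto simp: inv_set_def)
  let ?h = "\<lambda>(i, y) t. if t \<in> ?O then i else y t"
  have const: "w t = w c" if w: "w \<in> fixed_words N S g" and t: "t \<in> ?O" for w t
    using t
  proof induction
    case base
    then show ?case using w c by (simp add: fixed_words_def)
  next
    case (step t)
    then show ?case using w OS by (auto simp: fixed_words_def)
  qed
  have term_eq: "word_term N S w l = (if ?r \<le> l i then word_term N ?S y (l(i := l i - ?r)) else 0)"
    if i: "i < N" and wO: "\<And>t. t \<in> ?O \<Longrightarrow> w t = i" and wy: "\<And>t. t \<in> ?S \<Longrightarrow> w t = y t" for w i y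
  proof -
    have cs: "letter_count S w j = (if j = i then ?r else 0) + letter_count ?S y j" for j
    proof -
      have cc: "letter_count ?S w = letter_count ?S y" by (rule letter_count_cong) (rule wy)
      show ?thesis using letter_count_split[OF finS OS wO, where j = j] by (simp only: cc)
    qed
    show ?thesis
    proof (cases "?r \<le> l i")
      case True
      have a: "(\<forall>j<N. letter_count S w j \<le> l j) \<longleftrightarrow> (\<forall>j<N. letter_count ?S y j \<le> (l(i := l i - ?r)) j)"
        unfolding cs using True by (auto split: if_splits)
      have b: "(\<lambda>j. l j - letter_count S w j) = (\<lambda>j. (l(i := l i - ?r)) j - letter_count ?S y j)"
        unfolding cs by (auto simp: fun_eq_iff)
      show ?thesis using True unfolding word_term_def a b by simp
    next
      case False
      then have "\<not> letter_count S w i \<le> l i" unfolding cs by simp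
      then show ?thesis using False i by (auto simp: word_term_def)
    qed
  qed
  have "add_op N ?r (char_fn N ?S g) l
    = (\<Sum>i<N. \<Sum>y\<in>fixed_words N ?S g. if ?r \<le> l i then word_term N ?S y (l(i := l i - ?r)) else 0)"
    unfolding add_op_def char_fn_def by (intro sum.cong refl) simp
  also have "\<dots> = (\<Sum>(i, y)\<in>{..<N} \<times> fixed_words N ?S g. if ?r \<le> l i then word_term N ?S y (l(i := l i - ?r)) else 0)"
    by (rule sum.cartesian_product)
  also have "\<dots> = (\<Sum>w\<in>fixed_words N S g. word_term N S w l)"
  proof (rule sum.reindex_bij_witness[of _ "\<lambda>w. (w c, restrict w ?S)" ?h], goal_cases)
    case (1 p)
    obtain i y where p: "p = (i, y)" by force
    have "y \<in> extensional ?S" using 1 p by (auto simp: fixed_words_def PiE_def)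
    then have "restrict (?h (i, y)) ?S = y" by (auto simp: fun_eq_iff extensional_def)
    then show ?case using cO p by simp
  next
    case (2 p)
    obtain i y where p: "p = (i, y)" by force
    then have i: "i < N" and y: "y \<in> ?S \<rightarrow>\<^sub>E {..<N}" and yg: "\<And>t. t \<in> ?S \<Longrightarrow> y (g t) = y t"
      using 2 by (auto simp: fixed_words_def)
    have "?h (i, y) \<in> S \<rightarrow>\<^sub>E {..<N}"
      using i y OS by (auto simp: PiE_iff extensional_def)
    moreover have "?h (i, y) (g t) = ?h (i, y) t" if "t \<in> S" for t
      using gO[OF that] yg[of t] that by auto
    ultimately show ?case unfolding p fixed_words_def by simp
  next
    case (3 w)
    then show ?case using const[OF 3] by (auto simp: fun_eq_iff fixed_words_def PiE_iff extensional_def)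
  next
    case (4 w)
    then have "w c < N" using c by (auto simp: fixed_words_def PiE_iff)
    moreover have "restrict w ?S \<in> fixed_words N ?S g"
    proof -
      have "w (g t) = w t" "w t < N" "g t \<in> S" "g t \<notin> ?O" if "t \<in> ?S" for t
        using 4 that gO[of t] gS[of t] by (auto simp: fixed_words_def PiE_iff)
      then show ?thesis by (auto simp: fixed_words_def)
    qed
    ultimately show ?case by simp
  next
    case (5 p)
    obtain i y where p: "p = (i, y)" by force
    then have i: "i < N" using 5 by auto
    show ?case unfolding p prod.case by (rule term_eq[OF i]) auto
  qed
  finally show "char_fn N S g l = add_op N ?r (char_fn N ?S g) l" by (simp add: char_fn_def)
qed

lemma inv_set_induct [consumes 1, case_names empty step]:
  assumes "inv_set g S"
    and "P {}"
    and "\<And>S c. inv_set g S \<Longrightarrow> c \<in> S \<Longrightarrow> inv_set g (S - orbit g c) \<Longrightarrow> P (S - orbit g c) \<Longrightarrow> P S"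
  shows "P S"
  using assms(1)
proof (induction "card S" arbitrary: S rule: less_induct)
  case less
  show ?case
  proof (cases "S = {}")
    case False
    then obtain c where c: "c \<in> S" by blast
    have fin: "finite S" and perm: "permutation g" using less.prems by (auto simp: inv_set_def)
    have "S - orbit g c \<subset> S" using c permutation_self_in_orbit[OF perm, of c] by blast
    then have "card (S - orbit g c) < card S" using fin by (rule psubset_card_mono[rotated])
    then have "P (S - orbit g c)" using inv_set_Diff[OF less.prems] by (rule less.hyps)
    then show ?thesis using assms(3)[OF less.prems c inv_set_Diff[OF less.prems]] by blast
  qed (use assms(2) in simp)
qed

lemma card_Diff_orbit:
  assumes "inv_set g S" "c \<in> S" shows "card (S - orbit g c) + card (orbit g c) = card S"
  using orbit_sub_inv_set[OF assms] assms(1) by (simp add: inv_set_def card_Diff_subset card_mono finite_subset)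

lemma char_fn_alternating_homogeneous:
  "inv_set g S \<Longrightarrow> alternating N (char_fn N S g) \<and> homogeneous N (card S) (char_fn N S g)"
proof (induction rule: inv_set_induct)
  case empty
  then show ?case using alternating_vacuum homogeneous_vacuum by (simp add: char_fn_empty)
next
  case (step S c)
  show ?case unfolding char_fn_step[OF step(1,2)]
    using alternating_add_op[OF conjunct1[OF step(4)]] homogeneous_add_op[OF conjunct2[OF step(4)]]
      card_Diff_orbit[OF step(1,2)] by metis
qed

lemma orbit_card_pos: "inv_set g S \<Longrightarrow> c \<in> S \<Longrightarrow> card (orbit g c) > 0"
  using finite_orbit_inv permutation_self_in_orbit unfolding inv_set_def by (metis card_gt_0_iff empty_iff)

text \<open>Leibniz rule: by the commutation relation the removal operator acts on every cycle of length \<open>r\<close> with the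
factor \<open>r\<close>, which is counted here by the elements \<open>t\<close> of such cycles.\<close>

lemma rem_op_char_fn:
  assumes "inv_set g T" "card T \<le> N" "r > 0"
  shows "rem_op N r (char_fn N T g) l = (\<Sum>t\<in>{t \<in> T. card (orbit g t) = r}. char_fn N (T - orbit g t) g l)"
  using assms(1,2)
proof (induction arbitrary: l rule: inv_set_induct)
  case empty
  then show ?case using rem_op_vacuum[OF assms(3)] by (simp add: char_fn_empty)
next
  case (step T c)
  let ?O = "orbit g c"
  let ?T = "T - orbit g c"
  let ?s = "card ?O"
  have perm: "permutation g" and finT: "finite T" using step(1) by (auto simp: inv_set_def)
  have cd: "card ?T + ?s = card T" by (rule card_Diff_orbit[OF step(1,2)])
  have OT: "?O \<subseteq> T" by (rule orbit_sub_inv_set[OF step(1,2)])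
  have IH: "rem_op N r (char_fn N ?T g) = (\<lambda>l. \<Sum>t\<in>{t \<in> ?T. card (orbit g t) = r}. char_fn N (?T - orbit g t) g l)"
    using step(4) cd step.prems by auto
  have "rem_op N r (char_fn N T g) l = rem_op N r (add_op N ?s (char_fn N ?T g)) l"
    using char_fn_step[OF step(1,2)] by simp
  also have "\<dots> = add_op N ?s (rem_op N r (char_fn N ?T g)) l + (if r = ?s then int r * char_fn N ?T g l else 0)"
    using char_fn_alternating_homogeneous[OF step(3), of N] cd step.prems by (intro commutator) auto
  also have "add_op N ?s (rem_op N r (char_fn N ?T g)) l
    = (\<Sum>t\<in>{t \<in> ?T. card (orbit g t) = r}. add_op N ?s (char_fn N (?T - orbit g t) g) l)"
    unfolding IH add_op_def by (subst sum.swap) (intro sum.cong refl, simp)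
  also have "\<dots> = (\<Sum>t\<in>{t \<in> ?T. card (orbit g t) = r}. char_fn N (T - orbit g t) g l)"
  proof (rule sum.cong[OF refl])
    fix t assume t: "t \<in> {t \<in> ?T. card (orbit g t) = r}"
    have "inv_set g (T - orbit g t)" by (rule inv_set_Diff[OF step(1)])
    moreover have "c \<in> T - orbit g t"
      using orbits_disjoint[OF perm, of t c] t step(2) permutation_self_in_orbit[OF perm, of c] by auto
    moreover have "T - orbit g t - ?O = ?T - orbit g t" by auto
    ultimately show "add_op N ?s (char_fn N (?T - orbit g t) g) l = char_fn N (T - orbit g t) g l"
      using char_fn_step[of g "T - orbit g t" c N] by simp
  qed
  also have "(if r = ?s then int r * char_fn N ?T g l else 0)
    = (\<Sum>t\<in>{t \<in> ?O. card (orbit g t) = r}. char_fn N (T - orbit g t) g l)"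
  proof -
    have e: "orbit g t = ?O" if "t \<in> ?O" for t using orbit_eq_of_mem[OF perm that] .
    then have "{t \<in> ?O. card (orbit g t) = r} = (if r = ?s then ?O else {})" by auto
    moreover have "(\<Sum>t\<in>?O. char_fn N (T - orbit g t) g l) = int ?s * char_fn N ?T g l"
      using e by simp
    ultimately show ?thesis by simp
  qed
  also have "(\<Sum>t\<in>{t \<in> ?T. card (orbit g t) = r}. char_fn N (T - orbit g t) g l)
      + (\<Sum>t\<in>{t \<in> ?O. card (orbit g t) = r}. char_fn N (T - orbit g t) g l)
    = (\<Sum>t\<in>{t \<in> T. card (orbit g t) = r}. char_fn N (T - orbit g t) g l)"
  proof -
    have "{t \<in> T. card (orbit g t) = r} = {t \<in> ?T. card (orbit g t) = r} \<union> {t \<in> ?O. card (orbit g t) = r}"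
      using OT by auto
    then show ?thesis
      using finT finite_subset[OF OT finT] by (simp add: sum.union_disjoint disjoint_iff)
  qed
  finally show ?case .
qed

text \<open>The bijections that intertwine \<open>s\<close> and \<open>g\<close>, as extensional functions, so that their number is finite.\<close>

definition equivariant :: "nat set \<Rightarrow> (nat \<Rightarrow> nat) \<Rightarrow> nat set \<Rightarrow> (nat \<Rightarrow> nat) \<Rightarrow> (nat \<Rightarrow> nat) set" where
  "equivariant S s T g = {x \<in> S \<rightarrow>\<^sub>E T. bij_betw x S T \<and> (\<forall>a\<in>S. x (s a) = g (x a))}"

lemma funpow_orbit_eq_iff:
  assumes p: "permutation f"
  shows "(f ^^ j) c = (f ^^ k) c \<longleftrightarrow> j mod card (orbit f c) = k mod card (orbit f c)"
proof -
  define r where "r = funpow_dist1 f c c"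
  have c: "c \<in> orbit f c" by (rule permutation_self_in_orbit[OF p])
  have r0: "r > 0" by (simp add: r_def)
  have per: "(f ^^ r) c = c" unfolding r_def by (rule funpow_dist1_prop[OF c])
  have inj: "inj_on (\<lambda>n. (f ^^ n) c) {0..<r}" unfolding r_def by (rule inj_on_funpow_dist1[OF c])
  have "orbit f c = (\<lambda>n. (f ^^ n) c) ` {0..<r}" unfolding r_def by (rule orbit_conv_funpow_dist1[OF c])
  then have card: "card (orbit f c) = r" using inj by (simp add: card_image)
  have m: "(f ^^ n) c = (f ^^ (n mod r)) c" for n using funpow_mod_eq[OF per, of n] by simp
  show ?thesis unfolding card m[of j] m[of k]
    using inj r0 by (auto simp: inj_on_def)
qed

lemma equivariant_funpow:
  assumes "x \<in> equivariant S s T g" "inv_set s S" "c \<in> S"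
  shows "(s ^^ k) c \<in> S \<and> x ((s ^^ k) c) = (g ^^ k) (x c)"
  using assms by (induction k) (auto simp: equivariant_def inv_set_def)

lemma orbit_funpow: "permutation f \<Longrightarrow> orbit f c = range (\<lambda>k. (f ^^ k) c)"
  by (auto simp: orbit_altdef_permutation)

lemma equivariant_image_orbit:
  assumes x: "x \<in> equivariant S s T g" and S: "inv_set s S" and g: "permutation g" and c: "c \<in> S"
  shows "x ` orbit s c = orbit g (x c)"
  using equivariant_funpow[OF x S c] S g by (auto simp: orbit_funpow inv_set_def image_image)

text \<open>An equivariant bijection is determined on the cycle of \<open>c\<close> by the image \<open>t\<close> of \<open>c\<close>, which can be any element
of a cycle with the same length, and restricts to the complements of the two cycles.\<close>

lemma card_equivariant_step:
  assumes S: "inv_set s S" and T: "inv_set g T" and c: "c \<in> S"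
  shows "card (equivariant S s T g) =
    (\<Sum>t\<in>{t \<in> T. card (orbit g t) = card (orbit s c)}. card (equivariant (S - orbit s c) s (T - orbit g t) g))"
proof -
  let ?O = "orbit s c"
  let ?R = "{t \<in> T. card (orbit g t) = card ?O}"
  let ?E = "\<lambda>t. equivariant (S - ?O) s (T - orbit g t) g"
  have ps: "permutation s" and pg: "permutation g" and finS: "finite S" and finT: "finite T"
    using S T by (auto simp: inv_set_def)
  have OS: "?O \<subseteq> S" by (rule orbit_sub_inv_set[OF S c])
  have cO: "c \<in> ?O" by (rule permutation_self_in_orbit[OF ps])
  have sO: "s a \<in> ?O \<longleftrightarrow> a \<in> ?O" if "a \<in> S" for a
    using inv_set_Diff[OF S, of c] that orbit.step[of a s c] by (auto simp: inv_set_def)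
  have sS: "s a \<in> S" if "a \<in> S" for a using S that by (simp add: inv_set_def)
  have "bij_betw (\<lambda>x. (x c, restrict x (S - ?O))) (equivariant S s T g) (SIGMA t:?R. ?E t)"
    unfolding bij_betw_def
  proof
    show "inj_on (\<lambda>x. (x c, restrict x (S - ?O))) (equivariant S s T g)"
    proof (rule inj_onI)
      fix x y assume x: "x \<in> equivariant S s T g" and y: "y \<in> equivariant S s T g"
        and e: "(x c, restrict x (S - ?O)) = (y c, restrict y (S - ?O))"
      show "x = y"
      proof
        fix a
        consider "a \<notin> S" | "a \<in> ?O" | "a \<in> S - ?O" by blast
        then show "x a = y a"
        proof cases
          case 1
          then show ?thesis using x y by (auto simp: equivariant_def PiE_iff extensional_def)
        next
          case 2
          then obtain k where "a = (s ^^ k) c" using ps by (auto simp: orbit_funpow)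
          then show ?thesis using equivariant_funpow[OF x S c] equivariant_funpow[OF y S c] e by simp
        next
          case 3
          moreover have "restrict x (S - ?O) = restrict y (S - ?O)" using e by simp
          from fun_cong[OF this, of a] have "restrict x (S - ?O) a = restrict y (S - ?O) a" .
          ultimately show ?thesis by simp
        qed
      qed
    qed
    show "(\<lambda>x. (x c, restrict x (S - ?O))) ` equivariant S s T g = (SIGMA t:?R. ?E t)"
    proof (intro equalityI subsetI)
      fix p assume "p \<in> (\<lambda>x. (x c, restrict x (S - ?O))) ` equivariant S s T g"
      then obtain x where x: "x \<in> equivariant S s T g" and p: "p = (x c, restrict x (S - ?O))" by blast
      have b: "bij_betw x S T" using x by (simp add: equivariant_def)
      have im: "x ` ?O = orbit g (x c)" by (rule equivariant_image_orbit[OF x S pg c])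
      have "inj_on x ?O" using b OS by (auto simp: bij_betw_def intro: inj_on_subset)
      then have "card (orbit g (x c)) = card ?O" using im by (metis card_image)
      moreover have "x c \<in> T" using b c by (auto simp: bij_betw_def)
      moreover have "restrict x (S - ?O) \<in> ?E (x c)"
      proof -
        have "bij_betw x (S - ?O) (T - orbit g (x c))"
        proof -
          have inj: "inj_on x S" and img: "x ` S = T" using b by (auto simp: bij_betw_def)
          have "x ` (S - ?O) = x ` S - x ` ?O" using OS by (intro inj_on_image_set_diff[OF inj]) auto
          then show ?thesis unfolding bij_betw_def img im using inj_on_diff[OF inj] by blast
        qed
        then have "bij_betw (restrict x (S - ?O)) (S - ?O) (T - orbit g (x c))"
          by (subst bij_betw_cong[of _ _ x]) auto
        moreover from this have "restrict x (S - ?O) \<in> (S - ?O) \<rightarrow>\<^sub>E (T - orbit g (x c))"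
          by (auto simp: bij_betw_def PiE_iff)
        moreover have "restrict x (S - ?O) (s a) = g (restrict x (S - ?O) a)" if "a \<in> S - ?O" for a
          using that sO[of a] sS[of a] x by (auto simp: equivariant_def)
        ultimately show ?thesis by (simp add: equivariant_def)
      qed
      ultimately show "p \<in> (SIGMA t:?R. ?E t)" using p by simp
    next
      fix p assume "p \<in> (SIGMA t:?R. ?E t)"
      then obtain t y where p: "p = (t, y)" and t: "t \<in> T" "card (orbit g t) = card ?O" and y: "y \<in> ?E t" by auto
      define \<phi> where "\<phi> a = (g ^^ (SOME k. (s ^^ k) c = a)) t" for a
      have \<phi>: "\<phi> ((s ^^ k) c) = (g ^^ k) t" for k
      proof -
        have "(s ^^ (SOME j. (s ^^ j) c = (s ^^ k) c)) c = (s ^^ k) c" by (rule someI) simp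
        then show ?thesis unfolding \<phi>_def
          using funpow_orbit_eq_iff[OF ps, of _ c] funpow_orbit_eq_iff[OF pg, of _ t] t(2) by simp
      qed
      have \<phi>_bij: "bij_betw \<phi> ?O (orbit g t)"
      proof -
        have "\<phi> ` ?O = orbit g t" using \<phi> by (auto simp: orbit_funpow ps pg image_image)
        moreover have "inj_on \<phi> ?O"
        proof (rule inj_onI)
          fix a b assume "a \<in> ?O" "b \<in> ?O" "\<phi> a = \<phi> b"
          then obtain j k where "a = (s ^^ j) c" "b = (s ^^ k) c" "(g ^^ j) t = (g ^^ k) t"
            using \<phi> ps by (auto simp: orbit_funpow)
          then show "a = b" using funpow_orbit_eq_iff[OF ps, of _ c] funpow_orbit_eq_iff[OF pg, of _ t] t(2) by simp
        qed
        ultimately show ?thesis by (simp add: bij_betw_def)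
      qed
      have \<phi>_eq: "\<phi> (s a) = g (\<phi> a)" if aO: "a \<in> ?O" for a
      proof -
        obtain k where "a = (s ^^ k) c" using aO ps by (auto simp: orbit_funpow)
        then show ?thesis using \<phi>[of k] \<phi>[of "Suc k"] by simp
      qed
      define x where "x a = (if a \<in> ?O then \<phi> a else y a)" for a
      have yb: "bij_betw y (S - ?O) (T - orbit g t)" and ye: "y \<in> (S - ?O) \<rightarrow>\<^sub>E (T - orbit g t)"
        and yg: "\<And>a. a \<in> S - ?O \<Longrightarrow> y (s a) = g (y a)" using y by (auto simp: equivariant_def)
      have b1: "bij_betw x ?O (orbit g t)" using \<phi>_bij by (subst bij_betw_cong[of _ _ \<phi>]) (auto simp: x_def)
      have b2: "bij_betw x (S - ?O) (T - orbit g t)" using yb by (subst bij_betw_cong[of _ _ y]) (auto simp: x_def)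
      have OT: "orbit g t \<subseteq> T" by (rule orbit_sub_inv_set[OF T t(1)])
      have "bij_betw x (?O \<union> (S - ?O)) (orbit g t \<union> (T - orbit g t))"
        by (rule bij_betw_combine[OF b1 b2]) auto
      moreover have "?O \<union> (S - ?O) = S" "orbit g t \<union> (T - orbit g t) = T" using OS OT by auto
      ultimately have b: "bij_betw x S T" by simp
      have "x \<in> S \<rightarrow>\<^sub>E T"
      proof -
        have "x a = undefined" if "a \<notin> S" for a using that OS ye by (auto simp: x_def PiE_iff extensional_def)
        then show ?thesis using b by (auto simp: bij_betw_def PiE_iff extensional_def)
      qed
      moreover have "x (s a) = g (x a)" if "a \<in> S" for a
        using sO[OF that] \<phi>_eq[of a] yg[of a] that by (auto simp: x_def)
      ultimately have "x \<in> equivariant S s T g" using b by (simp add: equivariant_def)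
      moreover have "x c = t" using \<phi>[of 0] cO by (simp add: x_def)
      moreover have "restrict x (S - ?O) = y"
        using ye by (auto simp: x_def fun_eq_iff PiE_iff extensional_def)
      ultimately show "p \<in> (\<lambda>x. (x c, restrict x (S - ?O))) ` equivariant S s T g"
        unfolding p by (intro image_eqI[of _ _ x]) auto
    qed
  qed
  then have "card (equivariant S s T g) = card (SIGMA t:?R. ?E t)" by (rule bij_betw_same_card)
  also have "\<dots> = (\<Sum>t\<in>?R. card (?E t))"
  proof (rule card_SigmaI)
    show "\<forall>t\<in>?R. finite (?E t)"
    proof
      fix t
      have "?E t \<subseteq> (S - ?O) \<rightarrow>\<^sub>E (T - orbit g t)" by (auto simp: equivariant_def)
      then show "finite (?E t)" by (rule finite_subset) (use finS finT in \<open>auto intro: finite_PiE\<close>)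
    qed
  qed (use finT in auto)
  finally show ?thesis .
qed

lemma pairing_sum_right: "pairing N d F (\<lambda>l. \<Sum>t\<in>R. G t l) = (\<Sum>t\<in>R. pairing N d F (G t))"
  unfolding pairing_def sum_distrib_left by (rule sum.swap)

text \<open>Both sides satisfy the same recursion: remove a cycle of \<open>s\<close> on the left, and move the operator to the
other side by adjointness. This is the orthogonality of power sums, with the size of the centralizer
replaced by a number of intertwining maps.\<close>

theorem pairing_char_fn:
  assumes "inv_set s S" "inv_set g T" "card S = card T" "card T \<le> N"
  shows "pairing N (card S) (char_fn N S s) (char_fn N T g)
    = pairing N 0 (vacuum N) (vacuum N) * int (card (equivariant S s T g))"
  using assms
proof (induction arbitrary: T rule: inv_set_induct)
  case empty
  then have "T = {}" by (simp add: inv_set_def)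
  moreover have "equivariant {} s {} g = {\<lambda>_. undefined}" by (auto simp: equivariant_def bij_betw_def)
  ultimately show ?case by (simp add: char_fn_empty)
next
  case (step S c)
  let ?O = "orbit s c"
  let ?r = "card ?O"
  let ?R = "{t \<in> T. card (orbit g t) = ?r}"
  have cS: "card (S - ?O) + ?r = card S" by (rule card_Diff_orbit[OF step(1,2)])
  have r0: "?r > 0" by (rule orbit_card_pos[OF step(1,2)])
  have "pairing N (card S) (char_fn N S s) (char_fn N T g)
    = pairing N (card (S - ?O) + ?r) (add_op N ?r (char_fn N (S - ?O) s)) (char_fn N T g)"
    unfolding cS using char_fn_step[OF step(1,2)] by simp
  also have "\<dots> = pairing N (card (S - ?O)) (char_fn N (S - ?O) s) (rem_op N ?r (char_fn N T g))"
    by (rule pairing_adjoint)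
  also have "rem_op N ?r (char_fn N T g) = (\<lambda>l. \<Sum>t\<in>?R. char_fn N (T - orbit g t) g l)"
    using rem_op_char_fn[OF step.prems(1) step.prems(3) r0] by auto
  also have "pairing N (card (S - ?O)) (char_fn N (S - ?O) s) \<dots>
    = (\<Sum>t\<in>?R. pairing N (card (S - ?O)) (char_fn N (S - ?O) s) (char_fn N (T - orbit g t) g))"
    by (rule pairing_sum_right)
  also have "\<dots> = (\<Sum>t\<in>?R. pairing N 0 (vacuum N) (vacuum N) * int (card (equivariant (S - ?O) s (T - orbit g t) g)))"
  proof (rule sum.cong[OF refl])
    fix t assume t: "t \<in> ?R"
    then have "card (T - orbit g t) + ?r = card T" using card_Diff_orbit[OF step.prems(1), of t] by auto
    then show "pairing N (card (S - ?O)) (char_fn N (S - ?O) s) (char_fn N (T - orbit g t) g)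
      = pairing N 0 (vacuum N) (vacuum N) * int (card (equivariant (S - ?O) s (T - orbit g t) g))"
      using cS step.prems by (intro step(4) inv_set_Diff) auto
  qed
  also have "\<dots> = pairing N 0 (vacuum N) (vacuum N) * int (card (equivariant S s T g))"
    unfolding card_equivariant_step[OF step(1) step.prems(1) step(2)] by (simp add: sum_distrib_left)
  finally show ?case .
qed

section \<open>The alternating function of a single cycle\<close>

fun list_fn :: "nat \<Rightarrow> nat list \<Rightarrow> fock" where
  "list_fn N [] = vacuum N"
| "list_fn N (r # \<sigma>) = add_op N r (list_fn N \<sigma>)"

lemma char_fn_eq_list_fn:
  assumes "inv_set g S" "image_mset card (mset_set (orbit g ` S)) = mset \<sigma>"
  shows "char_fn N S g = list_fn N \<sigma>"
  using assms
proof (induction \<sigma> arbitrary: S)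
  case Nil
  then have "orbit g ` S = {}" by (auto simp: inv_set_def mset_set_empty_iff)
  then show ?case by (simp add: char_fn_empty)
next
  case (Cons r \<sigma>)
  have fin: "finite (orbit g ` S)" and perm: "permutation g" using Cons.prems(1) by (auto simp: inv_set_def)
  have "r \<in># image_mset card (mset_set (orbit g ` S))" using Cons.prems(2) by simp
  then obtain c where c: "c \<in> S" "card (orbit g c) = r" using fin by auto
  let ?O = "orbit g c"
  have "orbit g ` (S - ?O) = orbit g ` S - {?O}"
  proof (intro equalityI subsetI)
    fix X assume "X \<in> orbit g ` (S - ?O)"
    then obtain t where "t \<in> S" "t \<notin> ?O" "X = orbit g t" by auto
    then show "X \<in> orbit g ` S - {?O}" using permutation_self_in_orbit[OF perm, of t] by auto
  next
    fix X assume "X \<in> orbit g ` S - {?O}"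
    then obtain t where "t \<in> S" "X = orbit g t" "X \<noteq> ?O" by auto
    then show "X \<in> orbit g ` (S - ?O)" using orbit_eq_of_mem[OF perm, of t c] by auto
  qed
  then have "image_mset card (mset_set (orbit g ` S)) = add_mset r (image_mset card (mset_set (orbit g ` (S - ?O))))"
  proof -
    have "mset_set (orbit g ` S) = add_mset ?O (mset_set (orbit g ` S - {?O}))"
      by (rule mset_set.remove) (use fin c in auto)
    moreover assume "orbit g ` (S - ?O) = orbit g ` S - {?O}"
    ultimately show ?thesis using c by simp
  qed
  then have "image_mset card (mset_set (orbit g ` (S - ?O))) = mset \<sigma>" using Cons.prems(2) by simp
  then have "char_fn N (S - ?O) g = list_fn N \<sigma>" by (intro Cons.IH inv_set_Diff Cons.prems(1))
  then show ?case using char_fn_step[OF Cons.prems(1) c(1), of N] c(2) by simp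
qed

lemma list_fn_alternating: "alternating N (list_fn N \<sigma>)"
  by (induction \<sigma>) (auto simp: alternating_vacuum alternating_add_op)

lemma prod_fact_upd:
  fixes l :: "nat \<Rightarrow> nat"
  assumes "i < N" "k \<le> l i"
  shows "(\<Prod>j<N. fact (l j) :: real) = fact (l i) / fact (l i - k) * (\<Prod>j<N. fact ((l(i := l i - k)) j))"
proof -
  have "(\<Prod>j<N. fact ((l(i := l i - k)) j) :: real) = fact (l i - k) * (\<Prod>j\<in>{..<N}-{i}. fact (l j))"
    using assms by (subst prod.remove[of _ i]) (auto intro!: prod.cong)
  moreover have "(\<Prod>j<N. fact (l j) :: real) = fact (l i) * (\<Prod>j\<in>{..<N}-{i}. fact (l j))"
    using assms by (subst prod.remove[of _ i]) auto
  ultimately show ?thesis by simp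
qed

text \<open>The hook length formula in terms of beta-numbers. It is proved by induction on the size, where the step
is the rational function identity for lowering one entry by 1.\<close>

lemma list_fn_ones:
  assumes "l \<in> states N m"
  shows "real_of_int (list_fn N (replicate m 1) l) * (\<Prod>i<N. fact (l i)) =
    (\<Prod>i<N. fact i) * fact m * real_of_int (vander N l)"
  using assms
proof (induction m arbitrary: l)
  case 0
  show ?case
  proof (cases "inj_on l {..<N}")
    case True
    have s: "\<Sum>(l ` {..<N}) = \<Sum>{..<N}" using 0 True by (simp add: states_def sum.reindex)
    have img: "l ` {..<N} = {..<N}"
      using sum_nat_set_ge[of "l ` {..<N}"] s True by (simp add: card_image)
    then have v: "vacuum N l = vander N l" using 0 by (auto simp: vacuum_def states_def)
    have "(\<Prod>i<N. fact (l i) :: real) = (\<Prod>i\<in>l ` {..<N}. fact i)" using True by (simp add: prod.reindex)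
    then show ?thesis unfolding img by (simp add: v)
  next
    case False
    then have "vander N l = 0" using vander_nonzero by blast
    then show ?thesis by (simp add: vacuum_def)
  qed
next
  case (Suc m)
  let ?P = "\<Prod>i<N. fact (l i) :: real"
  let ?K = "\<Prod>i<N. fact i :: real"
  show ?case
  proof (cases "inj_on l {..<N}")
    case inj: True
    define T where "T i = (if 1 \<le> l i then real_of_int (list_fn N (replicate m 1) (l(i := l i - 1))) else 0) * ?P" for i
    have T: "T i = ?K * fact m * real_of_int (vander N l) *
        (real (l i) * (\<Prod>j\<in>{..<N}-{i}. 1 + (- 1) / (real (l i) - real (l j))))" if i: "i < N" for i
    proof (cases "1 \<le> l i")
      case True
      have st: "l(i := l i - 1) \<in> states N m" using states_sub[of i N 1 l m] i True Suc.prems by simp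
      have e: "fact (l i) / fact (l i - 1) = real (l i)" using True by (cases "l i") auto
      have "T i = real (l i) * (real_of_int (list_fn N (replicate m 1) (l(i := l i - 1))) * (\<Prod>j<N. fact ((l(i := l i - 1)) j)))"
        unfolding T_def prod_fact_upd[of i N 1 l, OF i True] e using True by simp
      also have "\<dots> = real (l i) * (?K * fact m * real_of_int (vander N (l(i := l i - 1))))"
        by (simp only: Suc.IH[OF st])
      also have "real_of_int (vander N (l(i := l i - 1)))
        = real_of_int (vander N l) * (\<Prod>j\<in>{..<N}-{i}. (real (l i - 1) - real (l j)) / (real (l i) - real (l j)))"
        by (rule vander_upd[OF i inj])
      also have "(\<Prod>j\<in>{..<N}-{i}. (real (l i - 1) - real (l j)) / (real (l i) - real (l j)))
        = (\<Prod>j\<in>{..<N}-{i}. 1 + (- 1) / (real (l i) - real (l j)))"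
      proof (rule prod.cong[OF refl])
        fix j assume "j \<in> {..<N} - {i}"
        then have "real (l i) - real (l j) \<noteq> 0" using inj i by (auto simp: inj_on_def)
        then show "(real (l i - 1) - real (l j)) / (real (l i) - real (l j)) = 1 + (- 1) / (real (l i) - real (l j))"
          using True by (simp add: field_simps of_nat_diff)
      qed
      finally show ?thesis by (simp only: mult_ac)
    next
      case False
      then show ?thesis by (simp add: T_def)
    qed
    have tri: "real (\<Sum>{..<N}) = real (N choose 2)"
    proof (induction N)
      case (Suc N)
      then show ?case by (simp add: numeral_2_eq_2)
    qed simp
    have sl: "(\<Sum>i<N. real (l i)) = real (\<Sum>{..<N}) + real (Suc m)"
      using Suc.prems unfolding states_def by (metis (mono_tags, lifting) mem_Collect_eq of_nat_add of_nat_sum)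
    have injr: "inj_on (\<lambda>i. real (l i)) {..<N}" using inj by (auto simp: inj_on_def)
    have "real_of_int (list_fn N (replicate (Suc m) 1) l) * ?P = (\<Sum>i<N. T i)"
      unfolding T_def by (simp add: add_op_def sum_distrib_right if_distrib cong: if_cong)
    also have "\<dots> = ?K * fact m * real_of_int (vander N l) *
       (\<Sum>i<N. real (l i) * (\<Prod>j\<in>{..<N}-{i}. 1 + (- 1) / (real (l i) - real (l j))))"
      unfolding sum_distrib_left by (rule sum.cong[OF refl], rule T) simp
    also have "(\<Sum>i<N. real (l i) * (\<Prod>j\<in>{..<N}-{i}. 1 + (- 1) / (real (l i) - real (l j)))) = real (Suc m)"
      using sum_shift_vandermonde[OF finite_lessThan injr, of 1] sl tri by simp
    finally show ?thesis by simp
  next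
    case False
    then have "list_fn N (replicate (Suc m) 1) l = 0"
      using alternating_inj[OF list_fn_alternating] by blast
    moreover have "vander N l = 0" using False vander_nonzero by blast
    ultimately show ?thesis by simp
  qed
qed

definition linear_phi :: "nat \<Rightarrow> nat \<Rightarrow> (nat \<Rightarrow> nat) \<Rightarrow> real" where
  "linear_phi k N l = (\<Sum>i | i < N \<and> k \<le> l i. fact (l i) / fact (l i - k) *
     (\<Prod>j\<in>{..<N}-{i}. (real (l i - k) - real (l j)) / (real (l i) - real (l j))))"

text \<open>The power sum of the cycle lowers one entry by \<open>k\<close>; the values at the lowered vectors are given by the
dimension formula.\<close>

lemma list_fn_cycle_ratio:
  assumes l: "l \<in> states N n" and inj: "inj_on l {..<N}" and k: "k \<le> n"
  shows "fact n / fact (n - k) * real_of_int (list_fn N (k # replicate (n - k) 1) l)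
     = linear_phi k N l * real_of_int (list_fn N (replicate n 1) l)"
    and "list_fn N (replicate n 1) l \<noteq> 0"
proof -
  let ?P = "\<Prod>i<N. fact (l i) :: real"
  let ?K = "\<Prod>i<N. fact i :: real"
  have P: "?P \<noteq> 0" by simp
  have v: "real_of_int (vander N l) \<noteq> 0" using inj vander_nonzero by simp
  have one: "real_of_int (list_fn N (replicate n 1) l) * ?P = ?K * fact n * real_of_int (vander N l)"
    by (rule list_fn_ones[OF l])
  then show "list_fn N (replicate n 1) l \<noteq> 0" using v P by auto
  define T where "T i = (if k \<le> l i then real_of_int (list_fn N (replicate (n - k) 1) (l(i := l i - k))) else 0) * ?P" for i
  have T: "T i = ?K * fact (n - k) * real_of_int (vander N l) * (if k \<le> l i then fact (l i) / fact (l i - k) *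
      (\<Prod>j\<in>{..<N}-{i}. (real (l i - k) - real (l j)) / (real (l i) - real (l j))) else 0)" if i: "i < N" for i
  proof (cases "k \<le> l i")
    case True
    have st: "l(i := l i - k) \<in> states N (n - k)" using states_sub[of i N k l "n - k"] i True l k by simp
    have "T i = fact (l i) / fact (l i - k) * (real_of_int (list_fn N (replicate (n - k) 1) (l(i := l i - k))) * (\<Prod>j<N. fact ((l(i := l i - k)) j)))"
      unfolding T_def prod_fact_upd[of i N k l, OF i True] using True by simp
    also have "\<dots> = fact (l i) / fact (l i - k) * (?K * fact (n - k) * real_of_int (vander N (l(i := l i - k))))"
      by (simp only: list_fn_ones[OF st])
    also have "real_of_int (vander N (l(i := l i - k)))
        = real_of_int (vander N l) * (\<Prod>j\<in>{..<N}-{i}. (real (l i - k) - real (l j)) / (real (l i) - real (l j)))"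
      by (rule vander_upd[OF i inj])
    finally show ?thesis using True by (simp add: mult_ac)
  qed (simp add: T_def)
  have "real_of_int (list_fn N (k # replicate (n - k) 1) l) * ?P = (\<Sum>i<N. T i)"
    unfolding T_def by (simp add: add_op_def sum_distrib_right if_distrib cong: if_cong)
  also have "\<dots> = ?K * fact (n - k) * real_of_int (vander N l) * linear_phi k N l"
  proof -
    have "linear_phi k N l = (\<Sum>i<N. if k \<le> l i then fact (l i) / fact (l i - k) *
      (\<Prod>j\<in>{..<N}-{i}. (real (l i - k) - real (l j)) / (real (l i) - real (l j))) else 0)"
      unfolding linear_phi_def by (subst sum.inter_filter[symmetric]) auto
    then show ?thesis unfolding sum_distrib_left by (simp only: sum_distrib_left) (rule sum.cong[OF refl], rule T, simp)
  qed
  finally have k1: "real_of_int (list_fn N (k # replicate (n - k) 1) l) * ?P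
     = ?K * fact (n - k) * real_of_int (vander N l) * linear_phi k N l" .
  have "fact n / fact (n - k) * real_of_int (list_fn N (k # replicate (n - k) 1) l) * ?P
    = ?K * fact n * real_of_int (vander N l) * linear_phi k N l"
    using k1 by (simp add: mult.assoc)
  also have "\<dots> = linear_phi k N l * real_of_int (list_fn N (replicate n 1) l) * ?P"
    unfolding one[symmetric] by (simp only: mult_ac)
  finally show "fact n / fact (n - k) * real_of_int (list_fn N (k # replicate (n - k) 1) l)
     = linear_phi k N l * real_of_int (list_fn N (replicate n 1) l)"
    by (rule mult_right_cancel[OF P, THEN iffD1])
qed

section \<open>Young symmetrizers\<close>

text \<open>A linear functional which is maximal among the arrangements of a set of values for the increasing
one and minimal for the decreasing one; it is used to order the shapes.\<close>

definition index_sum :: "nat \<Rightarrow> (nat \<Rightarrow> nat) \<Rightarrow> nat" where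
  "index_sum N l = (\<Sum>i<N. i * l i)"

definition stair :: "nat \<Rightarrow> nat \<Rightarrow> nat" where
  "stair N i = N - 1 - i"

text \<open>The sum of the squares of \<open>\<eta> i - stair N i\<close> is twice the difference of the two sides, because
\<open>\<eta>\<close> and the decreasing arrangement take the same values.\<close>

lemma index_sum_bij:
  assumes "\<eta> ` {..<N} = {..<N}"
  shows "index_sum N (stair N) \<le> index_sum N \<eta> \<and>
    (index_sum N \<eta> = index_sum N (stair N) \<longrightarrow> (\<forall>i<N. \<eta> i = stair N i))"
proof -
  let ?\<delta> = "stair N"
  have inj: "inj_on \<eta> {..<N}" using assms by (intro eq_card_imp_inj_on) auto
  have b: "bij_betw \<eta> {..<N} {..<N}" using inj assms by (simp add: bij_betw_def)
  have d: "bij_betw ?\<delta> {..<N} {..<N}"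
    by (rule bij_betwI[of _ _ _ ?\<delta>]) (auto simp: stair_def)
  have s1: "(\<Sum>i<N. int (\<eta> i)) = (\<Sum>i<N. int (?\<delta> i))"
    using sum.reindex_bij_betw[OF b, of int] sum.reindex_bij_betw[OF d, of int] by simp
  have s2: "(\<Sum>i<N. int (\<eta> i) ^ 2) = (\<Sum>i<N. int (?\<delta> i) ^ 2)"
    using sum.reindex_bij_betw[OF b, of "\<lambda>j. int j ^ 2"] sum.reindex_bij_betw[OF d, of "\<lambda>j. int j ^ 2"] by simp
  have "(\<Sum>i<N. (int (\<eta> i) - int (?\<delta> i)) ^ 2)
     = (\<Sum>i<N. (int (\<eta> i) ^ 2 - int (?\<delta> i) ^ 2) + 2 * int (i * \<eta> i) - 2 * int (i * ?\<delta> i)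
        - 2 * (int N - 1) * (int (\<eta> i) - int (?\<delta> i)))"
  proof (rule sum.cong[OF refl])
    fix i assume "i \<in> {..<N}"
    then have e: "int (?\<delta> i) = int N - 1 - int i" by (auto simp: stair_def)
    show "(int (\<eta> i) - int (?\<delta> i)) ^ 2 = (int (\<eta> i) ^ 2 - int (?\<delta> i) ^ 2) + 2 * int (i * \<eta> i) - 2 * int (i * ?\<delta> i)
        - 2 * (int N - 1) * (int (\<eta> i) - int (?\<delta> i))"
      unfolding of_nat_mult e by (simp add: power2_eq_square algebra_simps)
  qed
  also have "\<dots> = ((\<Sum>i<N. int (\<eta> i) ^ 2) - (\<Sum>i<N. int (?\<delta> i) ^ 2)) + 2 * int (index_sum N \<eta>) - 2 * int (index_sum N ?\<delta>)
      - 2 * (int N - 1) * ((\<Sum>i<N. int (\<eta> i)) - (\<Sum>i<N. int (?\<delta> i)))"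
    by (simp only: index_sum_def of_nat_sum sum.distrib sum_subtractf sum_distrib_left[symmetric])
  also have "\<dots> = 2 * int (index_sum N \<eta>) - 2 * int (index_sum N ?\<delta>)" using s1 s2 by simp
  finally have main: "(\<Sum>i<N. (int (\<eta> i) - int (?\<delta> i)) ^ 2) = 2 * int (index_sum N \<eta>) - 2 * int (index_sum N ?\<delta>)" .
  have "0 \<le> (\<Sum>i<N. (int (\<eta> i) - int (?\<delta> i)) ^ 2)" by (rule sum_nonneg) simp
  then have "index_sum N ?\<delta> \<le> index_sum N \<eta>" using main by simp
  moreover have "\<forall>i<N. \<eta> i = ?\<delta> i" if "index_sum N \<eta> = index_sum N ?\<delta>"
  proof -
    have "(\<Sum>i<N. (int (\<eta> i) - int (?\<delta> i)) ^ 2) = 0" using main that by simp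
    then have "\<forall>i\<in>{..<N}. (int (\<eta> i) - int (?\<delta> i)) ^ 2 = 0"
      by (subst (asm) sum_nonneg_eq_0_iff) auto
    then have z: "(int (\<eta> i) - int (?\<delta> i)) ^ 2 = 0" if "i < N" for i using that by blast
    have "int (\<eta> i) - int (?\<delta> i) = 0" if "i < N" for i using z[OF that] by (simp only: zero_eq_power2)
    then show ?thesis by (metis eq_iff_diff_eq_0 of_nat_eq_iff)
  qed
  ultimately show ?thesis by blast
qed

text \<open>A filling of a diagram with the numbers below \<open>n\<close>, where \<open>row\<close> and \<open>col\<close> are the coordinates of the box of
a number. The columns are initial segments; the rows need not be, and the columns need not be sorted,
which leaves room to build a diagram for any decreasing vector in \<open>diagram_of_decreasing\<close>.\<close>

locale young_diagram =
  fixes n :: nat and row col :: "nat \<Rightarrow> nat"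
  assumes box_inj: "\<And>a b. a < n \<Longrightarrow> b < n \<Longrightarrow> row a = row b \<Longrightarrow> col a = col b \<Longrightarrow> a = b"
    and column_segment: "\<And>b j. b < n \<Longrightarrow> j < row b \<Longrightarrow> \<exists>b'<n. col b' = col b \<and> row b' = j"
begin

definition RG :: "(nat \<Rightarrow> nat) set" where
  "RG = {p. p permutes {..<n} \<and> (\<forall>i<n. row (p i) = row i)}"

definition CG :: "(nat \<Rightarrow> nat) set" where
  "CG = {p. p permutes {..<n} \<and> (\<forall>i<n. col (p i) = col i)}"

text \<open>The coefficient of \<open>g\<close> in the Young symmetrizer: \<open>g\<close> is the product of an element \<open>p\<close> of the row group and
one of the column group in at most one way, so at most one term is nonzero.\<close>

definition yng :: "(nat \<Rightarrow> nat) \<Rightarrow> complex" where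
  "yng g = (\<Sum>p\<in>RG. if inv p \<circ> g \<in> CG then of_int (sign (inv p \<circ> g)) else 0)"

definition column_injective :: "(nat \<Rightarrow> nat) \<Rightarrow> bool" where
  "column_injective w \<longleftrightarrow> (\<forall>a<n. \<forall>b<n. col a = col b \<longrightarrow> w a = w b \<longrightarrow> a = b)"

lemma perm_lt: "p permutes {..<n} \<Longrightarrow> i < n \<Longrightarrow> p i < n"
  using permutes_in_image[of p "{..<n}" i] by simp

lemma RG_comp: "p \<in> RG \<Longrightarrow> q \<in> RG \<Longrightarrow> p \<circ> q \<in> RG"
  by (auto simp: RG_def permutes_compose perm_lt)

lemma CG_comp: "p \<in> CG \<Longrightarrow> q \<in> CG \<Longrightarrow> p \<circ> q \<in> CG"
  by (auto simp: CG_def permutes_compose perm_lt)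

lemma RG_inv:
  assumes "p \<in> RG" shows "inv p \<in> RG"
proof -
  have p: "p permutes {..<n}" and r: "\<And>i. i < n \<Longrightarrow> row (p i) = row i" using assms by (auto simp: RG_def)
  have "row (inv p i) = row i" if "i < n" for i
    using r[OF perm_lt[OF permutes_inv[OF p] that]] permutes_inverses(1)[OF p, of i] by simp
  then show ?thesis by (simp add: RG_def permutes_inv[OF p])
qed

lemma CG_inv:
  assumes "p \<in> CG" shows "inv p \<in> CG"
proof -
  have p: "p permutes {..<n}" and r: "\<And>i. i < n \<Longrightarrow> col (p i) = col i" using assms by (auto simp: CG_def)
  have "col (inv p i) = col i" if "i < n" for i
    using r[OF perm_lt[OF permutes_inv[OF p] that]] permutes_inverses(1)[OF p, of i] by simp
  then show ?thesis by (simp add: CG_def permutes_inv[OF p])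
qed

lemma id_RG: "id \<in> RG" by (simp add: RG_def permutes_id)
lemma id_CG: "id \<in> CG" by (simp add: CG_def permutes_id)

lemma RG_perm: "p \<in> RG \<Longrightarrow> p permutes {..<n}" by (simp add: RG_def)
lemma CG_perm: "p \<in> CG \<Longrightarrow> p permutes {..<n}" by (simp add: CG_def)

lemma permutation_of: "p permutes {..<n} \<Longrightarrow> permutation p"
  using permutation_permutes by blast

lemma RG_CG_id: assumes "p \<in> RG" "p \<in> CG" shows "p = id"
proof
  fix i
  show "p i = id i"
  proof (cases "i < n")
    case True
    then show ?thesis using assms box_inj[of "p i" i] perm_lt[of p i] by (simp add: RG_def CG_def)
  next
    case False
    then show ?thesis using permutes_not_in[OF RG_perm[OF assms(1)], of i] by simp
  qed
qed

lemma finite_RG: "finite RG"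
  by (rule finite_subset[OF _ finite_permutations[of "{..<n}"]]) (auto simp: RG_def)

lemma yng_left:
  assumes u: "u \<in> RG" shows "yng (u \<circ> g) = yng g"
  unfolding yng_def
proof (rule sum.reindex_bij_witness[of _ "\<lambda>p. u \<circ> p" "\<lambda>p. inv u \<circ> p"])
  have bu: "bij u" using RG_perm[OF u] permutes_bij by blast
  show "u \<circ> (inv u \<circ> p) = p" for p using bu by (simp add: fun_eq_iff bij_is_surj surj_f_inv_f)
  show "inv u \<circ> (u \<circ> p) = p" for p using bu by (simp add: fun_eq_iff bij_is_inj)
  show "inv u \<circ> p \<in> RG" if "p \<in> RG" for p using RG_comp[OF RG_inv[OF u] that] .
  show "u \<circ> p \<in> RG" if "p \<in> RG" for p using RG_comp[OF u that] .
  show "(if inv (inv u \<circ> p) \<circ> g \<in> CG then of_int (sign (inv (inv u \<circ> p) \<circ> g)) else 0)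
    = (if inv p \<circ> (u \<circ> g) \<in> CG then of_int (sign (inv p \<circ> (u \<circ> g))) else (0::complex))" if "p \<in> RG" for p
  proof -
    have bp: "bij p" using RG_perm[OF that] permutes_bij by blast
    have "inv (inv u \<circ> p) = inv p \<circ> u"
      using bu bp by (simp add: o_inv_distrib bij_imp_bij_inv inv_inv_eq)
    then show ?thesis by (simp add: comp_assoc)
  qed
qed

lemma yng_right:
  assumes q: "q \<in> CG" and g: "g permutes {..<n}"
  shows "yng (g \<circ> q) = of_int (sign q) * yng g"
  unfolding yng_def sum_distrib_left
proof (rule sum.cong[OF refl])
  fix p assume p: "p \<in> RG"
  let ?h = "inv p \<circ> g"
  have hp: "?h permutes {..<n}" using p g by (simp add: permutes_compose permutes_inv RG_perm)
  have bq: "bij q" using CG_perm[OF q] permutes_bij by blast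
  have "?h \<circ> q \<in> CG \<longleftrightarrow> ?h \<in> CG"
  proof
    assume "?h \<circ> q \<in> CG"
    then have "(?h \<circ> q) \<circ> inv q \<in> CG" using CG_comp CG_inv q by blast
    moreover have "(?h \<circ> q) \<circ> inv q = ?h" using bq by (simp add: fun_eq_iff bij_is_surj surj_f_inv_f)
    ultimately show "?h \<in> CG" by simp
  qed (use CG_comp q in blast)
  moreover have "sign (?h \<circ> q) = sign ?h * sign q"
    by (rule sign_compose) (use hp CG_perm[OF q] permutation_of in auto)
  ultimately show "(if inv p \<circ> (g \<circ> q) \<in> CG then of_int (sign (inv p \<circ> (g \<circ> q))) else 0)
    = of_int (sign q) * (if ?h \<in> CG then of_int (sign ?h) else (0::complex))"
    by (simp add: comp_assoc[symmetric])
qed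

lemma yng_id: "yng id = 1"
proof -
  have "yng id = (\<Sum>p\<in>RG. if p = id then 1 else 0)"
    unfolding yng_def
  proof (rule sum.cong[OF refl])
    fix p assume p: "p \<in> RG"
    show "(if inv p \<circ> id \<in> CG then of_int (sign (inv p \<circ> id)) else 0) = (if p = id then 1 else (0::complex))"
    proof (cases "p = id")
      case True
      then show ?thesis using id_CG by (simp add: sign_id)
    next
      case False
      have "inv p \<notin> CG"
      proof
        assume "inv p \<in> CG"
        then have "inv p = id" using RG_CG_id RG_inv[OF p] by blast
        then have "inv (inv p) = id" by simp
        then show False using False permutes_inv_inv[OF RG_perm[OF p]] by simp
      qed
      then show ?thesis using False by simp
    qed
  qed
  then show ?thesis using finite_RG id_RG by simp
qed

lemma sign_transpose_CG:
  assumes "a < n" "b < n" "col a = col b"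
  shows "transpose a b \<in> CG"
  using assms by (auto simp: CG_def permutes_swap_id transpose_def)

lemma transpose_RG:
  assumes "a < n" "b < n" "row a = row b"
  shows "transpose a b \<in> RG"
  using assms by (auto simp: RG_def permutes_swap_id transpose_def)

lemma column_rows:
  assumes "c \<in> col ` {..<n}"
  shows "row ` {b. b < n \<and> col b = c} = {..<card {b. b < n \<and> col b = c}}"
proof -
  let ?B = "{b. b < n \<and> col b = c}"
  have inj: "inj_on row ?B" using box_inj by (auto simp: inj_on_def)
  have down: "j \<in> row ` ?B" if "i \<in> row ` ?B" "j < i" for i j using that column_segment by force
  have fin: "finite (row ` ?B)" by simp
  have "row ` ?B = {..<card (row ` ?B)}"
  proof -
    have "i < card (row ` ?B)" if "i \<in> row ` ?B" for i
    proof -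
      have "{..i} \<subseteq> row ` ?B" using down[OF that] that by (auto simp: le_less)
      then have "card {..i} \<le> card (row ` ?B)" using fin by (rule card_mono[rotated])
      then show ?thesis by simp
    qed
    then have "row ` ?B \<subseteq> {..<card (row ` ?B)}" by auto
    then show ?thesis by (intro card_subset_eq) auto
  qed
  then show ?thesis using inj by (simp add: card_image)
qed

lemma column_sum:
  "(\<Sum>b<n. f b) = (\<Sum>c\<in>col ` {..<n}. \<Sum>b | b < n \<and> col b = c. (f b :: nat))"
  using sum.image_gen[of "{..<n}" f col] by simp

text \<open>In every column the values of \<open>w\<close> are distinct, so their sum is at least that of an initial segment,
which is the sum of the row indices. In case of equality they are a rearrangement of the rows in each
column.\<close>

lemma column_injective_stat:
  assumes w: "column_injective w"
  shows "(\<Sum>b<n. row b) \<le> (\<Sum>b<n. w b) \<and>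
    ((\<Sum>b<n. w b) = (\<Sum>b<n. row b) \<longrightarrow> (\<exists>q\<in>CG. \<forall>b<n. w (q b) = row b))"
proof -
  let ?B = "\<lambda>c. {b. b < n \<and> col b = c}"
  have injw: "inj_on w (?B c)" for c using w by (auto simp: column_injective_def inj_on_def)
  have injr: "inj_on row (?B c)" for c using box_inj by (auto simp: inj_on_def)
  have sw: "(\<Sum>b\<in>?B c. w b) = \<Sum>(w ` ?B c)" and sr: "(\<Sum>b\<in>?B c. row b) = \<Sum>(row ` ?B c)" for c
    using sum.reindex[OF injw, of "\<lambda>x. x" c] sum.reindex[OF injr, of "\<lambda>x. x" c] by simp_all
  have col_le: "(\<Sum>b\<in>?B c. row b) \<le> (\<Sum>b\<in>?B c. w b) \<and>
     ((\<Sum>b\<in>?B c. w b) = (\<Sum>b\<in>?B c. row b) \<longrightarrow> w ` ?B c = row ` ?B c)" if "c \<in> col ` {..<n}" for c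
    using sum_nat_set_ge[of "w ` ?B c"] column_rows[OF that] card_image[OF injw, of c]
    unfolding sw sr by simp
  have le: "(\<Sum>b<n. row b) \<le> (\<Sum>b<n. w b)"
    unfolding column_sum[of row] column_sum[of w] by (rule sum_mono) (use col_le in blast)
  moreover have "\<exists>q\<in>CG. \<forall>b<n. w (q b) = row b" if eq: "(\<Sum>b<n. w b) = (\<Sum>b<n. row b)"
  proof -
    have ceq: "w ` ?B c = row ` ?B c" if c: "c \<in> col ` {..<n}" for c
    proof -
      have "(\<Sum>b\<in>?B c. row b) = (\<Sum>b\<in>?B c. w b)"
      proof (rule ccontr)
        assume "(\<Sum>b\<in>?B c. row b) \<noteq> (\<Sum>b\<in>?B c. w b)"
        then have "(\<Sum>b\<in>?B c. row b) < (\<Sum>b\<in>?B c. w b)" using col_le[OF c] by simp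
        then have "(\<Sum>c\<in>col ` {..<n}. \<Sum>b\<in>?B c. row b) < (\<Sum>c\<in>col ` {..<n}. \<Sum>b\<in>?B c. w b)"
          using col_le c by (intro sum_strict_mono_ex1) auto
        then show False using eq unfolding column_sum[of row] column_sum[of w] by simp
      qed
      then show ?thesis using col_le[OF c] by simp
    qed
    have ex: "\<exists>b'. b' < n \<and> col b' = col b \<and> w b' = row b" if "b < n" for b
    proof -
      have "row b \<in> w ` ?B (col b)" using that ceq[of "col b"] by auto
      then show ?thesis by auto
    qed
    \<comment> \<open>Within each column, \<open>q\<close> sorts the values of \<open>w\<close> into the rows.\<close>
    define q where "q b = (if b < n then (SOME b'. b' < n \<and> col b' = col b \<and> w b' = row b) else b)" for b
    have q: "q b < n \<and> col (q b) = col b \<and> w (q b) = row b" if "b < n" for b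
      unfolding q_def using someI_ex[OF ex[OF that]] that by simp
    have "inj_on q {..<n}"
    proof (rule inj_onI)
      fix a b assume "a \<in> {..<n}" "b \<in> {..<n}" "q a = q b"
      then show "a = b" using q[of a] q[of b] box_inj[of a b] by auto
    qed
    moreover have "q ` {..<n} \<subseteq> {..<n}" using q by auto
    ultimately have "bij_betw q {..<n} {..<n}"
      unfolding bij_betw_def using endo_inj_surj[of "{..<n}" q] by simp
    then have "q permutes {..<n}" by (rule bij_imp_permutes) (simp add: q_def)
    then have "q \<in> CG" using q by (simp add: CG_def)
    then show ?thesis using q by blast
  qed
  ultimately show ?thesis by blast
qed

text \<open>Young's lemma: if two numbers in the same column of the diagram are sent to the same row by \<open>g\<close>, then
the transposition gives \<open>y g = - y g\<close>; otherwise \<open>g\<close> is a product of a row and a column permutation.\<close>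

lemma biequivariant_unique:
  assumes yl: "\<And>u g. u \<in> RG \<Longrightarrow> g permutes {..<n} \<Longrightarrow> y (u \<circ> g) = (y g :: complex)"
    and yr: "\<And>q g. q \<in> CG \<Longrightarrow> g permutes {..<n} \<Longrightarrow> y (g \<circ> q) = of_int (sign q) * y g"
    and g: "g permutes {..<n}"
  shows "y g = y id * yng g"
proof -
  have bg: "bij g" using g permutes_bij by blast
  have dich: "(z g = 0 \<or> column_injective (row \<circ> g)) "
    if zl: "\<And>u g. u \<in> RG \<Longrightarrow> g permutes {..<n} \<Longrightarrow> z (u \<circ> g) = (z g :: complex)"
    and zr: "\<And>q g. q \<in> CG \<Longrightarrow> g permutes {..<n} \<Longrightarrow> z (g \<circ> q) = of_int (sign q) * z g" for z
  proof (rule disjCI)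
    assume "\<not> column_injective (row \<circ> g)"
    then obtain a b where ab: "a < n" "b < n" "col a = col b" "row (g a) = row (g b)" "a \<noteq> b"
      by (auto simp: column_injective_def)
    have t: "transpose a b \<in> CG" using ab by (intro sign_transpose_CG)
    have u: "transpose (g a) (g b) \<in> RG" using ab perm_lt[OF g] by (intro transpose_RG) auto
    have "transpose (g a) (g b) \<circ> g = g \<circ> transpose a b"
      using bg by (auto simp: fun_eq_iff transpose_def bij_def inj_eq)
    then have "z g = - z g"
      using zl[OF u g] zr[OF t g] ab(5) by (simp add: sign_swap_id)
    then show "z g = 0" by simp
  qed
  show ?thesis
  proof (cases "column_injective (row \<circ> g)")
    case False
    then show ?thesis using dich[of y, OF yl yr] dich[of yng, OF yng_left yng_right] by auto
  next
    case True
    have "bij_betw g {..<n} {..<n}" using g by (rule permutes_imp_bij)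
    then have "(\<Sum>b<n. (row \<circ> g) b) = (\<Sum>b<n. row b)"
      unfolding comp_def by (rule sum.reindex_bij_betw)
    then obtain q where q: "q \<in> CG" "\<forall>b<n. row (g (q b)) = row b"
      using column_injective_stat[OF True] by auto
    have gq: "g \<circ> q \<in> RG" using q g CG_perm[OF q(1)] by (simp add: RG_def permutes_compose)
    have bq: "bij q" using CG_perm[OF q(1)] permutes_bij by blast
    have iq: "inv q \<in> CG" using CG_inv[OF q(1)] .
    have e: "(g \<circ> q) \<circ> (id \<circ> inv q) = g" using bq by (simp add: fun_eq_iff bij_is_surj surj_f_inv_f)
    have pid: "id permutes {..<n}" "id \<circ> inv q permutes {..<n}"
      using CG_perm[OF iq] by (simp_all add: permutes_id)
    have "y g = of_int (sign (inv q)) * y id"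
      using yl[OF gq pid(2)] yr[OF iq pid(1)] unfolding e by simp
    moreover have "yng g = of_int (sign (inv q))"
      using yng_left[OF gq, of "id \<circ> inv q"] yng_right[OF iq pid(1)] yng_id unfolding e by simp
    ultimately show ?thesis by simp
  qed
qed

text \<open>A transposition in the column group that fixes the word pairs off the terms with opposite signs.\<close>

lemma stabilizer_sum_zero:
  assumes "\<not> column_injective w"
  shows "(\<Sum>g | g permutes {..<n} \<and> (\<forall>b<n. w (g b) = w b). yng g) = 0"
proof -
  obtain a b where ab: "a < n" "b < n" "col a = col b" "w a = w b" "a \<noteq> b"
    using assms by (auto simp: column_injective_def)
  let ?t = "transpose a b"
  let ?G = "{g. g permutes {..<n} \<and> (\<forall>b<n. w (g b) = w b)}"
  have t: "?t \<in> CG" using ab by (intro sign_transpose_CG)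
  have wt: "w (?t i) = w i" for i using ab(4) by (auto simp: transpose_def)
  have tt: "?t i < n" if "i < n" for i using perm_lt[OF CG_perm[OF t] that] .
  have G: "g \<circ> ?t \<in> ?G" if "g \<in> ?G" for g
    using that CG_perm[OF t] tt wt by (auto simp: permutes_compose)
  have ii: "g \<circ> ?t \<circ> ?t = g" for g :: "nat \<Rightarrow> nat" by (simp add: fun_eq_iff)
  have "(\<Sum>g\<in>?G. yng g) = (\<Sum>g\<in>?G. yng (g \<circ> ?t))"
    by (rule sum.reindex_bij_witness[of _ "\<lambda>g. g \<circ> ?t" "\<lambda>g. g \<circ> ?t"]) (use G ii in auto)
  also have "\<dots> = (\<Sum>g\<in>?G. - yng g)"
    by (rule sum.cong[OF refl]) (use yng_right[OF t] ab(5) in \<open>simp add: sign_swap_id\<close>)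
  finally show ?thesis by (simp add: sum_negf)
qed

text \<open>The image of the coefficient functions \<open>char_fn\<close> under the Young symmetrizer: up to a factor,
the coefficients of the product of the Vandermonde determinant and the Schur function of the shape.\<close>

definition averaged_char_fn :: "nat \<Rightarrow> (nat \<Rightarrow> nat) \<Rightarrow> complex" where
  "averaged_char_fn N l = (\<Sum>g | g permutes {..<n}. yng g * of_int (char_fn N {..<n} g l))"

text \<open>The beta-numbers of the diagram.\<close>

definition shape :: "nat \<Rightarrow> nat \<Rightarrow> nat" where
  "shape N i = (if i < N then card {b. b < n \<and> row b = i} + stair N i else 0)"

definition shape_stat :: "nat \<Rightarrow> nat" where
  "shape_stat N = (\<Sum>b<n. row b) + index_sum N (stair N)"

text \<open>Triangularity. In the sum over words only those survive that are injective on columns; for such a word,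
\<open>l\<close> is the sum of its content and an arrangement of 0, ..., \<open>N - 1\<close>. Both have a minimal index sum,
which is attained only for the shape itself.\<close>

lemma averaged_char_fn_support:
  assumes nz: "averaged_char_fn N l \<noteq> 0" and l0: "\<forall>i\<ge>N. l i = 0"
  shows "shape_stat N \<le> index_sum N l \<and> (index_sum N l = shape_stat N \<longrightarrow> l = shape N)"
proof -
  let ?W = "{..<n} \<rightarrow>\<^sub>E {..<N}"
  let ?P = "{g. g permutes {..<n}}"
  have finW: "finite ?W" by (simp add: finite_PiE)
  have finP: "finite ?P" by (rule finite_permutations) simp
  have "averaged_char_fn N l = (\<Sum>g\<in>?P. \<Sum>w\<in>?W. if \<forall>b<n. w (g b) = w b then yng g * of_int (word_term N {..<n} w l) else 0)"
    unfolding averaged_char_fn_def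
  proof (rule sum.cong[OF refl])
    fix g
    have "char_fn N {..<n} g l = (\<Sum>w\<in>?W. if \<forall>b<n. w (g b) = w b then word_term N {..<n} w l else 0)"
      unfolding char_fn_def fixed_words_def by (subst sum.inter_filter[OF finW, symmetric]) (auto intro!: sum.cong)
    then show "yng g * of_int (char_fn N {..<n} g l)
      = (\<Sum>w\<in>?W. if \<forall>b<n. w (g b) = w b then yng g * of_int (word_term N {..<n} w l) else 0)"
      by (simp add: sum_distrib_left if_distrib of_int_sum cong: if_cong)
  qed
  also have "\<dots> = (\<Sum>w\<in>?W. \<Sum>g\<in>?P. if \<forall>b<n. w (g b) = w b then yng g * of_int (word_term N {..<n} w l) else 0)"
    by (rule sum.swap)
  also have "\<dots> = (\<Sum>w\<in>?W. (\<Sum>g | g permutes {..<n} \<and> (\<forall>b<n. w (g b) = w b). yng g) * of_int (word_term N {..<n} w l))"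
  proof (rule sum.cong[OF refl])
    fix w :: "nat \<Rightarrow> nat"
    have "{g. g permutes {..<n} \<and> (\<forall>b<n. w (g b) = w b)} = {g \<in> ?P. \<forall>b<n. w (g b) = w b}" by simp
    then show "(\<Sum>g\<in>?P. if \<forall>b<n. w (g b) = w b then yng g * of_int (word_term N {..<n} w l) else 0)
      = (\<Sum>g | g permutes {..<n} \<and> (\<forall>b<n. w (g b) = w b). yng g) * of_int (word_term N {..<n} w l)"
      by (simp only: sum_distrib_right sum.inter_filter[OF finP]) (auto intro!: sum.cong)
  qed
  finally have e: "averaged_char_fn N l = (\<Sum>w\<in>?W. (\<Sum>g | g permutes {..<n} \<and> (\<forall>b<n. w (g b) = w b). yng g) * of_int (word_term N {..<n} w l))" .
  from nz obtain w where w: "w \<in> ?W"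
    and s: "(\<Sum>g | g permutes {..<n} \<and> (\<forall>b<n. w (g b) = w b). yng g) * of_int (word_term N {..<n} w l) \<noteq> 0"
    unfolding e by (rule sum.not_neutral_contains_not_neutral)
  then have ci: "column_injective w" using stabilizer_sum_zero[of w] by auto
  have "word_term N {..<n} w l \<noteq> 0" using s by auto
  then have cle: "\<And>i. i < N \<Longrightarrow> letter_count {..<n} w i \<le> l i"
    and vac: "vacuum N (\<lambda>i. l i - letter_count {..<n} w i) \<noteq> 0" by (auto simp: word_term_def split: if_splits)
  define \<eta> where "\<eta> = (\<lambda>i. l i - letter_count {..<n} w i)"
  have \<eta>: "\<eta> ` {..<N} = {..<N}" using vac by (auto simp: vacuum_def \<eta>_def split: if_splits)
  have wN: "\<And>b. b < n \<Longrightarrow> w b < N" using w by (auto simp: PiE_iff)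
  have cw: "(\<Sum>i<N. i * letter_count {..<n} w i) = (\<Sum>b<n. w b)"
  proof -
    have "(\<Sum>b<n. w b) = (\<Sum>i\<in>w ` {..<n}. \<Sum>b\<in>{b \<in> {..<n}. w b = i}. w b)"
      by (rule sum.image_gen) simp
    also have "\<dots> = (\<Sum>i\<in>w ` {..<n}. i * letter_count {..<n} w i)"
      by (rule sum.cong[OF refl]) (simp add: letter_count_def)
    also have "\<dots> = (\<Sum>i<N. i * letter_count {..<n} w i)"
    proof (rule sum.mono_neutral_left)
      show "\<forall>i\<in>{..<N} - w ` {..<n}. i * letter_count {..<n} w i = 0"
        by (auto simp: letter_count_def card_eq_0_iff)
    qed (use wN in auto)
    finally show ?thesis by simp
  qed
  have st: "index_sum N l = (\<Sum>b<n. w b) + index_sum N \<eta>"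
    unfolding cw[symmetric] index_sum_def sum.distrib[symmetric]
  proof (rule sum.cong[OF refl])
    fix i assume "i \<in> {..<N}"
    then have "letter_count {..<n} w i + (l i - letter_count {..<n} w i) = l i" using cle[of i] by simp
    then show "i * l i = i * letter_count {..<n} w i + i * \<eta> i"
      unfolding \<eta>_def add_mult_distrib2[symmetric] by (rule arg_cong[OF sym])
  qed
  note a = column_injective_stat[OF ci] and b = index_sum_bij[OF \<eta>]
  have "shape_stat N \<le> index_sum N l" unfolding st shape_stat_def using a b by (intro add_mono) auto
  moreover have "l = shape N" if eq: "index_sum N l = shape_stat N"
  proof -
    have "(\<Sum>b<n. w b) = (\<Sum>b<n. row b)" "index_sum N \<eta> = index_sum N (stair N)"
      using eq a b unfolding st shape_stat_def by linarith+
    then obtain q where q: "q \<in> CG" "\<forall>b<n. w (q b) = row b" and \<eta>d: "\<And>i. i < N \<Longrightarrow> \<eta> i = stair N i"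
      using a b by auto
    have lc: "letter_count {..<n} w i = card {b. b < n \<and> row b = i}" for i
    proof -
      have qb: "bij_betw q {..<n} {..<n}" using CG_perm[OF q(1)] by (rule permutes_imp_bij)
      have "q ` {b. b < n \<and> row b = i} = {b. b < n \<and> w b = i}"
      proof (intro equalityI subsetI)
        fix x assume "x \<in> q ` {b. b < n \<and> row b = i}"
        then obtain b where b: "b < n" "row b = i" "x = q b" by blast
        then show "x \<in> {b. b < n \<and> w b = i}" using perm_lt[OF CG_perm[OF q(1)] b(1)] q(2) by simp
      next
        fix x assume x: "x \<in> {b. b < n \<and> w b = i}"
        then have "x \<in> q ` {..<n}" using bij_betw_imp_surj_on[OF qb] by simp
        then obtain a where a: "a < n" "x = q a" by blast
        then have "row a = i" using q(2) x by simp
        then show "x \<in> q ` {b. b < n \<and> row b = i}" using a by blast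
      qed
      moreover have inj: "inj_on q {b. b < n \<and> row b = i}"
        by (rule inj_on_subset[OF bij_betw_imp_inj_on[OF qb]]) auto
      ultimately have "card {b. b < n \<and> w b = i} = card {b. b < n \<and> row b = i}"
        using card_image[OF inj] by simp
      then show ?thesis by (simp add: letter_count_def)
    qed
    show ?thesis
    proof
      fix i
      show "l i = shape N i"
        using l0 \<eta>d[of i] cle[of i] lc[of i] by (cases "i < N") (auto simp: shape_def \<eta>_def)
    qed
  qed
  ultimately show ?thesis by blast
qed

end

section \<open>Orthogonality and the Frobenius formula\<close>

definition decreasing :: "nat \<Rightarrow> (nat \<Rightarrow> nat) \<Rightarrow> bool" where
  "decreasing N l \<longleftrightarrow> (\<forall>i j. i < j \<longrightarrow> j < N \<longrightarrow> l j < l i)"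

lemma alternating_permutes:
  assumes F: "alternating N F" and w: "w permutes {..<N}"
  shows "F (l \<circ> w) = sign w * F l"
  using w finite_lessThan
proof (induction w arbitrary: l rule: permutes_induct)
  case id
  then show ?case by (simp add: sign_id)
next
  case (swap a b p)
  have "F (l \<circ> (transpose a b \<circ> p)) = sign p * F (l \<circ> transpose a b)"
    using swap.IH[of "l \<circ> transpose a b"] by (simp only: comp_assoc)
  also have "F (l \<circ> transpose a b) = - F l" using F swap.hyps unfolding alternating_def by auto
  also have "sign p * - F l = sign (transpose a b \<circ> p) * F l"
  proof -
    have "permutation p" using swap.hyps(4) permutation_permutes by blast
    then show ?thesis using swap.hyps(3) by (simp add: sign_compose sign_swap_id permutation_swap_id)
  qed
  finally show ?case .
qed

lemma decreasing_rearrangement: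
  assumes inj: "inj_on l {..<N}"
  obtains w where "w permutes {..<N}" "decreasing N (l \<circ> w)"
proof -
  define L where "L = rev (sorted_list_of_set (l ` {..<N}))"
  have len: "length L = N" using inj by (simp add: L_def card_image)
  have setL: "set L = l ` {..<N}" by (simp add: L_def)
  have distL: "distinct L" by (simp add: L_def)
  have sortL: "sorted_wrt (>) L" unfolding L_def sorted_wrt_rev by simp
  define w where "w i = (if i < N then inv_into {..<N} l (L ! i) else i)" for i
  have lw: "w i < N \<and> l (w i) = L ! i" if "i < N" for i
  proof -
    have "L ! i \<in> l ` {..<N}" using that len setL nth_mem[of i L] by simp
    then show ?thesis using that f_inv_into_f[of "L ! i" l "{..<N}"] inv_into_into[of "L ! i" l "{..<N}"]
      by (simp add: w_def)
  qed
  have "inj_on w {..<N}"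
  proof (rule inj_onI)
    fix i j assume ij: "i \<in> {..<N}" "j \<in> {..<N}" "w i = w j"
    then have "L ! i = L ! j" using lw[of i] lw[of j] by simp
    then show "i = j" using ij distL len by (simp add: nth_eq_iff_index_eq)
  qed
  moreover have "w ` {..<N} \<subseteq> {..<N}" using lw by auto
  ultimately have "bij_betw w {..<N} {..<N}"
    unfolding bij_betw_def using endo_inj_surj[of "{..<N}" w] by simp
  then have "w permutes {..<N}" by (rule bij_imp_permutes) (simp add: w_def)
  moreover have "decreasing N (l \<circ> w)"
    unfolding decreasing_def
  proof (intro allI impI)
    fix i j assume ij: "i < j" "j < N"
    then have "L ! j < L ! i" using sortL len by (simp add: sorted_wrt_iff_nth_less)
    then show "(l \<circ> w) j < (l \<circ> w) i" using lw[of i] lw[of j] ij by simp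
  qed
  ultimately show ?thesis by (rule that)
qed

lemma states_permutes:
  assumes "w permutes {..<N}" "l \<in> states N d"
  shows "l \<circ> w \<in> states N d"
proof -
  have "(\<Sum>i<N. l (w i)) = (\<Sum>i<N. l i)"
    by (rule sum.reindex_bij_betw[OF permutes_imp_bij[OF assms(1)]])
  then show ?thesis using assms permutes_not_in[OF assms(1)] by (auto simp: states_def)
qed

lemma vacuum_norm_nonzero: "pairing N 0 (vacuum N) (vacuum N) \<noteq> 0"
proof -
  define d where "d = (\<lambda>i. if i < N then i else (0::nat))"
  have img: "d ` {..<N} = {..<N}" by (auto simp: d_def image_iff)
  have "inj_on d {..<N}" by (auto simp: d_def inj_on_def)
  then have nz: "vacuum N d \<noteq> 0" using img vander_nonzero[of N d] by (auto simp: vacuum_def d_def)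
  then have ds: "d \<in> states N 0" using homogeneous_vacuum by (simp add: homogeneous_def)
  have "0 < vacuum N d * vacuum N d" using nz by (simp add: zero_less_mult_iff linorder_neq_iff) linarith
  also have "\<dots> \<le> (\<Sum>l\<in>states N 0. vacuum N l * vacuum N l)"
    by (rule member_le_sum[OF ds]) (auto simp: finite_states)
  finally show ?thesis by (simp add: pairing_def)
qed

lemma inv_set_permutes: "g permutes {..<n} \<Longrightarrow> inv_set g {..<n}"
  using permutation_permutes permutes_in_image[of g "{..<n}"] by (auto simp: inv_set_def)

lemma card_equivariant_permutes:
  assumes "s permutes {..<n}" "g permutes {..<n}"
  shows "card (equivariant {..<n} s {..<n} g) = card {x. x permutes {..<n} \<and> x \<circ> s = g \<circ> x}"
proof (rule bij_betw_same_card[of "\<lambda>x i. if i < n then x i else i"], rule bij_betwI[of _ _ _ "\<lambda>x. restrict x {..<n}"])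
  have sn: "s i < n \<longleftrightarrow> i < n" and gn: "g i < n \<longleftrightarrow> i < n" for i
    using permutes_in_image[OF assms(1), of i] permutes_in_image[OF assms(2), of i] by auto
  have sf: "s i = i" and gf: "g i = i" if "\<not> i < n" for i
    using permutes_not_in[OF assms(1)] permutes_not_in[OF assms(2)] that by auto
  show "(\<lambda>x i. if i < n then x i else i) \<in> equivariant {..<n} s {..<n} g \<rightarrow> {x. x permutes {..<n} \<and> x \<circ> s = g \<circ> x}"
  proof
    fix x assume x: "x \<in> equivariant {..<n} s {..<n} g"
    let ?x = "\<lambda>i. if i < n then x i else i"
    have "bij_betw x {..<n} {..<n}" using x by (simp add: equivariant_def)
    then have "bij_betw ?x {..<n} {..<n}" by (subst bij_betw_cong[of _ _ x]) auto
    then have "?x permutes {..<n}" by (rule bij_imp_permutes) simp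
    moreover have "?x \<circ> s = g \<circ> ?x" using x sn sf gf by (auto simp: fun_eq_iff equivariant_def)
    ultimately show "?x \<in> {x. x permutes {..<n} \<and> x \<circ> s = g \<circ> x}" by simp
  qed
  show "(\<lambda>x. restrict x {..<n}) \<in> {x. x permutes {..<n} \<and> x \<circ> s = g \<circ> x} \<rightarrow> equivariant {..<n} s {..<n} g"
  proof
    fix x assume "x \<in> {x. x permutes {..<n} \<and> x \<circ> s = g \<circ> x}"
    then have x: "x permutes {..<n}" and e: "\<And>i. x (s i) = g (x i)" by (auto simp: fun_eq_iff)
    have "bij_betw (restrict x {..<n}) {..<n} {..<n}"
      using permutes_imp_bij[OF x] by (subst bij_betw_cong[of _ _ x]) auto
    moreover have "restrict x {..<n} \<in> {..<n} \<rightarrow>\<^sub>E {..<n}" using permutes_in_image[OF x] by auto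
    ultimately show "restrict x {..<n} \<in> equivariant {..<n} s {..<n} g"
      using e sn by (simp add: equivariant_def)
  qed
  show "restrict (\<lambda>i. if i < n then x i else i) {..<n} = x" if "x \<in> equivariant {..<n} s {..<n} g" for x
    using that by (auto simp: equivariant_def fun_eq_iff PiE_iff extensional_def)
  show "(\<lambda>i. if i < n then restrict x {..<n} i else i) = x" if "x \<in> {x. x permutes {..<n} \<and> x \<circ> s = g \<circ> x}" for x
    using that permutes_not_in[of x "{..<n}"] by (auto simp: fun_eq_iff)
qed

context young_diagram
begin

text \<open>The trace of \<open>inv s\<close> on the left ideal of the symmetrizer, up to a factor.\<close>

definition conj_sum :: "(nat \<Rightarrow> nat) \<Rightarrow> complex" where
  "conj_sum s = (\<Sum>x | x permutes {..<n}. yng (x \<circ> s \<circ> inv x))"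

lemma conj_sum_id: "conj_sum id \<noteq> 0"
proof -
  have "x \<circ> id \<circ> inv x = id" if "x permutes {..<n}" for x
    using permutes_inv_o(1)[OF that] by simp
  then have "conj_sum id = (\<Sum>x | x permutes {..<n}. yng id)"
    unfolding conj_sum_def by (intro sum.cong) auto
  also have "\<dots> = of_nat (fact n)" by (simp add: yng_id card_permutations)
  finally show ?thesis by simp
qed

lemma averaged_char_fn_permutes:
  assumes "w permutes {..<N}"
  shows "averaged_char_fn N (l \<circ> w) = of_int (sign w) * averaged_char_fn N l"
  unfolding averaged_char_fn_def sum_distrib_left
proof (rule sum.cong[OF refl])
  fix g assume "g \<in> {g. g permutes {..<n}}"
  then have "inv_set g {..<n}" by (simp add: inv_set_permutes)
  then have "alternating N (char_fn N {..<n} g)" using char_fn_alternating_homogeneous by blast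
  then have "char_fn N {..<n} g (l \<circ> w) = sign w * char_fn N {..<n} g l"
    by (rule alternating_permutes[OF _ assms])
  then show "yng g * of_int (char_fn N {..<n} g (l \<circ> w)) = of_int (sign w) * (yng g * of_int (char_fn N {..<n} g l))"
    by simp
qed

lemma averaged_char_fn_inj:
  assumes "averaged_char_fn N l \<noteq> 0" shows "inj_on l {..<N}"
proof -
  obtain g where g: "g \<in> {g. g permutes {..<n}}" and "yng g * of_int (char_fn N {..<n} g l) \<noteq> 0"
    using assms unfolding averaged_char_fn_def by (rule sum.not_neutral_contains_not_neutral)
  then have "char_fn N {..<n} g l \<noteq> 0" by auto
  moreover have "alternating N (char_fn N {..<n} g)"
    using char_fn_alternating_homogeneous inv_set_permutes g by blast
  ultimately show ?thesis using alternating_inj by blast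
qed

text \<open>The orthogonality relation replaces the count of the \<open>x\<close> with \<open>x \<circ> s = g \<circ> x\<close> by the sum over \<open>l\<close> of
the products of coefficient functions.\<close>

lemma conj_sum_expand:
  assumes s: "s permutes {..<n}" and N: "n \<le> N"
  shows "of_int (pairing N 0 (vacuum N) (vacuum N)) * conj_sum s
    = (\<Sum>l\<in>states N n. of_int (char_fn N {..<n} s l) * averaged_char_fn N l)"
proof -
  let ?P = "{g. g permutes {..<n}}"
  let ?K = "pairing N 0 (vacuum N) (vacuum N)"
  have finP: "finite ?P" by (rule finite_permutations) simp
  have "(\<Sum>l\<in>states N n. of_int (char_fn N {..<n} s l) * averaged_char_fn N l)
     = (\<Sum>l\<in>states N n. \<Sum>g\<in>?P. yng g * of_int (char_fn N {..<n} s l * char_fn N {..<n} g l))"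
    unfolding averaged_char_fn_def sum_distrib_left by (intro sum.cong refl) simp
  also have "\<dots> = (\<Sum>g\<in>?P. \<Sum>l\<in>states N n. yng g * of_int (char_fn N {..<n} s l * char_fn N {..<n} g l))"
    by (rule sum.swap)
  also have "\<dots> = (\<Sum>g\<in>?P. yng g * of_int (pairing N n (char_fn N {..<n} s) (char_fn N {..<n} g)))"
    by (simp only: pairing_def of_int_sum sum_distrib_left)
  also have "\<dots> = (\<Sum>g\<in>?P. \<Sum>x\<in>?P. of_int ?K * (if x \<circ> s = g \<circ> x then yng g else 0))"
  proof (rule sum.cong[OF refl])
    fix g assume g: "g \<in> ?P"
    have "pairing N n (char_fn N {..<n} s) (char_fn N {..<n} g) = ?K * int (card (equivariant {..<n} s {..<n} g))"
      using pairing_char_fn[of s "{..<n}" g "{..<n}" N] s g N inv_set_permutes by simp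
    also have "card (equivariant {..<n} s {..<n} g) = card {x \<in> ?P. x \<circ> s = g \<circ> x}"
      using card_equivariant_permutes[OF s, of g] g by simp
    finally have "yng g * of_int (pairing N n (char_fn N {..<n} s) (char_fn N {..<n} g))
      = (\<Sum>x\<in>{x \<in> ?P. x \<circ> s = g \<circ> x}. of_int ?K * yng g)" by simp
    also have "\<dots> = (\<Sum>x\<in>?P. if x \<circ> s = g \<circ> x then of_int ?K * yng g else 0)"
      by (rule sum.inter_filter[OF finP])
    finally show "yng g * of_int (pairing N n (char_fn N {..<n} s) (char_fn N {..<n} g))
      = (\<Sum>x\<in>?P. of_int ?K * (if x \<circ> s = g \<circ> x then yng g else 0))"
      by (simp add: if_distrib cong: if_cong)
  qed
  also have "\<dots> = (\<Sum>x\<in>?P. \<Sum>g\<in>?P. of_int ?K * (if x \<circ> s = g \<circ> x then yng g else 0))"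
    by (rule sum.swap)
  also have "\<dots> = (\<Sum>x\<in>?P. of_int ?K * yng (x \<circ> s \<circ> inv x))"
  proof (rule sum.cong[OF refl])
    fix x assume x: "x \<in> ?P"
    then have xs: "x \<circ> s \<circ> inv x \<in> ?P" using s by (auto intro: permutes_compose permutes_inv)
    have "x \<circ> s = g \<circ> x \<longleftrightarrow> g = x \<circ> s \<circ> inv x" for g
    proof
      assume "x \<circ> s = g \<circ> x"
      then have "x \<circ> s \<circ> inv x = g \<circ> (x \<circ> inv x)" by (simp add: comp_assoc)
      then show "g = x \<circ> s \<circ> inv x" using x permutes_inv_o(1)[of x "{..<n}"] by simp
    next
      assume "g = x \<circ> s \<circ> inv x"
      then have "g \<circ> x = x \<circ> s \<circ> (inv x \<circ> x)" by (simp add: comp_assoc)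
      then show "x \<circ> s = g \<circ> x" using x permutes_inv_o(2)[of x "{..<n}"] by simp
    qed
    then have "(\<Sum>g\<in>?P. of_int ?K * (if x \<circ> s = g \<circ> x then yng g else 0))
      = (\<Sum>g\<in>?P. if g = x \<circ> s \<circ> inv x then of_int ?K * yng (x \<circ> s \<circ> inv x) else 0)"
      by (intro sum.cong refl) auto
    also have "\<dots> = of_int ?K * yng (x \<circ> s \<circ> inv x)" using xs finP by simp
    finally show "(\<Sum>g\<in>?P. of_int ?K * (if x \<circ> s = g \<circ> x then yng g else 0)) = of_int ?K * yng (x \<circ> s \<circ> inv x)" .
  qed
  finally show ?thesis by (simp add: conj_sum_def sum_distrib_left)
qed

lemma row_less:
  assumes b: "b < n" shows "row b < n"
proof -
  have "{..row b} \<subseteq> row ` {..<n}"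
  proof
    fix j assume "j \<in> {..row b}"
    then have "j = row b \<or> j < row b" by auto
    then show "j \<in> row ` {..<n}" using column_segment[OF b, of j] b by auto
  qed
  then have "card {..row b} \<le> card (row ` {..<n})" by (rule card_mono[rotated]) simp
  also have "\<dots> \<le> n" using card_image_le[of "{..<n}" row] by simp
  finally show ?thesis by simp
qed

lemma sum_rows:
  assumes N: "n \<le> N"
  shows "(\<Sum>i<N. f i * card {b. b < n \<and> row b = i}) = (\<Sum>b<n. f (row b) :: nat)"
proof -
  have "(\<Sum>b<n. f (row b)) = (\<Sum>i\<in>row ` {..<n}. \<Sum>b\<in>{b \<in> {..<n}. row b = i}. f (row b))"
    by (rule sum.image_gen) simp
  also have "\<dots> = (\<Sum>i\<in>row ` {..<n}. f i * card {b. b < n \<and> row b = i})"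
    by (rule sum.cong[OF refl]) simp
  also have "\<dots> = (\<Sum>i<N. f i * card {b. b < n \<and> row b = i})"
  proof (rule sum.mono_neutral_left)
    show "row ` {..<n} \<subseteq> {..<N}" using row_less N by fastforce
    show "\<forall>i\<in>{..<N} - row ` {..<n}. f i * card {b. b < n \<and> row b = i} = 0"
      by (auto simp: card_eq_0_iff)
  qed simp
  finally show ?thesis by simp
qed

lemma sum_stair: "(\<Sum>i<N. stair N i) = \<Sum>{..<N}"
  by (rule sum.reindex_bij_witness[of _ "stair N" "stair N"]) (auto simp: stair_def)

lemma shape_states:
  assumes N: "n \<le> N" shows "shape N \<in> states N n"
proof -
  have "(\<Sum>i<N. shape N i) = (\<Sum>i<N. card {b. b < n \<and> row b = i}) + (\<Sum>i<N. stair N i)"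
    by (simp add: shape_def sum.distrib)
  also have "(\<Sum>i<N. card {b. b < n \<and> row b = i}) = n" using sum_rows[OF N, of "\<lambda>_. 1"] by simp
  finally show ?thesis by (simp add: states_def sum_stair shape_def)
qed

lemma index_sum_shape:
  assumes N: "n \<le> N" shows "index_sum N (shape N) = shape_stat N"
proof -
  have "index_sum N (shape N) = (\<Sum>i<N. i * card {b. b < n \<and> row b = i}) + index_sum N (stair N)"
    unfolding index_sum_def sum.distrib[symmetric] by (rule sum.cong[OF refl]) (simp add: shape_def algebra_simps)
  then show ?thesis using sum_rows[OF N, of "\<lambda>i. i"] by (simp add: shape_stat_def)
qed

text \<open>By antisymmetry, only rearrangements of the shape contribute to the expansion, and they all contribute
the same amount; \<open>M\<close> is their number.\<close>

lemma conj_sum_of_vanishing: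
  assumes N: "n \<le> N"
    and van: "\<And>l. l \<in> states N n \<Longrightarrow> decreasing N l \<Longrightarrow> l \<noteq> shape N \<Longrightarrow> averaged_char_fn N l = 0"
  shows "\<exists>M::nat. \<forall>s. s permutes {..<n} \<longrightarrow> of_int (pairing N 0 (vacuum N) (vacuum N)) * conj_sum s
    = of_nat M * averaged_char_fn N (shape N) * of_int (char_fn N {..<n} s (shape N))"
proof -
  define X where "X = (\<lambda>w. shape N \<circ> w) ` {w. w permutes {..<N}}"
  have XS: "X \<subseteq> states N n" using states_permutes shape_states[OF N] by (auto simp: X_def)
  have out: "averaged_char_fn N l = 0" if l: "l \<in> states N n - X" for l
  proof (rule ccontr)
    assume nz: "averaged_char_fn N l \<noteq> 0"
    obtain w where w: "w permutes {..<N}" "decreasing N (l \<circ> w)"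
      using decreasing_rearrangement[OF averaged_char_fn_inj[OF nz]] by blast
    have "averaged_char_fn N (l \<circ> w) \<noteq> 0" unfolding averaged_char_fn_permutes[OF w(1), of l] using nz by (simp add: sign_def)
    moreover have "l \<circ> w \<in> states N n" using l w by (intro states_permutes) auto
    ultimately have e: "l \<circ> w = shape N" using van w(2) by blast
    have "l = l \<circ> w \<circ> inv w" unfolding comp_assoc permutes_inv_o(1)[OF w(1)] by simp
    then have "l = shape N \<circ> inv w" unfolding e .
    then have "l \<in> X" using permutes_inv[OF w(1)] by (auto simp: X_def)
    then show False using l by simp
  qed
  have "of_int (pairing N 0 (vacuum N) (vacuum N)) * conj_sum s
    = of_nat (card X) * averaged_char_fn N (shape N) * of_int (char_fn N {..<n} s (shape N))" if s: "s permutes {..<n}" for s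
  proof -
    have alt: "alternating N (char_fn N {..<n} s)"
      using char_fn_alternating_homogeneous inv_set_permutes s by blast
    have "of_int (pairing N 0 (vacuum N) (vacuum N)) * conj_sum s
      = (\<Sum>l\<in>states N n. of_int (char_fn N {..<n} s l) * averaged_char_fn N l)" by (rule conj_sum_expand[OF s N])
    also have "\<dots> = (\<Sum>l\<in>X. of_int (char_fn N {..<n} s l) * averaged_char_fn N l)"
      by (rule sum.mono_neutral_right[OF finite_states XS]) (use out in simp)
    also have "\<dots> = (\<Sum>l\<in>X. of_int (char_fn N {..<n} s (shape N)) * averaged_char_fn N (shape N))"
    proof (rule sum.cong[OF refl])
      fix l assume "l \<in> X"
      then obtain w where w: "w permutes {..<N}" and l: "l = shape N \<circ> w" by (auto simp: X_def)
      have sq: "of_int (sign w) * of_int (sign w) = (1::complex)" by (simp add: sign_def)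
      have "of_int (char_fn N {..<n} s l) * averaged_char_fn N l
        = (of_int (sign w) * of_int (sign w)) * (of_int (char_fn N {..<n} s (shape N)) * averaged_char_fn N (shape N))"
        unfolding l alternating_permutes[OF alt w] averaged_char_fn_permutes[OF w] by simp
      then show "of_int (char_fn N {..<n} s l) * averaged_char_fn N l
        = of_int (char_fn N {..<n} s (shape N)) * averaged_char_fn N (shape N)" unfolding sq by simp
    qed
    also have "\<dots> = of_nat (card X) * averaged_char_fn N (shape N) * of_int (char_fn N {..<n} s (shape N))" by simp
    finally show ?thesis .
  qed
  then show ?thesis by blast
qed

end

text \<open>If \<open>r2\<close> has a greater sum, some column of the second diagram contains two numbers that \<open>x\<close> sends to the
same row of the first one; the corresponding transpositions pair off the terms with opposite signs.\<close>

lemma young_orthogonality: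
  assumes D1: "young_diagram n r1 c1" and D2: "young_diagram n r2 c2"
    and less: "(\<Sum>b<n. r1 b) < (\<Sum>b<n. r2 b)" and x: "x permutes {..<n}"
  shows "(\<Sum>g | g permutes {..<n}. young_diagram.yng n r1 c1 g * young_diagram.yng n r2 c2 (inv x \<circ> inv g \<circ> x)) = 0"
proof -
  interpret D1: young_diagram n r1 c1 by (rule D1)
  interpret D2: young_diagram n r2 c2 by (rule D2)
  have "(\<Sum>b<n. r1 (x b)) = (\<Sum>b<n. r1 b)"
    by (rule sum.reindex_bij_betw[OF permutes_imp_bij[OF x]])
  then have "\<not> D2.column_injective (r1 \<circ> x)"
    using D2.column_injective_stat[of "r1 \<circ> x"] less by auto
  then obtain a b where ab: "a < n" "b < n" "c2 a = c2 b" "r1 (x a) = r1 (x b)" "a \<noteq> b"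
    by (auto simp: D2.column_injective_def)
  let ?t = "transpose a b"
  \<comment> \<open>Conjugation with \<open>x\<close> turns the column transposition of the second diagram into a row transposition of the first.\<close>
  let ?u = "transpose (x a) (x b)"
  let ?P = "{g. g permutes {..<n}}"
  have bx: "bij x" using x permutes_bij by blast
  have t: "?t \<in> D2.CG" using ab by (intro D2.sign_transpose_CG)
  have u: "?u \<in> D1.RG" using ab D1.perm_lt[OF x] by (intro D1.transpose_RG) auto
  have ux: "?u \<circ> x = x \<circ> ?t"
    using bx by (auto simp: fun_eq_iff transpose_def bij_def inj_eq)
  have up: "?u permutes {..<n}" by (rule D1.RG_perm[OF u])
  have uu: "?u \<circ> (?u \<circ> g) = g" for g :: "nat \<Rightarrow> nat" by (simp add: fun_eq_iff)
  let ?f = "\<lambda>g. D1.yng g * D2.yng (inv x \<circ> inv g \<circ> x)"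
  have "sum ?f ?P = (\<Sum>g\<in>?P. ?f (?u \<circ> g))"
    by (rule sum.reindex_bij_witness[of _ "\<lambda>g. ?u \<circ> g" "\<lambda>g. ?u \<circ> g"])
       (use uu up in \<open>auto intro: permutes_compose\<close>)
  also have "\<dots> = (\<Sum>g\<in>?P. - ?f g)"
  proof (rule sum.cong[OF refl])
    fix g assume "g \<in> ?P"
    then have g: "g permutes {..<n}" by simp
    have "inv (?u \<circ> g) = inv g \<circ> ?u"
      using permutes_bij[OF g] by (simp add: o_inv_distrib)
    then have "inv x \<circ> inv (?u \<circ> g) \<circ> x = (inv x \<circ> inv g \<circ> x) \<circ> ?t"
      using ux by (simp add: comp_assoc)
    moreover have "inv x \<circ> inv g \<circ> x permutes {..<n}"
      using x g by (intro permutes_compose permutes_inv)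
    ultimately have "D2.yng (inv x \<circ> inv (?u \<circ> g) \<circ> x) = - D2.yng (inv x \<circ> inv g \<circ> x)"
      using D2.yng_right[OF t] ab(5) by (simp add: sign_swap_id)
    then show "?f (?u \<circ> g) = - ?f g" using D1.yng_left[OF u] by simp
  qed
  finally show ?thesis by (simp add: sum_negf)
qed

lemma decreasing_gap:
  assumes "decreasing N l" "i \<le> j" "j < N"
  shows "l j + (j - i) \<le> l i"
  using assms(2,3)
proof (induction j rule: dec_induct)
  case (step j)
  then have "l (Suc j) < l j" using assms(1) by (simp add: decreasing_def)
  moreover have "l j + (j - i) \<le> l i" using step by simp
  ultimately show ?case using step.hyps by simp
qed simp

text \<open>Subtracting the staircase from a decreasing vector leaves the weakly decreasing row lengths.\<close>

lemma diagram_of_decreasing: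
  assumes l: "l \<in> states N n" and dec: "decreasing N l"
  obtains r c where "young_diagram n r c" "young_diagram.shape n r N = l"
proof -
  define \<tau> where "\<tau> i = l i - stair N i" for i
  have ge: "stair N i \<le> l i" if "i < N" for i
    using decreasing_gap[OF dec, of i "N - 1"] that unfolding stair_def by linarith
  have mono: "\<tau> j \<le> \<tau> i" if "i \<le> j" "j < N" for i j
    using decreasing_gap[OF dec that] ge[of j] that unfolding \<tau>_def stair_def by linarith
  let ?D = "SIGMA i:{..<N}. {..<\<tau> i}"
  have "card ?D = (\<Sum>i<N. \<tau> i)" by simp
  also have "\<dots> = n"
  proof -
    have "(\<Sum>i<N. \<tau> i) + (\<Sum>i<N. stair N i) = (\<Sum>i<N. l i)"
      unfolding sum.distrib[symmetric] by (rule sum.cong[OF refl]) (simp add: \<tau>_def ge)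
    moreover have "(\<Sum>i<N. stair N i) = \<Sum>{..<N}"
      by (rule sum.reindex_bij_witness[of _ "stair N" "stair N"]) (auto simp: stair_def)
    ultimately show ?thesis using l by (simp add: states_def)
  qed
  finally have "card ?D = card {..<n}" by simp
  then obtain f where f: "bij_betw f {..<n} ?D"
    using finite_same_card_bij[of "{..<n}" ?D] by (metis finite_SigmaI finite_lessThan)
  define r where "r b = fst (f b)" for b
  define c where "c b = snd (f b)" for b
  have fb: "f b = (r b, c b)" for b by (simp add: r_def c_def)
  have mem: "r b < N \<and> c b < \<tau> (r b)" if "b < n" for b
  proof -
    have "f b \<in> ?D" using f that by (auto simp: bij_betw_def)
    then show ?thesis by (simp add: fb)
  qed
  have ex: "\<exists>b<n. r b = i \<and> c b = j" if "i < N" "j < \<tau> i" for i j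
  proof -
    have "(i, j) \<in> f ` {..<n}" using f that by (simp add: bij_betw_def)
    then show ?thesis by (auto simp: fb)
  qed
  have D: "young_diagram n r c"
  proof
    fix a b assume ab: "a < n" "b < n" "r a = r b" "c a = c b"
    then have "f a = f b" by (simp add: fb)
    then show "a = b" using f ab(1,2) by (auto simp: bij_betw_def inj_on_def)
  next
    fix b j assume b: "b < n" "j < r b"
    have "c b < \<tau> j" using mem[OF b(1)] mono[of j "r b"] b(2) by simp
    moreover have "j < N" using mem[OF b(1)] b(2) by simp
    ultimately show "\<exists>b'<n. c b' = c b \<and> r b' = j" using ex[of j "c b"] by blast
  qed
  have cnt: "card {b. b < n \<and> r b = i} = \<tau> i" if i: "i < N" for i
  proof -
    have "bij_betw c {b. b < n \<and> r b = i} {..<\<tau> i}"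
      unfolding bij_betw_def
    proof
      show "inj_on c {b. b < n \<and> r b = i}"
        by (rule inj_onI) (use young_diagram.box_inj[OF D] in auto)
      show "c ` {b. b < n \<and> r b = i} = {..<\<tau> i}"
      proof (intro equalityI subsetI)
        fix j assume "j \<in> c ` {b. b < n \<and> r b = i}"
        then show "j \<in> {..<\<tau> i}" using mem by auto
      next
        fix j assume "j \<in> {..<\<tau> i}"
        then show "j \<in> c ` {b. b < n \<and> r b = i}" using ex[OF i, of j] by auto
      qed
    qed
    then show ?thesis by (simp add: bij_betw_same_card)
  qed
  have "young_diagram.shape n r N = l"
  proof
    fix i
    show "young_diagram.shape n r N i = l i"
      using cnt[of i] ge[of i] l by (cases "i < N") (auto simp: young_diagram.shape_def[OF D] \<tau>_def states_def)
  qed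
  then show ?thesis using D that by blast
qed

lemma index_sum_bound:
  assumes "l \<in> states N n" shows "index_sum N l \<le> N * (\<Sum>{..<N} + n)"
proof -
  have "index_sum N l \<le> (\<Sum>i<N. N * l i)" unfolding index_sum_def by (rule sum_mono) simp
  also have "\<dots> = N * (\<Sum>i<N. l i)" by (simp only: sum_distrib_left)
  finally show ?thesis using assms by (simp add: states_def)
qed

lemma char_fn_inv:
  assumes g: "g permutes {..<n}"
  shows "char_fn N {..<n} (inv g) l = char_fn N {..<n} g l"
proof -
  have lt: "p i < n" if "p permutes {..<n}" "i < n" for p i using permutes_in_image[OF that(1), of i] that(2) by simp
  have "(\<forall>t<n. w (inv g t) = w t) \<longleftrightarrow> (\<forall>t<n. w (g t) = w t)" for w :: "nat \<Rightarrow> nat"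
    using permutes_inverses[OF g] lt[OF g] lt[OF permutes_inv[OF g]] by metis
  then have "fixed_words N {..<n} (inv g) = fixed_words N {..<n} g" by (simp add: fixed_words_def Ball_def)
  then show ?thesis by (simp add: char_fn_def)
qed

text \<open>Induction from the greatest value of the statistic downwards. If the value at \<open>l\<close> is nonzero, then \<open>l\<close> is
the shape of a diagram \<open>E\<close> with a greater statistic, for which the claim, and therefore the formula for
the conjugacy sum, is already known. Averaging this formula for \<open>E\<close> with the first symmetrizer gives
the value at \<open>l\<close> up to a nonzero factor, while orthogonality of the two symmetrizers gives 0.\<close>

lemma averaged_char_fn_vanishing:
  assumes "young_diagram n row col" "n \<le> N" "l \<in> states N n" "decreasing N l" "l \<noteq> young_diagram.shape n row N"
  shows "young_diagram.averaged_char_fn n row col N l = 0"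
  using assms(1,3-5)
proof (induction "N * (\<Sum>{..<N} + n) - young_diagram.shape_stat n row N" arbitrary: row col l rule: less_induct)
  case less
  interpret D: young_diagram n row col by (rule less.prems(1))
  show ?case
  proof (rule ccontr)
    assume nz: "D.averaged_char_fn N l \<noteq> 0"
    obtain r c where E: "young_diagram n r c" and sh: "young_diagram.shape n r N = l"
      using diagram_of_decreasing[OF less.prems(2,3)] .
    interpret E: young_diagram n r c by (rule E)
    have l0: "\<forall>i\<ge>N. l i = 0" using less.prems(2) by (simp add: states_def)
    have lt: "D.shape_stat N < index_sum N l"
      using D.averaged_char_fn_support[OF nz l0] less.prems(4) by (metis le_neq_implies_less)
    have Est: "index_sum N l = E.shape_stat N" using E.index_sum_shape[OF assms(2)] sh by simp
    have van: "E.averaged_char_fn N l' = 0" if "l' \<in> states N n" "decreasing N l'" "l' \<noteq> E.shape N" for l'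
      by (rule less.hyps[OF _ E that]) (use lt Est index_sum_bound[OF less.prems(2)] in simp)
    let ?K = "of_int (pairing N 0 (vacuum N) (vacuum N)) :: complex"
    obtain M :: nat where M: "\<And>s. s permutes {..<n} \<Longrightarrow> ?K * E.conj_sum s
        = of_nat M * E.averaged_char_fn N l * of_int (char_fn N {..<n} s l)"
      using E.conj_sum_of_vanishing[OF assms(2) van] unfolding sh by blast
    have K: "?K \<noteq> 0" using vacuum_norm_nonzero by simp
    have "?K * E.conj_sum id \<noteq> 0" using K E.conj_sum_id by simp
    then have Mb: "of_nat M * E.averaged_char_fn N l \<noteq> 0" using M[of id] by (auto simp: permutes_id)
    let ?P = "{g. g permutes {..<n}}"
    have lessr: "(\<Sum>b<n. row b) < (\<Sum>b<n. r b)"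
      using lt unfolding Est D.shape_stat_def E.shape_stat_def by simp
    have "(\<Sum>g\<in>?P. D.yng g * (?K * E.conj_sum (inv g))) = ?K * (\<Sum>x\<in>?P. \<Sum>g\<in>?P. D.yng g * E.yng (x \<circ> inv g \<circ> inv x))"
      unfolding E.conj_sum_def sum_distrib_left by (subst sum.swap) (intro sum.cong refl, simp only: mult_ac)
    also have "(\<Sum>x\<in>?P. \<Sum>g\<in>?P. D.yng g * E.yng (x \<circ> inv g \<circ> inv x)) = 0"
    proof (rule sum.neutral, rule ballI)
      fix x assume "x \<in> ?P"
      then have x: "inv x permutes {..<n}" "inv (inv x) = x" by (auto simp: permutes_inv permutes_inv_inv)
      show "(\<Sum>g\<in>?P. D.yng g * E.yng (x \<circ> inv g \<circ> inv x)) = 0"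
        using young_orthogonality[OF less.prems(1) E lessr x(1)] unfolding x(2) .
    qed
    finally have z: "(\<Sum>g\<in>?P. D.yng g * (?K * E.conj_sum (inv g))) = 0" by simp
    have "(\<Sum>g\<in>?P. D.yng g * (?K * E.conj_sum (inv g))) = of_nat M * E.averaged_char_fn N l * D.averaged_char_fn N l"
      unfolding D.averaged_char_fn_def sum_distrib_left
    proof (rule sum.cong[OF refl])
      fix g assume "g \<in> ?P"
      then have g: "g permutes {..<n}" by simp
      have "char_fn N {..<n} (inv g) l = char_fn N {..<n} g l" by (rule char_fn_inv[OF g])
      then show "D.yng g * (?K * E.conj_sum (inv g)) = of_nat M * E.averaged_char_fn N l * (D.yng g * of_int (char_fn N {..<n} g l))"
        using M[OF permutes_inv[OF g]] by simp
    qed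
    then show False using z Mb nz by simp
  qed
qed

text \<open>The Frobenius formula up to a factor; evaluation at the identity shows that the factor is nonzero.\<close>

theorem (in young_diagram) conj_sum_formula:
  assumes N: "n \<le> N"
  obtains B :: complex where "B \<noteq> 0"
    "\<And>s. s permutes {..<n} \<Longrightarrow> conj_sum s = B * of_int (char_fn N {..<n} s (shape N))"
proof -
  let ?K = "of_int (pairing N 0 (vacuum N) (vacuum N)) :: complex"
  have K: "?K \<noteq> 0" using vacuum_norm_nonzero by simp
  have D: "young_diagram n row col" by unfold_locales
  obtain M :: nat where M: "\<And>s. s permutes {..<n} \<Longrightarrow> ?K * conj_sum s
        = of_nat M * averaged_char_fn N (shape N) * of_int (char_fn N {..<n} s (shape N))"
    using conj_sum_of_vanishing[OF N averaged_char_fn_vanishing[OF D N]] by blast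
  let ?B = "of_nat M * averaged_char_fn N (shape N) / ?K"
  have B: "conj_sum s = ?B * of_int (char_fn N {..<n} s (shape N))" if "s permutes {..<n}" for s
    using M[OF that] K by (simp add: field_simps)
  have "?B \<noteq> 0"
  proof
    assume "?B = 0"
    then have "conj_sum id = 0" using B[OF permutes_id] by (simp only: mult_zero_left)
    then show False using conj_sum_id by simp
  qed
  then show ?thesis using B that by blast
qed

section \<open>The Specht module of a partition\<close>

lemma sum_fun_apply: "(sum f A) x = (\<Sum>i\<in>A. f i x)"
  by (induction A rule: infinite_finite_induct) auto

definition boxes :: "nat list \<Rightarrow> (nat \<times> nat) list" where
  "boxes \<mu> = concat (map (\<lambda>y. map (\<lambda>x. (x, y)) [1..<Suc (\<mu> ! (y - 1))]) [1..<Suc (length \<mu>)])"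

lemma box_of_boxes: "box_of \<mu> i = boxes \<mu> ! i" by (simp add: box_of_def boxes_def)

lemma length_boxes: "length (boxes \<mu>) = sum_list \<mu>"
proof -
  have "map (\<lambda>y. \<mu> ! (y - 1)) [1..<Suc (length \<mu>)] = \<mu>"
    by (rule nth_equalityI) (auto simp del: upt_Suc)
  moreover have "map length (map (\<lambda>y. map (\<lambda>x. (x, y)) [1..<Suc (\<mu> ! (y - 1))]) [1..<Suc (length \<mu>)])
    = map (\<lambda>y. \<mu> ! (y - 1)) [1..<Suc (length \<mu>)]" by (simp del: upt_Suc)
  ultimately show ?thesis unfolding boxes_def length_concat by simp
qed

lemma set_boxes: "set (boxes \<mu>) = diagram \<mu>"
proof -
  have "set (boxes \<mu>) = (\<Union>y\<in>{1..<Suc (length \<mu>)}. (\<lambda>x. (x, y)) ` {1..<Suc (\<mu> ! (y - 1))})"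
    by (simp add: boxes_def del: upt_Suc)
  also have "\<dots> = diagram \<mu>"
  proof (rule set_eqI)
    fix p :: "nat \<times> nat"
    obtain x y where p: "p = (x, y)" by force
    have i: "(x, y) \<in> (\<lambda>x. (x, y')) ` A \<longleftrightarrow> x \<in> A \<and> y = y'" for y' and A :: "nat set" by auto
    have "p \<in> (\<Union>y\<in>{1..<Suc (length \<mu>)}. (\<lambda>x. (x, y)) ` {1..<Suc (\<mu> ! (y - 1))})
      \<longleftrightarrow> y \<in> {1..<Suc (length \<mu>)} \<and> x \<in> {1..<Suc (\<mu> ! (y - 1))}"
      unfolding p UN_iff i by blast
    then show "p \<in> (\<Union>y\<in>{1..<Suc (length \<mu>)}. (\<lambda>x. (x, y)) ` {1..<Suc (\<mu> ! (y - 1))}) \<longleftrightarrow> p \<in> diagram \<mu>"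
      unfolding p by (auto simp: diagram_def less_Suc_eq_le)
  qed
  finally show ?thesis .
qed

lemma distinct_boxes: "distinct (boxes \<mu>)"
proof -
  have "distinct (concat (map (\<lambda>y. map (\<lambda>x. (x, y)) (f y)) ys))"
    if "distinct ys" "\<And>y. distinct (f y)" for f :: "nat \<Rightarrow> nat list" and ys :: "nat list"
    using that by (induction ys) (auto simp: distinct_map inj_on_def)
  then show ?thesis unfolding boxes_def by (simp del: upt_Suc)
qed

lemma bij_box_of: "bij_betw (box_of \<mu>) {..<sum_list \<mu>} (diagram \<mu>)"
  using bij_betw_nth[OF distinct_boxes, of "{..<sum_list \<mu>}" \<mu> "diagram \<mu>"]
  by (simp add: length_boxes set_boxes box_of_boxes[abs_def])

definition box_row :: "nat list \<Rightarrow> nat \<Rightarrow> nat" where "box_row \<mu> i = snd (box_of \<mu> i) - 1"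
definition box_col :: "nat list \<Rightarrow> nat \<Rightarrow> nat" where "box_col \<mu> i = fst (box_of \<mu> i)"

lemma box_of_row_col:
  assumes "i < sum_list \<mu>"
  shows "box_of \<mu> i = (box_col \<mu> i, Suc (box_row \<mu> i))" "box_row \<mu> i < length \<mu>"
    "1 \<le> box_col \<mu> i" "box_col \<mu> i \<le> \<mu> ! box_row \<mu> i"
proof -
  have "box_of \<mu> i \<in> diagram \<mu>" using bij_box_of[of \<mu>] assms by (auto simp: bij_betw_def)
  then show "box_of \<mu> i = (box_col \<mu> i, Suc (box_row \<mu> i))" "box_row \<mu> i < length \<mu>"
    "1 \<le> box_col \<mu> i" "box_col \<mu> i \<le> \<mu> ! box_row \<mu> i"
    by (auto simp: diagram_def box_row_def box_col_def split: prod.splits)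
qed

lemma ex_box:
  assumes "j < length \<mu>" "1 \<le> x" "x \<le> \<mu> ! j"
  shows "\<exists>b<sum_list \<mu>. box_row \<mu> b = j \<and> box_col \<mu> b = x"
proof -
  have "(x, Suc j) \<in> diagram \<mu>" using assms by (simp add: diagram_def)
  then have "(x, Suc j) \<in> box_of \<mu> ` {..<sum_list \<mu>}" using bij_box_of[of \<mu>] by (simp add: bij_betw_def)
  then obtain b where "b < sum_list \<mu>" "box_of \<mu> b = (x, Suc j)" by auto
  then show ?thesis by (intro exI[of _ b]) (simp add: box_row_def box_col_def)
qed

lemma young_diagram_partition:
  assumes "is_partition \<mu>"
  shows "young_diagram (sum_list \<mu>) (box_row \<mu>) (box_col \<mu>)"
proof
  fix a b assume ab: "a < sum_list \<mu>" "b < sum_list \<mu>" "box_row \<mu> a = box_row \<mu> b" "box_col \<mu> a = box_col \<mu> b"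
  then have "box_of \<mu> a = box_of \<mu> b" by (simp add: box_of_row_col)
  then show "a = b" using bij_box_of[of \<mu>] ab(1,2) by (auto simp: bij_betw_def inj_on_def)
next
  fix b j assume b: "b < sum_list \<mu>" "j < box_row \<mu> b"
  note B = box_of_row_col[OF b(1)]
  have "\<mu> ! box_row \<mu> b \<le> \<mu> ! j"
    using assms b(2) B(2) by (simp add: is_partition_def sorted_wrt_iff_nth_less)
  then show "\<exists>b'<sum_list \<mu>. box_col \<mu> b' = box_col \<mu> b \<and> box_row \<mu> b' = j"
    using ex_box[of j \<mu> "box_col \<mu> b"] B b(2) by auto
qed

lemma shape_partition:
  assumes "is_partition \<mu>"
  shows "young_diagram.shape (sum_list \<mu>) (box_row \<mu>) N i =
    (if i < N then (if i < length \<mu> then \<mu> ! i else 0) + stair N i else 0)"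
proof -
  interpret young_diagram "sum_list \<mu>" "box_row \<mu>" "box_col \<mu>" by (rule young_diagram_partition[OF assms])
  have "card {b. b < sum_list \<mu> \<and> box_row \<mu> b = i} = (if i < length \<mu> then \<mu> ! i else 0)"
  proof (cases "i < length \<mu>")
    case True
    have "bij_betw (box_col \<mu>) {b. b < sum_list \<mu> \<and> box_row \<mu> b = i} {1..\<mu> ! i}"
      unfolding bij_betw_def
    proof
      show "inj_on (box_col \<mu>) {b. b < sum_list \<mu> \<and> box_row \<mu> b = i}"
        by (rule inj_onI) (use box_inj in auto)
      show "box_col \<mu> ` {b. b < sum_list \<mu> \<and> box_row \<mu> b = i} = {1..\<mu> ! i}"
      proof (intro equalityI subsetI)
        fix x assume "x \<in> box_col \<mu> ` {b. b < sum_list \<mu> \<and> box_row \<mu> b = i}"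
        then obtain b where "b < sum_list \<mu>" "box_row \<mu> b = i" "x = box_col \<mu> b" by auto
        then show "x \<in> {1..\<mu> ! i}" using box_of_row_col[of b \<mu>] by simp
      next
        fix x assume "x \<in> {1..\<mu> ! i}"
        then show "x \<in> box_col \<mu> ` {b. b < sum_list \<mu> \<and> box_row \<mu> b = i}"
          using ex_box[OF True, of x] by auto
      qed
    qed
    then show ?thesis using True by (simp add: bij_betw_same_card)
  next
    case False
    then have "{b. b < sum_list \<mu> \<and> box_row \<mu> b = i} = {}" using box_of_row_col(2) by blast
    then show ?thesis using False by simp
  qed
  then show ?thesis by (simp add: shape_def)
qed

lemma young_symmetrizer_eq_yng:
  assumes "is_partition \<mu>"
  shows "young_symmetrizer \<mu> = young_diagram.yng (sum_list \<mu>) (box_row \<mu>) (box_col \<mu>)"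
proof
  interpret young_diagram "sum_list \<mu>" "box_row \<mu>" "box_col \<mu>" by (rule young_diagram_partition[OF assms])
  let ?n = "sum_list \<mu>"
  fix g
  have R: "row_group \<mu> = RG"
  proof -
    have "(\<forall>i<?n. snd (box_of \<mu> (p i)) = snd (box_of \<mu> i)) \<longleftrightarrow> (\<forall>i<?n. box_row \<mu> (p i) = box_row \<mu> i)"
      if "p permutes {..<?n}" for p using box_of_row_col(1) perm_lt[OF that] by simp
    then show ?thesis by (auto simp: row_group_def RG_def)
  qed
  have C: "column_group \<mu> = CG" by (auto simp: column_group_def CG_def box_col_def)
  have finP: "finite {p. p permutes {..<?n}}" by (rule finite_permutations) simp
  have finC: "finite CG" by (rule finite_subset[OF _ finP]) (auto simp: CG_def)
  have r: "(\<Sum>p\<in>RG. delta p) p = (if p \<in> RG then 1 else 0)" for p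
    using finite_RG by (simp add: sum_fun_apply delta_def)
  have c: "(\<Sum>q\<in>CG. (\<lambda>r. of_int (sign q) * delta q r)) h = (if h \<in> CG then of_int (sign h) else 0)" for h
  proof -
    have "(\<Sum>q\<in>CG. (\<lambda>r. of_int (sign q) * delta q r)) h = (\<Sum>q\<in>CG. if h = q then of_int (sign h) else 0)"
      unfolding sum_fun_apply by (rule sum.cong[OF refl]) (simp add: delta_def)
    then show ?thesis using finC by simp
  qed
  have "young_symmetrizer \<mu> g = (\<Sum>p | p permutes {..<?n}. if p \<in> RG then (if inv p \<circ> g \<in> CG then of_int (sign (inv p \<circ> g)) else 0) else 0)"
    unfolding young_symmetrizer_def conv_def R C r c by (rule sum.cong[OF refl]) simp
  also have "\<dots> = (\<Sum>p\<in>{p \<in> {p. p permutes {..<?n}}. p \<in> RG}. if inv p \<circ> g \<in> CG then of_int (sign (inv p \<circ> g)) else 0)"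
    by (rule sum.inter_filter[OF finP, symmetric])
  also have "{p \<in> {p. p permutes {..<?n}}. p \<in> RG} = RG" by (auto simp: RG_def)
  finally show "young_symmetrizer \<mu> g = yng g" unfolding yng_def .
qed

section \<open>Convolution, traces and the irreducible characters\<close>

lemma permutes_reindex_left:
  assumes u: "u permutes {..<n}"
  shows "(\<Sum>p | p permutes {..<n}. f p) = (\<Sum>p | p permutes {..<n}. f (u \<circ> p))"
proof (rule sum.reindex_bij_witness[of _ "\<lambda>p. u \<circ> p" "\<lambda>p. inv u \<circ> p"])
  show "u \<circ> (inv u \<circ> p) = p" for p using permutes_inv_o(1)[OF u] by (simp add: comp_assoc[symmetric])
  show "inv u \<circ> (u \<circ> p) = p" for p using permutes_inv_o(2)[OF u] by (simp add: comp_assoc[symmetric])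
  show "inv u \<circ> p \<in> {p. p permutes {..<n}}" if "p \<in> {p. p permutes {..<n}}" for p
    using that permutes_compose[OF _ permutes_inv[OF u]] by simp
  show "u \<circ> p \<in> {p. p permutes {..<n}}" if "p \<in> {p. p permutes {..<n}}" for p
    using that permutes_compose[OF _ u] by simp
  show "f (u \<circ> (inv u \<circ> p)) = f p" for p using permutes_inv_o(1)[OF u] by (simp add: comp_assoc[symmetric])
qed

lemma conv_assoc: "conv n (conv n f g) h = conv n f (conv n g h)"
proof
  fix r
  let ?P = "{p. p permutes {..<n}}"
  have "conv n (conv n f g) h r = (\<Sum>q\<in>?P. \<Sum>p\<in>?P. f q * g (inv q \<circ> p) * h (inv p \<circ> r))"
    unfolding conv_def sum_distrib_right by (rule sum.swap)
  also have "\<dots> = (\<Sum>q\<in>?P. f q * (\<Sum>p\<in>?P. g p * h (inv p \<circ> (inv q \<circ> r))))"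
  proof (rule sum.cong[OF refl])
    fix q assume "q \<in> ?P"
    then have q: "q permutes {..<n}" by simp
    have "(\<Sum>p\<in>?P. f q * g (inv q \<circ> p) * h (inv p \<circ> r)) = (\<Sum>p\<in>?P. f q * g (inv q \<circ> (q \<circ> p)) * h (inv (q \<circ> p) \<circ> r))"
      by (rule permutes_reindex_left[OF q])
    also have "\<dots> = (\<Sum>p\<in>?P. f q * (g p * h (inv p \<circ> (inv q \<circ> r))))"
    proof (rule sum.cong[OF refl])
      fix p assume "p \<in> ?P"
      then have "inv (q \<circ> p) = inv p \<circ> inv q" using permutes_bij q by (auto intro: o_inv_distrib)
      moreover have "inv q \<circ> (q \<circ> p) = p" using permutes_inv_o(2)[OF q] by (simp add: comp_assoc[symmetric])
      ultimately show "f q * g (inv q \<circ> (q \<circ> p)) * h (inv (q \<circ> p) \<circ> r) = f q * (g p * h (inv p \<circ> (inv q \<circ> r)))"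
        by (simp add: comp_assoc)
    qed
    finally show "(\<Sum>p\<in>?P. f q * g (inv q \<circ> p) * h (inv p \<circ> r)) = f q * (\<Sum>p\<in>?P. g p * h (inv p \<circ> (inv q \<circ> r)))"
      by (simp only: sum_distrib_left)
  qed
  finally show "conv n (conv n f g) h r = conv n f (conv n g h) r" by (simp add: conv_def)
qed

lemma conv_delta:
  assumes "s permutes {..<n}" shows "conv n (delta s) f r = f (inv s \<circ> r)"
proof -
  have "conv n (delta s) f r = (\<Sum>p | p permutes {..<n}. if p = s then f (inv s \<circ> r) else 0)"
    unfolding conv_def by (rule sum.cong[OF refl]) (simp add: delta_def)
  then show ?thesis using assms by (simp add: finite_permutations)
qed

lemma conv_group_algebra:
  assumes "g \<in> group_algebra n" shows "conv n f g \<in> group_algebra n"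
  unfolding group_algebra_def
proof (intro CollectI allI impI)
  fix r assume r: "\<not> r permutes {..<n}"
  show "conv n f g r = 0"
    unfolding conv_def
  proof (rule sum.neutral, rule ballI)
    fix p assume "p \<in> {p. p permutes {..<n}}"
    then have p: "p permutes {..<n}" by simp
    have "\<not> inv p \<circ> r permutes {..<n}"
    proof
      assume "inv p \<circ> r permutes {..<n}"
      then have "p \<circ> (inv p \<circ> r) permutes {..<n}" using p by (rule permutes_compose)
      moreover have "p \<circ> (inv p \<circ> r) = r" using permutes_inv_o(1)[OF p] by (simp add: comp_assoc[symmetric])
      ultimately show False using r by simp
    qed
    then show "f p * g (inv p \<circ> r) = 0" using assms by (simp add: group_algebra_def)
  qed
qed

definition left_ideal :: "nat \<Rightarrow> ((nat \<Rightarrow> nat) \<Rightarrow> complex) \<Rightarrow> ((nat \<Rightarrow> nat) \<Rightarrow> complex) set" where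
  "left_ideal n c = (\<lambda>f. conv n f c) ` group_algebra n"

lemma left_ideal_subspace: "fun_space.subspace (left_ideal n c)"
  unfolding fun_space.subspace_def left_ideal_def
proof (intro conjI ballI allI)
  have "conv n 0 c = 0" by (simp add: conv_def fun_eq_iff)
  moreover have "0 \<in> group_algebra n" by (simp add: group_algebra_def)
  ultimately show "0 \<in> (\<lambda>f. conv n f c) ` group_algebra n" by (metis image_eqI)
next
  fix x y assume "x \<in> (\<lambda>f. conv n f c) ` group_algebra n" "y \<in> (\<lambda>f. conv n f c) ` group_algebra n"
  then obtain f g where f: "f \<in> group_algebra n" "x = conv n f c" and g: "g \<in> group_algebra n" "y = conv n g c" by auto
  have "x + y = conv n (f + g) c" unfolding f g by (simp add: conv_def fun_eq_iff distrib_right sum.distrib)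
  moreover have "f + g \<in> group_algebra n" using f g by (simp add: group_algebra_def)
  ultimately show "x + y \<in> (\<lambda>f. conv n f c) ` group_algebra n" by blast
next
  fix a x assume "x \<in> (\<lambda>f. conv n f c) ` group_algebra n"
  then obtain f where f: "f \<in> group_algebra n" "x = conv n f c" by auto
  have "(\<lambda>r. a * x r) = conv n (\<lambda>p. a * f p) c" unfolding f by (simp add: conv_def fun_eq_iff sum_distrib_left mult.assoc)
  moreover have "(\<lambda>p. a * f p) \<in> group_algebra n" using f by (simp add: group_algebra_def)
  ultimately show "(\<lambda>r. a * x r) \<in> (\<lambda>f. conv n f c) ` group_algebra n" by blast
qed

lemma group_algebra_span:
  "group_algebra n \<subseteq> fun_space.span (delta ` {p. p permutes {..<n}})"
proof
  fix f assume f: "f \<in> group_algebra n"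
  let ?P = "{p. p permutes {..<n}}"
  have finP: "finite ?P" by (rule finite_permutations) simp
  have "f = (\<Sum>p\<in>?P. (\<lambda>r. f p * delta p r))"
  proof
    fix r
    have "(\<Sum>p\<in>?P. (\<lambda>r. f p * delta p r)) r = (\<Sum>p\<in>?P. if r = p then f r else 0)"
      unfolding sum_fun_apply by (rule sum.cong[OF refl]) (simp add: delta_def)
    also have "\<dots> = f r" using finP f by (auto simp: group_algebra_def)
    finally show "f r = (\<Sum>p\<in>?P. (\<lambda>r. f p * delta p r)) r" by simp
  qed
  moreover have "(\<Sum>p\<in>?P. (\<lambda>r. f p * delta p r)) \<in> fun_space.span (delta ` ?P)"
    by (intro fun_space.span_sum fun_space.span_scale fun_space.span_base imageI)
  ultimately show "f \<in> fun_space.span (delta ` ?P)" by simp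
qed

text \<open>The endomorphism of the group algebra that multiplies with \<open>c\<close> on the right is \<open>\<kappa>\<close> times the identity on the
left ideal. Hence \<open>\<kappa>\<close> times the trace on the ideal is the trace of the two-sided multiplication,
\<open>f\<close> to \<open>s f c\<close>, on the whole algebra, which is computed in the basis of the permutations.\<close>

lemma trace_on_left_ideal:
  assumes c: "c \<in> group_algebra n" and idem: "conv n c c = (\<lambda>r. \<kappa> * c r)" and s: "s permutes {..<n}"
  shows "\<kappa> * trace_on (left_ideal n c) (conv n (delta s)) = (\<Sum>p | p permutes {..<n}. c (inv p \<circ> inv s \<circ> p))"
proof -
  let ?P = "{p. p permutes {..<n}}"
  let ?V = "left_ideal n c"
  have finP: "finite ?P" by (rule finite_permutations) simp
  have VGA: "?V \<subseteq> group_algebra n" using conv_group_algebra[OF c] by (auto simp: left_ideal_def)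
  define B where "B = (SOME B. B \<subseteq> ?V \<and> fun_space.independent B \<and> fun_space.span B = ?V)"
  have "\<exists>B. B \<subseteq> ?V \<and> fun_space.independent B \<and> fun_space.span B = ?V"
  proof -
    obtain B where B: "B \<subseteq> ?V" "fun_space.independent B" "?V \<subseteq> fun_space.span B"
      using fun_space.maximal_independent_subset by blast
    have "fun_space.span B \<subseteq> ?V" by (rule fun_space.span_minimal[OF B(1) left_ideal_subspace])
    then show ?thesis using B by blast
  qed
  then have B: "B \<subseteq> ?V" "fun_space.independent B" "fun_space.span B = ?V"
    unfolding B_def by (metis (mono_tags, lifting) someI_ex)+
  have finB: "finite B"
    using fun_space.independent_span_bound[of "delta ` ?P" B] finP B VGA group_algebra_span by blast
  let ?rep = "fun_space.representation B"
  define e where "e p = (\<lambda>r. c (inv p \<circ> inv s \<circ> r))" for p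
  have T: "conv n (delta s) (conv n f c) = (\<Sum>p\<in>?P. (\<lambda>r. f p * e p r))" for f
  proof
    fix r
    show "conv n (delta s) (conv n f c) r = (\<Sum>p\<in>?P. (\<lambda>r. f p * e p r)) r"
      unfolding conv_delta[OF s] sum_fun_apply by (simp add: conv_def e_def comp_assoc)
  qed
  have TV: "conv n (delta s) x \<in> ?V" if xV: "x \<in> ?V" for x
  proof -
    obtain f where f: "f \<in> group_algebra n" "x = conv n f c" using xV by (auto simp: left_ideal_def)
    have "conv n (delta s) x = conv n (conv n (delta s) f) c" unfolding f by (rule conv_assoc[symmetric])
    then show ?thesis using conv_group_algebra[OF f(1)] by (auto simp: left_ideal_def)
  qed
  have eV: "e p \<in> ?V" if p: "p \<in> ?P" for p
  proof -
    have "e p = conv n (delta s) (conv n (delta p) c)"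
      using p by (simp add: fun_eq_iff e_def conv_delta[OF s] conv_delta comp_assoc)
    moreover have "delta p \<in> group_algebra n" using p by (auto simp: group_algebra_def delta_def)
    ultimately show ?thesis using TV by (auto simp: left_ideal_def)
  qed
  have eS: "e p \<in> fun_space.span B" if "p \<in> ?P" for p unfolding B(3) by (rule eV[OF that])
  have scaleV: "conv n b c = (\<lambda>r. \<kappa> * b r)" if bV: "b \<in> ?V" for b
  proof -
    obtain f where f: "b = conv n f c" using bV by (auto simp: left_ideal_def)
    have "conv n b c = conv n f (conv n c c)" unfolding f by (rule conv_assoc)
    also have "\<dots> = (\<lambda>r. \<kappa> * b r)" unfolding idem f by (simp add: conv_def fun_eq_iff sum_distrib_left mult_ac)
    finally show ?thesis .
  qed
  have trace: "trace_on ?V (conv n (delta s)) = (\<Sum>b\<in>B. ?rep (conv n (delta s) b) b)"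
    unfolding trace_on_def Let_def B_def[symmetric] ..
  have "\<kappa> * trace_on ?V (conv n (delta s)) = (\<Sum>b\<in>B. \<Sum>p\<in>?P. b p * ?rep (e p) b)"
    unfolding trace sum_distrib_left
  proof (rule sum.cong[OF refl])
    fix b assume b: "b \<in> B"
    then have bV: "b \<in> ?V" using B(1) by blast
    have "(\<lambda>r. \<kappa> * conv n (delta s) b r) = conv n (delta s) (\<lambda>r. \<kappa> * b r)"
      by (simp add: fun_eq_iff conv_delta[OF s])
    also have "\<dots> = (\<Sum>p\<in>?P. (\<lambda>r. b p * e p r))" unfolding scaleV[OF bV, symmetric] by (rule T)
    finally have eq: "(\<lambda>r. \<kappa> * conv n (delta s) b r) = (\<Sum>p\<in>?P. (\<lambda>r. b p * e p r))" .
    have "\<kappa> * ?rep (conv n (delta s) b) b = ?rep (\<lambda>r. \<kappa> * conv n (delta s) b r) b"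
      by (rule fun_space.representation_scale[OF B(2), of "conv n (delta s) b" \<kappa>, THEN fun_cong, symmetric])
        (unfold B(3), rule TV[OF bV])
    also have "\<dots> = (\<Sum>p\<in>?P. ?rep (\<lambda>r. b p * e p r) b)"
      unfolding eq
      by (rule fun_space.representation_sum[OF B(2), of ?P "\<lambda>p. (\<lambda>r. b p * e p r)", THEN fun_cong])
        (rule fun_space.span_scale[OF eS])
    also have "\<dots> = (\<Sum>p\<in>?P. b p * ?rep (e p) b)"
      by (rule sum.cong[OF refl], rule fun_space.representation_scale[OF B(2) eS, THEN fun_cong])
    finally show "\<kappa> * ?rep (conv n (delta s) b) b = (\<Sum>p\<in>?P. b p * ?rep (e p) b)" .
  qed
  also have "\<dots> = (\<Sum>p\<in>?P. \<Sum>b\<in>B. b p * ?rep (e p) b)" by (rule sum.swap)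
  also have "\<dots> = (\<Sum>p\<in>?P. e p p)"
  proof (rule sum.cong[OF refl])
    fix p assume p: "p \<in> ?P"
    have "(\<Sum>b\<in>B. (\<lambda>r. ?rep (e p) b * b r)) = e p"
      by (rule fun_space.sum_representation_eq[OF B(2) eS[OF p] finB order_refl])
    then have "(\<Sum>b\<in>B. (\<lambda>r. ?rep (e p) b * b r)) p = e p p" by simp
    then show "(\<Sum>b\<in>B. b p * ?rep (e p) b) = e p p" by (simp add: sum_fun_apply mult.commute)
  qed
  finally show ?thesis by (simp add: e_def)
qed

context young_diagram
begin

lemma yng_group_algebra: "yng \<in> group_algebra n"
  unfolding group_algebra_def
proof (intro CollectI allI impI)
  fix g assume g: "\<not> g permutes {..<n}"
  show "yng g = 0"
    unfolding yng_def
  proof (rule sum.neutral, rule ballI)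
    fix p assume p: "p \<in> RG"
    have "inv p \<circ> g \<notin> CG"
    proof
      assume "inv p \<circ> g \<in> CG"
      then have "p \<circ> (inv p \<circ> g) permutes {..<n}" using CG_perm RG_perm[OF p] by (blast intro: permutes_compose)
      moreover have "p \<circ> (inv p \<circ> g) = g" using permutes_inv_o(1)[OF RG_perm[OF p]] by (simp add: comp_assoc[symmetric])
      ultimately show False using g by simp
    qed
    then show "(if inv p \<circ> g \<in> CG then of_int (sign (inv p \<circ> g)) else 0) = (0::complex)" by simp
  qed
qed

text \<open>The square of the symmetrizer has the same equivariance as the symmetrizer, so Young's lemma applies.\<close>

lemma yng_idem: "conv n yng yng = (\<lambda>r. conv n yng yng id * yng r)"
proof
  fix g
  show "conv n yng yng g = conv n yng yng id * yng g"
  proof (cases "g permutes {..<n}")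
    case False
    then show ?thesis using conv_group_algebra[OF yng_group_algebra, of yng] yng_group_algebra
      by (simp add: group_algebra_def)
  next
    case True
    show ?thesis
    proof (rule biequivariant_unique[OF _ _ True])
      fix u g assume u: "u \<in> RG"
      have "conv n yng yng (u \<circ> g) = (\<Sum>p | p permutes {..<n}. yng (u \<circ> p) * yng (inv (u \<circ> p) \<circ> (u \<circ> g)))"
        unfolding conv_def by (rule permutes_reindex_left[OF RG_perm[OF u]])
      also have "\<dots> = conv n yng yng g"
        unfolding conv_def
      proof (rule sum.cong[OF refl])
        fix p assume "p \<in> {p. p permutes {..<n}}"
        then have "inv (u \<circ> p) = inv p \<circ> inv u" using permutes_bij RG_perm[OF u] by (auto intro: o_inv_distrib)
        moreover have "inv u \<circ> (u \<circ> g) = g" using permutes_inv_o(2)[OF RG_perm[OF u]] by (simp add: comp_assoc[symmetric])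
        ultimately show "yng (u \<circ> p) * yng (inv (u \<circ> p) \<circ> (u \<circ> g)) = yng p * yng (inv p \<circ> g)"
          using yng_left[OF u] by (simp add: comp_assoc)
      qed
      finally show "conv n yng yng (u \<circ> g) = conv n yng yng g" .
    next
      fix q g assume q: "q \<in> CG" and g: "g permutes {..<n}"
      show "conv n yng yng (g \<circ> q) = of_int (sign q) * conv n yng yng g"
        unfolding conv_def sum_distrib_left
      proof (rule sum.cong[OF refl])
        fix p assume "p \<in> {p. p permutes {..<n}}"
        then have "inv p \<circ> g permutes {..<n}" using g by (auto intro: permutes_compose permutes_inv)
        then have "yng (inv p \<circ> g \<circ> q) = of_int (sign q) * yng (inv p \<circ> g)" by (rule yng_right[OF q])
        then show "yng p * yng (inv p \<circ> (g \<circ> q)) = of_int (sign q) * (yng p * yng (inv p \<circ> g))"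
          by (simp add: comp_assoc)
      qed
    qed
  qed
qed

lemma trace_conj_sum:
  assumes s: "s permutes {..<n}"
  shows "conv n yng yng id * trace_on (left_ideal n yng) (conv n (delta s)) = conj_sum (inv s)"
proof -
  have "(\<Sum>p | p permutes {..<n}. yng (inv p \<circ> inv s \<circ> p)) = conj_sum (inv s)"
    unfolding conj_sum_def
    by (rule sum.reindex_bij_witness[of _ inv inv]) (auto simp: permutes_inv permutes_inv_inv)
  then show ?thesis by (rule trans[OF trace_on_left_ideal[OF yng_group_algebra yng_idem s]])
qed

end

text \<open>The factor \<open>A\<close> depends on \<open>\<mu>\<close> and \<open>N\<close> only. The assumption on \<open>\<sigma>\<close> makes the permutation chosen in the
definition of \<open>irr_character\<close> one of cycle type \<open>\<sigma>\<close>.\<close>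

theorem irr_character_formula:
  assumes mu: "is_partition \<mu>" and N: "sum_list \<mu> \<le> N"
  obtains A :: complex where "A \<noteq> 0"
    "\<And>\<sigma>. (\<exists>s. s permutes {..<sum_list \<mu>} \<and> cycle_type (sum_list \<mu>) s = mset \<sigma>) \<Longrightarrow>
      irr_character \<mu> \<sigma> = A * of_int (list_fn N \<sigma> (young_diagram.shape (sum_list \<mu>) (box_row \<mu>) N))"
proof -
  let ?n = "sum_list \<mu>"
  interpret young_diagram "sum_list \<mu>" "box_row \<mu>" "box_col \<mu>" by (rule young_diagram_partition[OF mu])
  define \<kappa> where "\<kappa> = conv ?n yng yng id"
  have V: "specht_module \<mu> = left_ideal ?n yng"
    unfolding specht_module_def left_ideal_def young_symmetrizer_eq_yng[OF mu] ..
  have "\<kappa> * trace_on (left_ideal ?n yng) (conv ?n (delta id)) = conj_sum id"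
    using trace_conj_sum[of id] by (simp add: \<kappa>_def permutes_id)
  then have \<kappa>: "\<kappa> \<noteq> 0" using conj_sum_id by auto
  obtain B :: complex where B: "B \<noteq> 0"
    "\<And>s. s permutes {..<?n} \<Longrightarrow> conj_sum s = B * of_int (char_fn N {..<?n} s (shape N))"
    using conj_sum_formula[OF N] by blast
  show ?thesis
  proof (rule that[of "B / \<kappa>"])
    show "B / \<kappa> \<noteq> 0" using B(1) \<kappa> by simp
    fix \<sigma> assume "\<exists>s. s permutes {..<?n} \<and> cycle_type ?n s = mset \<sigma>"
    then have s: "(SOME s. s permutes {..<?n} \<and> cycle_type ?n s = mset \<sigma>) permutes {..<?n} \<and>
      cycle_type ?n (SOME s. s permutes {..<?n} \<and> cycle_type ?n s = mset \<sigma>) = mset \<sigma>" by (rule someI_ex)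
    define s where "s = (SOME s. s permutes {..<?n} \<and> cycle_type ?n s = mset \<sigma>)"
    have sp: "s permutes {..<?n}" and st: "cycle_type ?n s = mset \<sigma>" using s unfolding s_def by auto
    have "\<kappa> * irr_character \<mu> \<sigma> = conj_sum (inv s)"
      unfolding irr_character_def Let_def s_def[symmetric] V \<kappa>_def by (rule trace_conj_sum[OF sp])
    also have "\<dots> = B * of_int (char_fn N {..<?n} s (shape N))"
      unfolding B(2)[OF permutes_inv[OF sp]] char_fn_inv[OF sp] ..
    also have "char_fn N {..<?n} s = list_fn N \<sigma>"
      by (rule char_fn_eq_list_fn[OF inv_set_permutes[OF sp]]) (use st in \<open>simp add: cycle_type_def\<close>)
    finally show "irr_character \<mu> \<sigma> = B / \<kappa> * of_int (list_fn N \<sigma> (shape N))"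
      using \<kappa> by (simp add: field_simps)
  qed
qed

section \<open>The normalized linear character at a cycle\<close>

lemma cycle_with_fixed_points:
  assumes k: "1 \<le> k" "k \<le> n"
  shows "\<exists>s. s permutes {..<n} \<and> cycle_type n s = mset (k # replicate (n - k) 1)"
proof -
  define s where "s i = (if i < k then (if Suc i = k then 0 else Suc i) else i)" for i
  have s1: "s i = Suc i" if "Suc i < k" for i using that by (simp add: s_def)
  have s2: "s i = 0" if "Suc i = k" for i using that by (auto simp: s_def)
  have s3: "s i = i" if "k \<le> i" for i using that by (simp add: s_def)
  have inj: "inj_on s {..<n}" by (auto simp: inj_on_def s_def split: if_splits)
  have sub: "s ` {..<n} \<subseteq> {..<n}" using k by (auto simp: s_def)
  have "bij_betw s {..<n} {..<n}"
    unfolding bij_betw_def using inj endo_inj_surj[OF _ sub inj] by simp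
  then have perm: "s permutes {..<n}" by (rule bij_imp_permutes) (use k in \<open>auto simp: s_def\<close>)
  have small: "orbit s i = {..<k}" if i: "i < k" for i
  proof
    have "s j < k" if "j < k" for j using that by (simp add: s_def)
    then show "orbit s i \<subseteq> {..<k}" by (auto elim: orbit.induct simp: i)
    have up: "Suc i \<le> j \<Longrightarrow> j < k \<Longrightarrow> j \<in> orbit s i" for j
    proof (induction j rule: dec_induct)
      case base
      have "s i \<in> orbit s i" by (rule orbit.base)
      then show ?case using s1[OF base(1)] by simp
    next
      case (step j)
      then have "s j \<in> orbit s i" by (intro orbit.step) simp
      then show ?case using s1[OF step.prems] by simp
    qed
    have zero: "0 \<in> orbit s i"
    proof (cases "Suc i = k")
      case True
      have "s i \<in> orbit s i" by (rule orbit.base)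
      then show ?thesis using s2[OF True] by simp
    next
      case False
      then have "s (k - 1) \<in> orbit s i" using i by (intro orbit.step up) auto
      then show ?thesis using s2[of "k - 1"] k by simp
    qed
    have "j < k \<Longrightarrow> j \<in> orbit s i" for j
    proof (induction j)
      case (Suc j)
      then have "s j \<in> orbit s i" by (intro orbit.step) simp
      then show ?case using s1[OF Suc.prems] by simp
    qed (simp add: zero)
    then show "{..<k} \<subseteq> orbit s i" by auto
  qed
  have large: "orbit s i = {i}" if i: "k \<le> i" for i
  proof
    note si = s3[OF i]
    have "x \<in> orbit s i \<Longrightarrow> x = i" for x by (induction rule: orbit.induct) (simp_all add: si)
    then show "orbit s i \<subseteq> {i}" by auto
    show "{i} \<subseteq> orbit s i" using orbit.base[of s i] si by simp
  qed
  have split: "{..<n} = {..<k} \<union> {k..<n}" using k by auto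
  have "orbit s ` {..<k} = (\<lambda>i. {..<k}) ` {..<k}" using small by (intro image_cong) auto
  then have "orbit s ` {..<k} = {{..<k}}" using k by (simp add: image_constant_conv lessThan_empty_iff)
  moreover have "orbit s ` {k..<n} = (\<lambda>i. {i}) ` {k..<n}" using large by (intro image_cong) auto
  ultimately have orb: "orbit s ` {..<n} = insert {..<k} ((\<lambda>i. {i}) ` {k..<n})"
    unfolding split image_Un by simp
  have notin: "{..<k} \<notin> (\<lambda>i. {i}) ` {k..<n}"
  proof
    assume "{..<k} \<in> (\<lambda>i. {i}) ` {k..<n}"
    then obtain i where i: "k \<le> i" "{..<k} = {i}" by auto
    have "0 \<in> {i}" unfolding i(2)[symmetric] using k by simp
    then show False using i(1) k by simp
  qed
  have "cycle_type n s = add_mset k (image_mset card (mset_set ((\<lambda>i. {i}) ` {k..<n})))"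
    unfolding cycle_type_def orb by (subst mset_set.insert) (use notin in auto)
  also have "mset_set ((\<lambda>i. {i}) ` {k..<n}) = image_mset (\<lambda>i. {i}) (mset_set {k..<n})"
    by (rule image_mset_mset_set[symmetric]) simp
  also have "image_mset card \<dots> = replicate_mset (n - k) 1"
    by (simp add: image_mset.compositionality comp_def image_mset_const_eq)
  finally show ?thesis using perm by (auto simp: mset_replicate)
qed

definition beta_number :: "nat \<Rightarrow> nat list \<Rightarrow> nat \<Rightarrow> nat" where
  "beta_number N \<mu> i = (if i < N then (if i < length \<mu> then \<mu> ! i else 0) + (N - 1 - i) else 0)"

lemma beta_number_less:
  assumes mu: "is_partition \<mu>" and ij: "i < j" "j < N"
  shows "beta_number N \<mu> j < beta_number N \<mu> i"
proof -
  have "(if j < length \<mu> then \<mu> ! j else 0) \<le> (if i < length \<mu> then \<mu> ! i else 0)"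
    using mu ij by (auto simp: is_partition_def sorted_wrt_iff_nth_less)
  then show ?thesis using ij unfolding beta_number_def by simp
qed

lemma inj_beta_number: "is_partition \<mu> \<Longrightarrow> inj_on (beta_number N \<mu>) {..<N}"
  unfolding inj_on_def
proof (intro ballI impI)
  fix i j assume "is_partition \<mu>" "i \<in> {..<N}" "j \<in> {..<N}" "beta_number N \<mu> i = beta_number N \<mu> j"
  then show "i = j"
    using beta_number_less[of \<mu> i j N] beta_number_less[of \<mu> j i N] by (cases i j rule: linorder_cases) simp_all
qed

text \<open>The factor of the Frobenius formula cancels in the quotient of the two characters.\<close>

theorem Ch_formula:
  assumes mu: "is_partition \<mu>" and k: "1 \<le> k" "k \<le> sum_list \<mu>" and N: "sum_list \<mu> \<le> N"
  shows "Ch [k] \<mu> = of_real (linear_phi k N (beta_number N \<mu>))"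
proof -
  define n where "n = sum_list \<mu>"
  let ?l = "beta_number N \<mu>"
  interpret young_diagram "sum_list \<mu>" "box_row \<mu>" "box_col \<mu>" by (rule young_diagram_partition[OF mu])
  have sh: "shape N = ?l"
    by (rule ext) (simp add: shape_partition[OF mu] beta_number_def stair_def)
  have st: "?l \<in> states N n" unfolding n_def sh[symmetric] by (rule shape_states[OF N])
  obtain A where A: "A \<noteq> 0" "\<And>\<sigma>. (\<exists>s. s permutes {..<n} \<and> cycle_type n s = mset \<sigma>) \<Longrightarrow>
      irr_character \<mu> \<sigma> = A * of_int (list_fn N \<sigma> ?l)"
    using irr_character_formula[OF mu N] unfolding sh n_def by blast
  have k': "k \<le> n" and n1: "1 \<le> n" using k by (simp_all add: n_def)
  have 1: "irr_character \<mu> (k # replicate (n - k) 1) = A * of_int (list_fn N (k # replicate (n - k) 1) ?l)"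
    by (rule A(2)[OF cycle_with_fixed_points[OF k(1) k']])
  have "1 # replicate (n - 1) 1 = replicate n (1::nat)" using n1 by (cases n) auto
  then have 2: "irr_character \<mu> (replicate n 1) = A * of_int (list_fn N (replicate n 1) ?l)"
    using A(2)[OF cycle_with_fixed_points[OF order_refl n1]] by simp
  note ratio = list_fn_cycle_ratio[OF st inj_beta_number[OF mu] k']
  have "complex_of_real (fact n / fact (n - k) * real_of_int (list_fn N (k # replicate (n - k) 1) ?l))
     = of_real (linear_phi k N ?l * real_of_int (list_fn N (replicate n 1) ?l))"
    unfolding ratio(1) ..
  then have 3: "fact n / fact (n - k) * of_int (list_fn N (k # replicate (n - k) 1) ?l)
     = of_real (linear_phi k N ?l) * (of_int (list_fn N (replicate n 1) ?l) :: complex)"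
    by simp
  have fp: "falling_power n k = fact n / fact (n - k)"
    using falling_power_fact[OF k'] by (simp add: field_simps)
  have nz: "(of_int (list_fn N (replicate n 1) ?l) :: complex) \<noteq> 0" using ratio(2) by simp
  have "Ch [k] \<mu> = falling_power n k * irr_character \<mu> (k # replicate (n - k) 1) / irr_character \<mu> (replicate n 1)"
    unfolding Ch_def Let_def n_def[symmetric] using k' by simp
  also have "\<dots> = A * (fact n / fact (n - k) * of_int (list_fn N (k # replicate (n - k) 1) ?l)) /
      (A * of_int (list_fn N (replicate n 1) ?l))"
    unfolding 1 2 fp by (simp only: mult_ac)
  also have "\<dots> = of_real (linear_phi k N ?l)" unfolding 3 using A(1) nz by simp
  finally show ?thesis .
qed

section \<open>The cycle character on the beta-set of a double\<close>

lemma prod_below_beyond: "(\<Prod>b<N. of_nat (N + x) - of_nat b :: complex) * fact x = fact (N + x)"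
proof (induction N)
  case (Suc N)
  have "(\<Prod>b<Suc N. of_nat (Suc N + x) - of_nat b :: complex)
      = of_nat (Suc (N + x)) * (\<Prod>b<N. of_nat (N + x) - of_nat b)"
    by (subst prod.lessThan_Suc_shift) simp
  then show ?case using Suc by (simp add: mult.assoc)
qed simp

lemma prod_below_inside:
  "v < N \<Longrightarrow> (\<Prod>b\<in>{..<N} - {v}. of_nat v - of_nat b :: complex) = (- 1) ^ (N - 1 - v) * fact v * fact (N - 1 - v)"
proof (induction N)
  case (Suc N)
  show ?case
  proof (cases "v = N")
    case True
    have "{..<Suc N} - {N} = {..<N}" by auto
    then show ?thesis using prod_below_beyond[of N 0] True by simp
  next
    case False
    then have v: "v < N" using Suc.prems by simp
    have e: "{..<Suc N} - {v} = insert N ({..<N} - {v})" using v by auto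
    obtain m where m: "N - v = Suc m" "N - 1 - v = m" using v by (cases "N - v") auto
    have d: "(of_nat v - of_nat N :: complex) = - of_nat (Suc m)"
      using m v by (metis less_imp_le_nat minus_diff_eq of_nat_diff)
    have "(\<Prod>b\<in>{..<Suc N} - {v}. of_nat v - of_nat b :: complex)
        = (of_nat v - of_nat N) * ((- 1) ^ m * fact v * fact m)"
      unfolding e using Suc.IH[OF v] m by simp
    then show ?thesis unfolding d using m by (simp add: algebra_simps)
  qed
qed simp

text \<open>The sum \<open>linear_phi\<close> as a function of the set of beta-numbers, with complex values.\<close>

definition beta_phi :: "nat \<Rightarrow> nat set \<Rightarrow> complex" where
  "beta_phi k L = (\<Sum>a | a \<in> L \<and> k \<le> a. fact a / fact (a - k) *
     (\<Prod>b\<in>L-{a}. (of_nat (a - k) - of_nat b) / (of_nat a - of_nat b)))"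

text \<open>The beta-numbers of the double of a strict partition with set of parts \<open>Z\<close>. They are symmetric about
\<open>N\<close> up to complements: \<open>N + x\<close> is present if and only if \<open>N - x\<close> is absent.\<close>

definition doubled_set :: "nat \<Rightarrow> nat set \<Rightarrow> nat set" where
  "doubled_set N Z = (\<lambda>x. N + x) ` Z \<union> ({..<N} - (\<lambda>x. N - x) ` Z)"

locale beta_set_of_double =
  fixes k N :: nat and Z :: "nat set"
  assumes k: "odd k" and Z0: "0 \<notin> Z" and ZN: "\<And>z. z \<in> Z \<Longrightarrow> z \<le> N"
begin

abbreviation "L \<equiv> doubled_set N Z"

definition quot :: "nat \<Rightarrow> nat \<Rightarrow> complex" where
  "quot a b = (of_nat (a - k) - of_nat b) / (of_nat a - of_nat b)"

definition summand :: "nat \<Rightarrow> complex" where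
  "summand a = fact a / fact (a - k) * (\<Prod>b\<in>L-{a}. quot a b)"

lemma k0: "0 < k" using k by (cases k) auto

lemma finZ [simp]: "finite Z" using ZN finite_subset[of Z "{..N}"] by auto

lemma reflect_less: "z \<in> Z \<Longrightarrow> N - z < N"
  using Z0 ZN[of z] by (cases z) auto

lemma finL [simp]: "finite L" by (simp add: doubled_set_def)

lemma two_ne_k: "(2 * of_nat x :: complex) \<noteq> of_nat k"
proof
  assume "(2 * of_nat x :: complex) = of_nat k"
  then have "of_nat (2 * x) = (of_nat k :: complex)" by simp
  then have "2 * x = k" by (simp only: of_nat_eq_iff)
  then show False using k by auto
qed

text \<open>A beta-number cannot be lowered to an occupied position.\<close>

lemma summand_zero: "a - k \<in> L \<Longrightarrow> k \<le> a \<Longrightarrow> summand a = 0"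
  using k0 by (auto simp: summand_def quot_def intro!: bexI[of _ "a - k"])

text \<open>The product over the beta-numbers is compared with that over the full interval below \<open>N\<close>. The two
factors that can vanish or have a vanishing denominator, at \<open>a\<close> and at \<open>a - k\<close>, are left out everywhere;
\<open>X\<close> and \<open>Y\<close> are the parts that remain for the added and the missing positions.\<close>

lemma prod_doubled_set:
  assumes a: "a \<in> L" and c: "a - k \<notin> {..<N} - (\<lambda>x. N - x) ` Z"
    and X: "X \<subseteq> Z" "(\<lambda>x. N + x) ` Z - {a} = (\<lambda>x. N + x) ` X"
    and Y: "Y \<subseteq> Z" "(\<lambda>x. N - x) ` Z - {a - k} = (\<lambda>x. N - x) ` Y"
  shows "(\<Prod>b\<in>L-{a}. quot a b) =
    (\<Prod>b\<in>{..<N}-{a}-{a-k}. quot a b) * (\<Prod>b\<in>X. quot a (N + b)) / (\<Prod>b\<in>Y. quot a (N - b))"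
proof -
  let ?A = "(\<lambda>x. N + x) ` Z" and ?B = "(\<lambda>x. N - x) ` Z"
  have BN: "?B \<subseteq> {..<N}" by (auto intro: reflect_less)
  have aB: "a \<notin> ?B" using a BN by (auto simp: doubled_set_def)
  have injY: "inj_on (\<lambda>x. N - x) Y"
  proof (rule inj_onI)
    fix y z assume "y \<in> Y" "z \<in> Y" "N - y = N - z"
    moreover from this have "y \<le> N" "z \<le> N" using Y(1) ZN by blast+
    ultimately show "y = z" by simp
  qed
  have fXY: "finite X" "finite Y" by (rule finite_subset[OF X(1) finZ], rule finite_subset[OF Y(1) finZ])
  have "(\<Prod>b\<in>L-{a}. quot a b) = (\<Prod>b\<in>({..<N} - ?B - {a}) \<union> (?A - {a}). quot a b)"
    by (rule prod.cong) (auto simp: doubled_set_def)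
  also have "\<dots> = (\<Prod>b\<in>{..<N} - ?B - {a}. quot a b) * (\<Prod>b\<in>?A-{a}. quot a b)"
    by (rule prod.union_disjoint) auto
  also have "(\<Prod>b\<in>?A-{a}. quot a b) = (\<Prod>b\<in>X. quot a (N + b))"
    unfolding X(2) by (subst prod.reindex) auto
  also have "(\<Prod>b\<in>{..<N} - ?B - {a}. quot a b) = (\<Prod>b\<in>{..<N}-{a}-{a-k}. quot a b) / (\<Prod>b\<in>Y. quot a (N - b))"
  proof -
    have nz: "(\<Prod>b\<in>?B-{a-k}. quot a b) \<noteq> 0"
      using aB by (subst prod_zero_iff) (auto simp: quot_def)
    have "(\<Prod>b\<in>{..<N}-{a}-{a-k}. quot a b) = (\<Prod>b\<in>({..<N} - ?B - {a}) \<union> (?B-{a-k}). quot a b)"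
      using BN aB c by (intro prod.cong) auto
    also have "\<dots> = (\<Prod>b\<in>{..<N} - ?B - {a}. quot a b) * (\<Prod>b\<in>?B-{a-k}. quot a b)"
      by (rule prod.union_disjoint) auto
    finally have "(\<Prod>b\<in>{..<N} - ?B - {a}. quot a b) = (\<Prod>b\<in>{..<N}-{a}-{a-k}. quot a b) / (\<Prod>b\<in>?B-{a-k}. quot a b)"
      using nz by (simp add: field_simps)
    also have "(\<Prod>b\<in>?B-{a-k}. quot a b) = (\<Prod>b\<in>Y. quot a (N - b))"
      unfolding Y(2) by (subst prod.reindex[OF injY]) simp
    finally show ?thesis .
  qed
  finally show ?thesis by simp
qed

text \<open>The value of the term at \<open>N + x\<close> for a part \<open>x \<ge> k\<close>. The additional factor comes from the pair of \<open>N + x\<close> with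
the missing position \<open>N - x\<close>.\<close>

definition correction :: "nat \<Rightarrow> complex" where
  "correction x = 2 * of_nat x / (2 * of_nat x - of_nat k) * shift_ratio x k (Z - {x})"

lemma correction_eq:
  assumes x: "x \<in> Z" "k \<le> x"
  shows "fact x / fact (x - k) * ((\<Prod>b\<in>Z-{x}. (of_nat (x-k) - of_nat b) / (of_nat x - of_nat b)) *
     (\<Prod>b\<in>Z. (of_nat x + of_nat b) / (of_nat (x-k) + of_nat b))) = correction x"
proof -
  have 1: "(\<Prod>b\<in>Z. (of_nat x + of_nat b) / (of_nat (x-k) + of_nat b) :: complex)
    = 2 * of_nat x / (2 * of_nat x - of_nat k) * (\<Prod>b\<in>Z-{x}. (of_nat x + of_nat b) / (of_nat (x-k) + of_nat b))"
    using x by (subst prod.remove[of _ x]) (auto simp: of_nat_diff)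
  have 2: "(\<Prod>b\<in>Z-{x}. (of_nat (x-k) - of_nat b) / (of_nat x - of_nat b)) *
      (\<Prod>b\<in>Z-{x}. (of_nat x + of_nat b) / (of_nat (x-k) + of_nat b)) =
      (\<Prod>b\<in>Z-{x}. (of_nat (x - k) - of_nat b) * (of_nat x + of_nat b) /
             ((of_nat (x - k) + of_nat b) * (of_nat x - of_nat b)) :: complex)"
    unfolding prod.distrib[symmetric] by (rule prod.cong) (auto simp: mult.commute)
  show ?thesis unfolding correction_def shift_ratio_def 1 2[symmetric] by (simp only: mult_ac)
qed

lemma summand_large_part:
  assumes x: "x \<in> Z" "k \<le> x"
  shows "summand (N + x) = correction x"
proof -
  have c: "N + x - k = N + (x - k)" using x by simp
  have e: "{..<N}-{N+x}-{N+x-k} = {..<N}" using x by auto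
  have nB: "N + (x - k) \<notin> (\<lambda>x. N - x) ` Z"
  proof
    assume "N + (x - k) \<in> (\<lambda>x. N - x) ` Z"
    then obtain z where "z \<in> Z" "N + (x - k) = N - z" by auto
    then show False using reflect_less[of z] by linarith
  qed
  have "(\<Prod>b\<in>L-{N+x}. quot (N+x) b) =
    (\<Prod>b\<in>{..<N}-{N+x}-{N+x-k}. quot (N+x) b) * (\<Prod>b\<in>Z-{x}. quot (N+x) (N + b)) / (\<Prod>b\<in>Z. quot (N+x) (N - b))"
  proof (rule prod_doubled_set)
    show "N + x \<in> L" using x by (simp add: doubled_set_def)
    show "N + x - k \<notin> {..<N} - (\<lambda>x. N - x) ` Z" using x by simp
    show "(\<lambda>x. N + x) ` Z - {N + x} = (\<lambda>x. N + x) ` (Z - {x})" by auto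
    show "(\<lambda>x. N - x) ` Z - {N + x - k} = (\<lambda>x. N - x) ` Z"
      by (simp only: c Diff_insert0[OF nB] Diff_empty)
  qed auto
  also have "(\<Prod>b\<in>{..<N}-{N+x}-{N+x-k}. quot (N+x) b)
      = (fact (N + (x - k)) / fact (x - k)) / (fact (N + x) / fact x)"
    unfolding e quot_def c prod_dividef prod_below_beyond[of N "x - k", symmetric] prod_below_beyond[of N x, symmetric]
    by simp
  also have "(\<Prod>b\<in>Z-{x}. quot (N+x) (N + b)) = (\<Prod>b\<in>Z-{x}. (of_nat (x-k) - of_nat b) / (of_nat x - of_nat b))"
    unfolding quot_def c by simp
  also have "(\<Prod>b\<in>Z. quot (N+x) (N - b)) = inverse (\<Prod>b\<in>Z. (of_nat x + of_nat b) / (of_nat (x-k) + of_nat b))"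
    unfolding prod_inversef[symmetric] comp_def
  proof (rule prod.cong[OF refl])
    fix b assume "b \<in> Z"
    then have "of_nat (N - b) = (of_nat N - of_nat b :: complex)" using ZN by (simp add: of_nat_diff)
    then show "quot (N+x) (N - b) = inverse ((of_nat x + of_nat b) / (of_nat (x-k) + of_nat b))"
      unfolding quot_def c by (simp only: of_nat_add) (simp add: add.commute)
  qed
  finally show ?thesis
    unfolding summand_def c correction_eq[OF x, symmetric] by (simp add: field_simps)
qed

text \<open>The beta-number \<open>N - (x - k)\<close> is lowered to the missing position \<open>N - x\<close>. The sign from the full interval
is negative because \<open>k\<close> is odd, and cancels with that of \<open>a - k - a\<close>.\<close>

lemma summand_below:
  assumes x: "x \<in> Z" "k < x" "x - k \<notin> Z"
  shows "summand (N - (x - k)) = (of_nat x - of_nat k) / of_nat x * correction x"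
proof -
  define a where "a = N - (x - k)"
  have xN: "x \<le> N" by (rule ZN[OF x(1)])
  have c: "a - k = N - x" and aN: "a < N" and cN: "a - k < N" and ca: "a - k \<noteq> a" and ka: "k \<le> a"
    using x xN k0 by (auto simp: a_def)
  have n: "of_nat (N - x) = (of_nat N - of_nat x :: complex)"
      "of_nat (N - (x - k)) = (of_nat N - of_nat (x - k) :: complex)"
    using x xN by (simp_all only: of_nat_diff diff_le_self order_trans[OF diff_le_self xN])
  have r: "N - 1 - a = x - k - 1" "N - 1 - (a - k) = x - 1" using x xN by (auto simp: a_def)
  have aL: "a \<in> L"
  proof -
    have "a \<notin> (\<lambda>x. N - x) ` Z"
    proof
      assume "a \<in> (\<lambda>x. N - x) ` Z"
      then obtain z where z: "z \<in> Z" "N - (x - k) = N - z" by (auto simp: a_def)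
      then have "z = x - k" using ZN[OF z(1)] xN by simp
      then show False using z x(3) by simp
    qed
    then show ?thesis using aN by (simp add: doubled_set_def)
  qed
  have "(\<Prod>b\<in>L-{a}. quot a b) =
    (\<Prod>b\<in>{..<N}-{a}-{a-k}. quot a b) * (\<Prod>b\<in>Z. quot a (N + b)) / (\<Prod>b\<in>Z-{x}. quot a (N - b))"
  proof (rule prod_doubled_set[OF aL])
    show "(\<lambda>x. N - x) ` Z - {a - k} = (\<lambda>x. N - x) ` (Z - {x})"
    proof -
      have "N - z = N - x \<longleftrightarrow> z = x" if "z \<in> Z" for z using ZN[OF that] xN by auto
      then show ?thesis unfolding c by auto
    qed
  qed (use x aN c in auto)
  also have "(\<Prod>b\<in>{..<N}-{a}-{a-k}. quot a b) = fact (a - k) / fact a * (fact (x - 1) / fact (x - k - 1))"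
  proof -
    have n: "(\<Prod>b\<in>{..<N}-{a}-{a-k}. of_nat (a-k) - of_nat b :: complex)
        = - ((- 1) ^ (x - 1) * fact (a - k) * fact (x - 1)) / of_nat k"
    proof -
      have "(\<Prod>b\<in>{..<N}-{a-k}. of_nat (a-k) - of_nat b :: complex)
        = (of_nat (a-k) - of_nat a) * (\<Prod>b\<in>{..<N}-{a-k}-{a}. of_nat (a-k) - of_nat b)"
        by (rule prod.remove) (use aN ca in auto)
      moreover have "(of_nat (a-k) - of_nat a :: complex) = - of_nat k" using ka by (simp add: of_nat_diff)
      moreover have "{..<N}-{a-k}-{a} = {..<N}-{a}-{a-k}" by auto
      ultimately have "(- 1) ^ (x - 1) * fact (a - k) * fact (x - 1)
          = - of_nat k * (\<Prod>b\<in>{..<N}-{a}-{a-k}. of_nat (a-k) - of_nat b :: complex)"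
        using prod_below_inside[OF cN] unfolding r by simp
      then show ?thesis using k0 by (simp add: field_simps)
    qed
    have d: "(\<Prod>b\<in>{..<N}-{a}-{a-k}. of_nat a - of_nat b :: complex)
        = ((- 1) ^ (x - k - 1) * fact a * fact (x - k - 1)) / of_nat k"
    proof -
      have "(\<Prod>b\<in>{..<N}-{a}. of_nat a - of_nat b :: complex)
        = (of_nat a - of_nat (a-k)) * (\<Prod>b\<in>{..<N}-{a}-{a-k}. of_nat a - of_nat b)"
        by (rule prod.remove) (use cN ca in auto)
      moreover have "(of_nat a - of_nat (a-k) :: complex) = of_nat k" using ka by (simp add: of_nat_diff)
      ultimately have "(- 1) ^ (x - k - 1) * fact a * fact (x - k - 1)
          = of_nat k * (\<Prod>b\<in>{..<N}-{a}-{a-k}. of_nat a - of_nat b :: complex)"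
        using prod_below_inside[OF aN] unfolding r by simp
      then show ?thesis using k0 by (simp add: field_simps)
    qed
    have s: "(- 1 :: complex) ^ (x - 1) = - ((- 1) ^ (x - k - 1))"
    proof -
      have "x - 1 = (x - k - 1) + k" using x by simp
      then have "(- 1 :: complex) ^ (x - 1) = (- 1) ^ (x - k - 1) * (- 1) ^ k" by (simp only: power_add)
      then show ?thesis using k by simp
    qed
    have nz: "(- 1 :: complex) ^ (x - k - 1) \<noteq> 0" by simp
    show ?thesis unfolding quot_def prod_dividef n d s using k0 nz by (simp add: field_simps)
  qed
  also have "(\<Prod>b\<in>Z. quot a (N + b)) = (\<Prod>b\<in>Z. (of_nat x + of_nat b) / (of_nat (x-k) + of_nat b))"
  proof (rule prod.cong[OF refl])
    fix b assume b: "b \<in> Z"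
    have "quot a (N + b) = (- (of_nat x + of_nat b)) / (- (of_nat (x-k) + of_nat b))"
      unfolding quot_def c unfolding a_def n of_nat_add
      by (rule arg_cong2[of _ _ _ _ "(/)"]) simp_all
    then show "quot a (N + b) = (of_nat x + of_nat b) / (of_nat (x-k) + of_nat b)" by (simp only: minus_divide_divide)
  qed
  also have "(\<Prod>b\<in>Z-{x}. quot a (N - b)) = inverse (\<Prod>b\<in>Z-{x}. (of_nat (x-k) - of_nat b) / (of_nat x - of_nat b))"
    unfolding prod_inversef[symmetric] comp_def
  proof (rule prod.cong[OF refl])
    fix b assume b: "b \<in> Z - {x}"
    have nb: "of_nat (N - b) = (of_nat N - of_nat b :: complex)" using b ZN by (intro of_nat_diff) auto
    have "quot a (N - b) = (- (of_nat x - of_nat b)) / (- (of_nat (x-k) - of_nat b))"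
      unfolding quot_def c unfolding a_def n nb
      by (rule arg_cong2[of _ _ _ _ "(/)"]) simp_all
    then show "quot a (N - b) = inverse ((of_nat (x-k) - of_nat b) / (of_nat x - of_nat b))"
      by (simp only: minus_divide_divide inverse_divide)
  qed
  finally have "summand a = fact (x - 1) / fact (x - k - 1) *
     ((\<Prod>b\<in>Z-{x}. (of_nat (x-k) - of_nat b) / (of_nat x - of_nat b)) *
     (\<Prod>b\<in>Z. (of_nat x + of_nat b) / (of_nat (x-k) + of_nat b)))"
    unfolding summand_def by (simp add: field_simps)
  also have "fact (x - 1) / fact (x - k - 1) = (of_nat x - of_nat k) / of_nat x * (fact x / fact (x - k) :: complex)"
  proof -
    obtain m where m: "x - k = Suc m" using x by (cases "x - k") auto
    obtain m' where m': "x = Suc m'" using x by (cases x) auto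
    have d: "(of_nat x - of_nat k :: complex) = of_nat (Suc m)" using m x by (metis less_imp_le_nat of_nat_diff)
    have f: "(fact x :: complex) = of_nat x * fact (x - 1)" "(fact (x - k) :: complex) = of_nat (Suc m) * fact (x - k - 1)"
      using m m' by (metis diff_Suc_1 fact_Suc)+
    have nz: "(of_nat x :: complex) \<noteq> 0" "(of_nat (Suc m) :: complex) \<noteq> 0" using m' by (simp_all del: of_nat_Suc)
    show ?thesis unfolding d f using nz by (simp del: of_nat_Suc)
  qed
  finally show ?thesis unfolding a_def mult.assoc correction_eq[OF x(1) less_imp_le[OF x(2)]] .
qed

text \<open>The beta-number \<open>N + x\<close> is lowered to the missing position \<open>N - w\<close>.\<close>

lemma summand_small_part:
  assumes x: "x \<in> Z" and w: "w \<in> Z" and xw: "x + w = k"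
  shows "summand (N + x) = 4 * of_nat x / (of_nat x - of_nat w) * pair_ratio x w (Z - {x} - {w})"
proof -
  define a where "a = N + x"
  have wN: "w \<le> N" by (rule ZN[OF w])
  have w0: "0 < w" using w Z0 by (cases w) auto
  have ne: "x \<noteq> w" using k xw by auto
  have c: "a - k = N - w" "of_nat (a - k) = (of_nat N - of_nat w :: complex)" "of_nat a = (of_nat N + of_nat x :: complex)"
    using xw wN by (auto simp: a_def of_nat_diff)
  have cN: "a - k < N" using w0 wN c by simp
  have r: "N - 1 - (a - k) = w - 1" using c w0 wN by simp
  have aN: "N \<le> a" by (simp add: a_def)
  have "(\<Prod>b\<in>L-{a}. quot a b) =
    (\<Prod>b\<in>{..<N}-{a}-{a-k}. quot a b) * (\<Prod>b\<in>Z-{x}. quot a (N + b)) / (\<Prod>b\<in>Z-{w}. quot a (N - b))"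
  proof (rule prod_doubled_set)
    show "(\<lambda>x. N - x) ` Z - {a - k} = (\<lambda>x. N - x) ` (Z - {w})"
    proof -
      have "N - z = N - w \<longleftrightarrow> z = w" if "z \<in> Z" for z using ZN[OF that] wN by auto
      then show ?thesis unfolding c by auto
    qed
  qed (use x w aN c in \<open>auto simp: a_def doubled_set_def\<close>)
  also have "(\<Prod>b\<in>{..<N}-{a}-{a-k}. quot a b) = fact (a - k) / fact a * ((- 1) ^ (w - 1) * fact (w - 1) * fact x * of_nat k)"
  proof -
    have e: "{..<N}-{a}-{a-k} = {..<N}-{a-k}" using aN by auto
    have "(\<Prod>b\<in>{..<N}. of_nat a - of_nat b :: complex)
        = (of_nat a - of_nat (a-k)) * (\<Prod>b\<in>{..<N}-{a-k}. of_nat a - of_nat b)"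
      by (rule prod.remove) (use cN in auto)
    moreover have "(of_nat a - of_nat (a-k) :: complex) = of_nat k" using xw c by auto
    ultimately have "fact a = of_nat k * (\<Prod>b\<in>{..<N}-{a-k}. of_nat a - of_nat b :: complex) * fact x"
      using prod_below_beyond[of N x] unfolding a_def[symmetric] by simp
    then have d: "(\<Prod>b\<in>{..<N}-{a-k}. of_nat a - of_nat b :: complex) = fact a / (of_nat k * fact x)"
      using k0 by (simp add: field_simps)
    show ?thesis unfolding e quot_def prod_dividef d prod_below_inside[OF cN] r by (simp add: field_simps)
  qed
  also have "(\<Prod>b\<in>Z-{x}. quot a (N + b)) = - 2 * of_nat w / (of_nat x - of_nat w) *
      (\<Prod>b\<in>Z-{x}-{w}. - (of_nat w + of_nat b) / (of_nat x - of_nat b))"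
  proof -
    have "(\<Prod>b\<in>Z-{x}. quot a (N + b)) = quot a (N + w) * (\<Prod>b\<in>Z-{x}-{w}. quot a (N + b))"
      by (rule prod.remove) (use w ne in auto)
    moreover have "quot a (N + w) = - 2 * of_nat w / (of_nat x - of_nat w)"
      unfolding quot_def c(2,3) by simp
    moreover have "(\<Prod>b\<in>Z-{x}-{w}. quot a (N + b)) = (\<Prod>b\<in>Z-{x}-{w}. - (of_nat w + of_nat b) / (of_nat x - of_nat b))"
      by (rule prod.cong) (simp_all add: quot_def c(2,3))
    ultimately show ?thesis by simp
  qed
  also have "(\<Prod>b\<in>Z-{w}. quot a (N - b)) = (of_nat x - of_nat w) / (2 * of_nat x) *
      inverse (\<Prod>b\<in>Z-{x}-{w}. - (of_nat x + of_nat b) / (of_nat w - of_nat b))"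
  proof -
    have "(\<Prod>b\<in>Z-{w}. quot a (N - b)) = quot a (N - x) * (\<Prod>b\<in>Z-{w}-{x}. quot a (N - b))"
      by (rule prod.remove) (use x ne in auto)
    moreover have "quot a (N - x) = (of_nat x - of_nat w) / (2 * of_nat x)"
      unfolding quot_def c(2,3) of_nat_diff[OF ZN[OF x]] by simp
    moreover have "(\<Prod>b\<in>Z-{w}-{x}. quot a (N - b)) = inverse (\<Prod>b\<in>Z-{x}-{w}. - (of_nat x + of_nat b) / (of_nat w - of_nat b))"
      unfolding prod_inversef[symmetric] comp_def
    proof (rule prod.cong)
      fix b assume b: "b \<in> Z-{x}-{w}"
      have nb: "of_nat (N - b) = (of_nat N - of_nat b :: complex)" using b ZN by (intro of_nat_diff) auto
      have "quot a (N - b) = (- (of_nat w - of_nat b)) / (of_nat x + of_nat b)"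
        unfolding quot_def c(2,3) nb by simp
      then show "quot a (N - b) = inverse (- (of_nat x + of_nat b) / (of_nat w - of_nat b))"
        by (metis inverse_divide minus_divide_left minus_divide_right)
    qed auto
    ultimately show ?thesis by simp
  qed
  finally have pr: "(\<Prod>b\<in>L-{a}. quot a b) =
      fact (a - k) / fact a * ((- 1) ^ (w - 1) * fact (w - 1) * fact x * of_nat k) *
      (- 2 * of_nat w / (of_nat x - of_nat w) *
        (\<Prod>b\<in>Z-{x}-{w}. - (of_nat w + of_nat b) / (of_nat x - of_nat b))) /
      ((of_nat x - of_nat w) / (2 * of_nat x) *
        inverse (\<Prod>b\<in>Z-{x}-{w}. - (of_nat x + of_nat b) / (of_nat w - of_nat b)))" .
  have f: "fact a * (inverse (fact (a - k)) * (fact (a - k) * inverse (fact a))) = (1 :: complex)"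
    by (simp add: mult.assoc[symmetric])
  have cancel: "fact a / fact (a - k) * (fact (a - k) / fact a * K * (X * P) / (Y * inverse Q)) =
      K * (X * inverse Y) * (P * Q)" for K X Y P Q :: complex
    by (simp add: divide_inverse f)
  have "summand a = ((- 1) ^ (w - 1) * fact (w - 1) * fact x * of_nat k) *
     (- 2 * of_nat w / (of_nat x - of_nat w) * (2 * of_nat x / (of_nat x - of_nat w))) *
     ((\<Prod>b\<in>Z-{x}-{w}. - (of_nat w + of_nat b) / (of_nat x - of_nat b)) *
      (\<Prod>b\<in>Z-{x}-{w}. - (of_nat x + of_nat b) / (of_nat w - of_nat b)))"
    unfolding summand_def pr cancel inverse_divide ..
  also have "(\<Prod>b\<in>Z-{x}-{w}. - (of_nat w + of_nat b) / (of_nat x - of_nat b)) *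
      (\<Prod>b\<in>Z-{x}-{w}. - (of_nat x + of_nat b) / (of_nat w - of_nat b)) =
      (\<Prod>b\<in>Z-{x}-{w}. (of_nat x + of_nat b) * (of_nat w + of_nat b) /
             ((of_nat x - of_nat b) * (of_nat w - of_nat b)) :: complex)" (is "_ = ?P")
    unfolding prod.distrib[symmetric] by (rule prod.cong) (simp_all only: times_divide_times_eq minus_mult_minus mult_ac)
  also have "(- 1) ^ (w - 1) * fact (w - 1) * fact x * of_nat k *
     (- 2 * of_nat w / (of_nat x - of_nat w) * (2 * of_nat x / (of_nat x - of_nat w))) * ?P
     = 4 * of_nat x / (of_nat x - of_nat w) * pair_ratio x w (Z - {x} - {w})"
  proof -
    have w1: "w = Suc (w - 1)" using w0 by simp
    have f: "fact w = (of_nat w * fact (w - 1) :: complex)" by (subst (1 2) w1) (simp only: fact_Suc)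
    have s: "(- 1 :: complex) ^ w = - ((- 1) ^ (w - 1))" by (subst (1) w1) simp
    have kk: "(of_nat k :: complex) = of_nat x + of_nat w" using xw by auto
    have "e * F * X * K * (- 2 * W / D * (2 * V / D)) * P = 4 * V / D * (- e * X * (W * F) * K / D * P)"
      for e F X K W D V P :: complex by (simp add: divide_inverse)
    then show ?thesis unfolding pair_ratio_def f s kk .
  qed
  finally show ?thesis by (simp add: a_def)
qed

lemma pair_ratio_sym:
  assumes "x + w = k"
  shows "pair_ratio w x (Z - {w} - {x}) = pair_ratio x w (Z - {x} - {w})"
proof -
  have s: "(- 1 :: complex) ^ x = - ((- 1) ^ w)"
  proof -
    have "(- 1 :: complex) ^ x * (- 1) ^ w = - 1" using k by (simp add: power_add[symmetric] assms)
    moreover have "(- 1 :: complex) ^ w * (- 1) ^ w = 1" by (simp add: power_mult_distrib[symmetric])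
    ultimately show ?thesis by (metis mult.assoc mult.right_neutral mult_minus1)
  qed
  have e: "Z - {w} - {x} = Z - {x} - {w}" by auto
  have m: "(of_nat w - of_nat x :: complex) = - (of_nat x - of_nat w)" by simp
  have p: "(\<Prod>b\<in>Z - {x} - {w}. (of_nat w + of_nat b) * (of_nat x + of_nat b) /
             ((of_nat w - of_nat b) * (of_nat x - of_nat b)) :: complex) =
    (\<Prod>b\<in>Z - {x} - {w}. (of_nat x + of_nat b) * (of_nat w + of_nat b) /
             ((of_nat x - of_nat b) * (of_nat w - of_nat b)))"
    by (rule prod.cong) (auto simp: mult.commute)
  have "- c * F * X * (W + V) / (- D) * P = c * X * F * (V + W) / D * P" for c F X W V D P :: complex
    by (simp add: ac_simps)
  then show ?thesis unfolding pair_ratio_def e p m s .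
qed

text \<open>For a part \<open>x \<ge> k\<close> the terms at \<open>N + x\<close> and \<open>N - (x - k)\<close> have the sum
\<open>(1 + (x - k) / x) * (2 * x / (2 * x - k)) = 2\<close> times the spin term. For a pair of parts with sum \<open>k\<close> the
terms at \<open>N + x\<close> and \<open>N + w\<close> are \<open>4 * x / (x - w)\<close> and \<open>4 * w / (w - x)\<close> times the same spin term, with
the sum 4; the spin side counts the pair twice. All other terms are lowered to occupied positions.\<close>

lemma beta_phi_double: "beta_phi k L = 2 * spin_phi k Z"
proof -
  let ?A = "(\<lambda>x. N + x) ` Z" and ?B = "(\<lambda>x. N - x) ` Z"
  let ?P = "{(x, w). x \<in> Z \<and> w \<in> Z \<and> x + w = k}"
  let ?pr = "\<lambda>x w. pair_ratio x w (Z - {x} - {w})"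
  have BN: "?B \<subseteq> {..<N}" by (auto intro: reflect_less)
  have "beta_phi k L = (\<Sum>a | a \<in> L \<and> k \<le> a. summand a)" by (simp add: beta_phi_def summand_def quot_def)
  also have "\<dots> = (\<Sum>a\<in>{a \<in> ?A. k \<le> a} \<union> {a \<in> {..<N} - ?B. k \<le> a}. summand a)"
    by (rule sum.cong) (auto simp: doubled_set_def)
  also have "\<dots> = (\<Sum>a\<in>{a \<in> ?A. k \<le> a}. summand a) + (\<Sum>a\<in>{a \<in> {..<N} - ?B. k \<le> a}. summand a)"
    by (rule sum.union_disjoint) auto
  also have "(\<Sum>a\<in>{a \<in> ?A. k \<le> a}. summand a) = (\<Sum>x\<in>{x\<in>Z. k \<le> N + x}. summand (N + x))"
    by (rule sum.reindex_bij_witness[of _ "\<lambda>x. N + x" "\<lambda>a. a - N"]) auto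
  also have "\<dots> = (\<Sum>x\<in>{x\<in>Z. k \<le> x} \<union> {x\<in>Z. x < k \<and> k \<le> N + x}. summand (N + x))"
    by (rule sum.cong) auto
  also have "\<dots> = (\<Sum>x\<in>{x\<in>Z. k \<le> x}. summand (N + x)) + (\<Sum>x\<in>{x\<in>Z. x < k \<and> k \<le> N + x}. summand (N + x))"
    by (rule sum.union_disjoint) auto
  also have "(\<Sum>x\<in>{x\<in>Z. k \<le> x}. summand (N + x)) = (\<Sum>x\<in>{x\<in>Z. k \<le> x}. correction x)"
    by (rule sum.cong) (auto simp: summand_large_part)
  also have "(\<Sum>x\<in>{x\<in>Z. x < k \<and> k \<le> N + x}. summand (N + x)) = (\<Sum>x\<in>{x\<in>Z. x < k \<and> k - x \<in> Z}. summand (N + x))"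
  proof (rule sum.mono_neutral_right)
    show "{x \<in> Z. x < k \<and> k - x \<in> Z} \<subseteq> {x \<in> Z. x < k \<and> k \<le> N + x}" using ZN by force
    show "\<forall>x\<in>{x \<in> Z. x < k \<and> k \<le> N + x} - {x \<in> Z. x < k \<and> k - x \<in> Z}. summand (N + x) = 0"
    proof
      fix x assume x: "x \<in> {x \<in> Z. x < k \<and> k \<le> N + x} - {x \<in> Z. x < k \<and> k - x \<in> Z}"
      have "N + x - k \<notin> ?B"
      proof
        assume "N + x - k \<in> ?B"
        then obtain z where z: "z \<in> Z" "N + x - k = N - z" by auto
        then have "z = k - x" using ZN[OF z(1)] x by auto
        then show False using z x by auto
      qed
      then have "N + x - k \<in> L" using x by (auto simp: doubled_set_def)
      then show "summand (N + x) = 0" using x by (intro summand_zero) auto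
    qed
  qed auto
  also have "\<dots> = (\<Sum>(x, w)\<in>?P. summand (N + x))"
    by (rule sum.reindex_bij_witness[of _ fst "\<lambda>x. (x, k - x)"]) (use Z0 in \<open>auto intro!: gr0I\<close>)
  also have "\<dots> = (\<Sum>(x, w)\<in>?P. 4 * of_nat x / (of_nat x - of_nat w) * ?pr x w)"
  proof (rule sum.cong[OF refl])
    fix p assume p: "p \<in> ?P"
    obtain x w where xw: "p = (x, w)" by (cases p)
    have "x \<in> Z" "w \<in> Z" "x + w = k" using p by (simp_all add: xw)
    from summand_small_part[OF this] show "(case p of (x, w) \<Rightarrow> summand (N + x)) =
        (case p of (x, w) \<Rightarrow> 4 * of_nat x / (of_nat x - of_nat w) * ?pr x w)" by (simp add: xw)
  qed
  also have "\<dots> = 2 * (\<Sum>(x, w)\<in>?P. ?pr x w)"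
  proof -
    let ?f = "\<lambda>x w. 4 * of_nat x / (of_nat x - of_nat w) * ?pr x w"
    have sw: "(\<Sum>(x, w)\<in>?P. ?f x w) = (\<Sum>(x, w)\<in>?P. ?f w x)"
      by (rule sum.reindex_bij_witness[of _ prod.swap prod.swap]) (auto simp: add.commute)
    have "2 * (\<Sum>(x, w)\<in>?P. ?f x w) = (\<Sum>(x, w)\<in>?P. ?f x w) + (\<Sum>(x, w)\<in>?P. ?f w x)"
      using sw by simp
    also have "\<dots> = (\<Sum>(x, w)\<in>?P. 4 * ?pr x w)"
      unfolding sum.distrib[symmetric]
    proof (rule sum.cong[OF refl], clarify)
      fix x w assume xw: "x \<in> Z" "w \<in> Z" "k = x + w"
      have "x \<noteq> w" using k xw by auto
      then have ne: "(of_nat x - of_nat w :: complex) \<noteq> 0" by simp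
      have m: "(of_nat w - of_nat x :: complex) = - (of_nat x - of_nat w)" by simp
      have "4 * of_nat x / (of_nat x - of_nat w) + 4 * of_nat w / (of_nat w - of_nat x)
          = 4 * (of_nat x - of_nat w) / (of_nat x - of_nat w :: complex)"
        unfolding m by (simp only: divide_minus_right right_diff_distrib diff_divide_distrib) simp
      then have "4 * of_nat x / (of_nat x - of_nat w) + 4 * of_nat w / (of_nat w - of_nat x) = (4 :: complex)"
        unfolding nonzero_mult_div_cancel_right[OF ne] .
      then show "?f x w + ?f w x = 4 * ?pr x w"
        unfolding pair_ratio_sym[OF xw(3)[symmetric]] distrib_right[symmetric] by simp
    qed
    also have "\<dots> = 2 * (2 * (\<Sum>(x, w)\<in>?P. ?pr x w))" by (simp add: sum_distrib_left split_def)
    finally show ?thesis by simp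
  qed
  also have "(\<Sum>a\<in>{a \<in> {..<N} - ?B. k \<le> a}. summand a) = (\<Sum>x\<in>{x\<in>Z. k \<le> x}. (of_nat x - of_nat k) / of_nat x * correction x)"
  proof -
    let ?S = "{a \<in> {..<N} - ?B. k \<le> a \<and> N - (a - k) \<in> Z}"
    let ?T = "{x \<in> Z. k < x \<and> x - k \<notin> Z}"
    let ?h = "\<lambda>x. (of_nat x - of_nat k) / of_nat x * correction x"
    have "(\<Sum>a\<in>{a \<in> {..<N} - ?B. k \<le> a}. summand a) = (\<Sum>a\<in>?S. summand a)"
    proof (rule sum.mono_neutral_right)
      show "\<forall>a\<in>{a \<in> {..<N} - ?B. k \<le> a} - ?S. summand a = 0"
      proof
        fix a assume a: "a \<in> {a \<in> {..<N} - ?B. k \<le> a} - ?S"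
        have "a - k \<notin> ?B"
        proof
          assume "a - k \<in> ?B"
          then obtain z where z: "z \<in> Z" "a - k = N - z" by auto
          then have "N - (a - k) = z" using ZN[OF z(1)] by simp
          then show False using z a by auto
        qed
        then show "summand a = 0" using a by (intro summand_zero) (auto simp: doubled_set_def)
      qed
    qed auto
    also have "\<dots> = (\<Sum>x\<in>?T. ?h x)"
    proof (rule sum.reindex_bij_witness[of _ "\<lambda>x. N - (x - k)" "\<lambda>a. N - a + k"])
      fix a assume "a \<in> ?S"
      then have a: "a < N" "k \<le> a" "a \<notin> ?B" "N - (a - k) \<in> Z" by auto
      have e: "N - (a - k) = N - a + k" using a by simp
      then have x: "N - a + k \<in> Z" using a(4) by simp
      have na: "N - a \<notin> Z"
      proof
        assume "N - a \<in> Z"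
        then have "N - (N - a) \<in> ?B" by (rule imageI)
        then show False using a(1,3) by simp
      qed
      show "N - ((N - a + k) - k) = a" using a by simp
      show "N - a + k \<in> ?T" using a(1) x na by simp
      have "summand (N - (N - a + k - k)) = ?h (N - a + k)"
        by (rule summand_below) (use a(1) x na in simp_all)
      then show "?h (N - a + k) = summand a" using a(1) by simp
    next
      fix x assume x: "x \<in> ?T"
      then have xN: "x \<le> N" using ZN by simp
      show "N - (N - (x - k)) + k = x" using x xN by simp
      have "N - (x - k) \<notin> ?B"
      proof
        assume "N - (x - k) \<in> ?B"
        then obtain z where z: "z \<in> Z" "N - (x - k) = N - z" by auto
        then have "z = x - k" using ZN[OF z(1)] x xN by auto
        then show False using z x by auto
      qed
      then show "N - (x - k) \<in> ?S" using x xN by auto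
    qed
    also have "\<dots> = (\<Sum>x\<in>{x\<in>Z. k \<le> x}. ?h x)"
    proof (rule sum.mono_neutral_left)
      show "\<forall>x\<in>{x\<in>Z. k \<le> x} - ?T. ?h x = 0"
      proof
        fix x assume x: "x \<in> {x\<in>Z. k \<le> x} - ?T"
        show "?h x = 0"
        proof (cases "x = k")
          case False
          then have "(\<Prod>b\<in>Z-{x}. (of_nat (x - k) - of_nat b) * (of_nat x + of_nat b) /
                 ((of_nat (x - k) + of_nat b) * (of_nat x - of_nat b)) :: complex) = 0"
            using x k0 by (subst prod_zero_iff) (auto intro!: bexI[of _ "x - k"])
          then show ?thesis unfolding correction_def shift_ratio_def by simp
        qed simp
      qed
    qed auto
    finally show ?thesis .
  qed
  also have "(\<Sum>x\<in>{x\<in>Z. k \<le> x}. correction x) + 2 * (\<Sum>(x, w)\<in>?P. ?pr x w) +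
      (\<Sum>x\<in>{x\<in>Z. k \<le> x}. (of_nat x - of_nat k) / of_nat x * correction x)
    = (\<Sum>x\<in>{x\<in>Z. k \<le> x}. correction x + (of_nat x - of_nat k) / of_nat x * correction x) + 2 * (\<Sum>(x, w)\<in>?P. ?pr x w)"
    by (simp only: sum.distrib add_ac)
  also have "(\<Sum>x\<in>{x\<in>Z. k \<le> x}. correction x + (of_nat x - of_nat k) / of_nat x * correction x)
    = (\<Sum>x\<in>{x\<in>Z. k \<le> x}. 2 * shift_ratio x k (Z - {x}))"
  proof (rule sum.cong[OF refl])
    fix x assume "x \<in> {x\<in>Z. k \<le> x}"
    then have x0: "(of_nat x :: complex) \<noteq> 0" using Z0 by (auto intro!: gr0I)
    have x2: "(2 * of_nat x - of_nat k :: complex) \<noteq> 0" using two_ne_k[of x] by simp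
    have "(1 + (of_nat x - of_nat k) / of_nat x) * (2 * of_nat x / (2 * of_nat x - of_nat k)) = (2 :: complex)"
      using x0 x2 by (simp add: divide_simps)
    then have "(1 + (of_nat x - of_nat k) / of_nat x) * (2 * of_nat x / (2 * of_nat x - of_nat k)) * shift_ratio x k (Z - {x})
      = 2 * shift_ratio x k (Z - {x})" by simp
    then show "correction x + (of_nat x - of_nat k) / of_nat x * correction x = 2 * shift_ratio x k (Z - {x})"
      unfolding correction_def by (simp only: distrib_right mult_1 mult.assoc)
  qed
  finally show ?thesis by (simp add: spin_phi_def sum_distrib_left[symmetric] distrib_left)
qed

end

section \<open>The double of a strict partition\<close>

lemma partition_eqI:
  assumes "is_partition \<mu>" "is_partition \<nu>" "diagram \<mu> = diagram \<nu>"
  shows "\<mu> = \<nu>"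
proof -
  have len: "length \<nu> \<le> length \<mu>" if "is_partition \<nu>" "diagram \<nu> \<subseteq> diagram \<mu>" for \<mu> \<nu>
  proof (cases "length \<nu>")
    case (Suc j)
    then have "\<nu> ! j \<in> set \<nu>" by simp
    then have "0 < \<nu> ! j" using that(1) by (simp add: is_partition_def)
    then have "(1, Suc j) \<in> diagram \<nu>" using Suc by (simp add: diagram_def)
    then have "(1, Suc j) \<in> diagram \<mu>" using that(2) by blast
    then show ?thesis using Suc by (simp add: diagram_def)
  qed simp
  have part: "\<nu> ! j \<le> \<mu> ! j" if "diagram \<nu> \<subseteq> diagram \<mu>" "j < length \<nu>" for \<mu> \<nu> j
  proof (cases "\<nu> ! j")
    case (Suc v)
    then have "(Suc v, Suc j) \<in> diagram \<nu>" using that(2) by (simp add: diagram_def)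
    then have "(Suc v, Suc j) \<in> diagram \<mu>" using that(1) by blast
    then show ?thesis using Suc by (simp add: diagram_def)
  qed simp
  have l: "length \<mu> = length \<nu>" using len[of \<mu> \<nu>] len[of \<nu> \<mu>] assms by simp
  show ?thesis
  proof (rule nth_equalityI[OF l])
    fix j assume "j < length \<mu>"
    then show "\<mu> ! j = \<nu> ! j" using part[of \<mu> \<nu> j] part[of \<nu> \<mu> j] assms(3) l by simp
  qed
qed

text \<open>With rows counted from 0: the first rows contain the boxes of the shifted diagram of \<open>\<xi>\<close> and the
transposed ones on and below the diagonal, which are complete there; a later row \<open>j\<close> has one box for every
column of the transposed part that reaches it.\<close>

definition double_parts :: "nat list \<Rightarrow> nat list" where
  "double_parts \<xi> = map (\<lambda>j. if j < length \<xi> then Suc j + \<xi> ! j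
     else card {x. x < length \<xi> \<and> j < x + \<xi> ! x}) [0..<(if \<xi> = [] then 0 else \<xi> ! 0)]"

locale strict_parts =
  fixes \<xi> :: "nat list"
  assumes strict: "sorted_wrt (>) \<xi>" "0 \<notin> set \<xi>"
begin

text \<open>The row \<open>x\<close> of the shifted diagram ends in column \<open>row_end x\<close>, counted from 1, if the diagram starts at the
diagonal. This number decreases weakly with \<open>x\<close>, because the parts decrease strictly.\<close>

definition row_end :: "nat \<Rightarrow> nat" where "row_end x = x + \<xi> ! x"

definition rows_beyond :: "nat \<Rightarrow> nat" where "rows_beyond j = card {x. x < length \<xi> \<and> j < row_end x}"

lemma row_end_antimono: "x \<le> y \<Longrightarrow> y < length \<xi> \<Longrightarrow> row_end y \<le> row_end x"
proof (induction y rule: dec_induct)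
  case (step y)
  have "\<xi> ! Suc y < \<xi> ! y" using strict(1) step.prems by (simp add: sorted_wrt_iff_nth_less)
  then have "row_end (Suc y) \<le> row_end y" by (simp add: row_end_def)
  then show ?case using step by simp
qed simp

lemma part_pos: "x < length \<xi> \<Longrightarrow> 0 < \<xi> ! x"
  using strict(2) by (metis gr0I nth_mem)

lemma row_end_ge: "x < length \<xi> \<Longrightarrow> length \<xi> \<le> row_end x"
proof -
  assume x: "x < length \<xi>"
  then have "row_end (length \<xi> - 1) \<le> row_end x" by (intro row_end_antimono) auto
  moreover have "0 < \<xi> ! (length \<xi> - 1)" using x by (intro part_pos) simp
  then have "length \<xi> \<le> row_end (length \<xi> - 1)" unfolding row_end_def by linarith
  ultimately show ?thesis by simp
qed

text \<open>The rows that extend beyond a given column are the first ones.\<close>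

lemma less_rows_beyond_iff: "x < rows_beyond j \<longleftrightarrow> x < length \<xi> \<and> j < row_end x"
proof -
  define S where "S = {x. x < length \<xi> \<and> j < row_end x}"
  have fin: "finite S" by (simp add: S_def)
  have down: "y \<in> S" if "x \<in> S" "y \<le> x" for x y
    using that row_end_antimono[of y x] by (simp add: S_def)
  have "S = {..<card S}"
  proof (rule sym, rule card_subset_eq[OF fin])
    show "{..<card S} \<subseteq> S"
    proof
      fix y assume y: "y \<in> {..<card S}"
      show "y \<in> S"
      proof (rule ccontr)
        assume "y \<notin> S"
        then have "S \<subseteq> {..<y}" using down by (meson lessThan_iff not_le_imp_less subsetI)
        then have "card S \<le> card {..<y}" by (intro card_mono) auto
        then show False using y by simp
      qed
    qed
  qed simp
  then have "x \<in> S \<longleftrightarrow> x < card S" by (metis lessThan_iff)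
  then show ?thesis by (simp add: S_def rows_beyond_def)
qed

lemma rows_beyond_antimono: "i \<le> j \<Longrightarrow> rows_beyond j \<le> rows_beyond i"
  unfolding rows_beyond_def by (rule card_mono) auto

lemma rows_beyond_le: "rows_beyond j \<le> length \<xi>"
  using less_rows_beyond_iff[of "length \<xi>" j] by simp

definition height :: nat where "height = (if \<xi> = [] then 0 else \<xi> ! 0)"

lemma row_end_le: "x < length \<xi> \<Longrightarrow> row_end x \<le> height"
  using row_end_antimono[of 0 x] by (auto simp: height_def row_end_def)

lemma length_le: "length \<xi> \<le> height"
  using row_end_ge[of 0] row_end_le[of 0] by (cases "length \<xi>") auto

lemma double_parts_eq: "double_parts \<xi> = map (\<lambda>j. if j < length \<xi> then Suc (row_end j) else rows_beyond j) [0..<height]"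
  unfolding double_parts_def height_def rows_beyond_def row_end_def by simp

lemma length_double_parts: "length (double_parts \<xi>) = height"
  by (simp add: double_parts_eq)

lemma nth_double_parts: "j < height \<Longrightarrow> double_parts \<xi> ! j = (if j < length \<xi> then Suc (row_end j) else rows_beyond j)"
  by (simp add: double_parts_eq)

lemma double_parts_pos: "j < height \<Longrightarrow> 0 < double_parts \<xi> ! j"
proof -
  assume j: "j < height"
  then have "\<xi> \<noteq> []" by (auto simp: height_def)
  then have "0 < length \<xi> \<and> j < row_end 0" using j by (simp add: height_def row_end_def)
  then have "0 < rows_beyond j" by (simp only: less_rows_beyond_iff)
  then show ?thesis using j by (simp add: nth_double_parts)
qed

lemma is_partition_double_parts: "is_partition (double_parts \<xi>)"
  unfolding is_partition_def
proof
  show "sorted_wrt (\<ge>) (double_parts \<xi>)"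
    unfolding sorted_wrt_iff_nth_less length_double_parts
  proof (intro allI impI)
    fix i j assume ij: "i < j" "j < height"
    consider "j < length \<xi>" | "i < length \<xi>" "\<not> j < length \<xi>" | "\<not> i < length \<xi>" "\<not> j < length \<xi>"
      using ij by linarith
    then show "double_parts \<xi> ! j \<le> double_parts \<xi> ! i"
    proof cases
      case 1
      then show ?thesis using ij row_end_antimono[of i j] by (simp add: nth_double_parts)
    next
      case 2
      then show ?thesis using ij row_end_ge[of i] rows_beyond_le[of j] by (simp add: nth_double_parts)
    next
      case 3
      then show ?thesis using ij rows_beyond_antimono[of i j] by (simp add: nth_double_parts)
    qed
  qed
  show "\<forall>p\<in>set (double_parts \<xi>). 0 < p"
    using double_parts_pos by (auto simp: in_set_conv_nth length_double_parts)
qed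

lemma diagram_double_parts: "diagram (double_parts \<xi>) = double_diagram \<xi>"
proof -
  have "(x, y) \<in> diagram (double_parts \<xi>) \<longleftrightarrow> (x, y) \<in> double_diagram \<xi>" for x y
  proof (cases "x = 0 \<or> y = 0")
    case False
    then obtain i j where ij: "x = Suc i" "y = Suc j" by (metis not0_implies_Suc)
    have L: "(x, y) \<in> diagram (double_parts \<xi>) \<longleftrightarrow> j < height \<and> i < double_parts \<xi> ! j"
      by (auto simp: diagram_def ij length_double_parts)
    have R: "(x, y) \<in> double_diagram \<xi> \<longleftrightarrow> (j < length \<xi> \<and> j < i \<and> i \<le> row_end j) \<or> (i < length \<xi> \<and> i \<le> j \<and> j < row_end i)"
      by (auto simp: double_diagram_def ij row_end_def)
    show ?thesis
    proof (cases "j < length \<xi>")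
      case True
      have "j < row_end i" if "i \<le> j" using row_end_antimono[OF that True] part_pos[OF True] by (simp add: row_end_def)
      moreover have "j < height" using True length_le by simp
      moreover have "j < row_end j" using part_pos[OF True] by (simp add: row_end_def)
      ultimately show ?thesis unfolding L R using True by (auto simp: nth_double_parts)
    next
      case False
      have "i < length \<xi> \<and> i \<le> j \<and> j < row_end i \<longleftrightarrow> j < height \<and> i < rows_beyond j"
        using less_rows_beyond_iff[of i j] row_end_le[of i] False by auto
      then show ?thesis unfolding L R using False by (auto simp: nth_double_parts)
    qed
  qed (auto simp: diagram_def double_diagram_def)
  then show ?thesis by auto
qed

lemma double_eq: "double \<xi> = double_parts \<xi>"
  unfolding double_def
proof (rule the_equality)
  show "is_partition (double_parts \<xi>) \<and> diagram (double_parts \<xi>) = double_diagram \<xi>"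
    using is_partition_double_parts diagram_double_parts by simp
  fix \<mu> assume "is_partition \<mu> \<and> diagram \<mu> = double_diagram \<xi>"
  then show "\<mu> = double_parts \<xi>"
    using is_partition_double_parts diagram_double_parts by (intro partition_eqI) auto
qed

lemma sum_list_le: "sum_list \<xi> \<le> sum_list (double_parts \<xi>)"
proof -
  have "sum_list \<xi> = (\<Sum>j<length \<xi>. \<xi> ! j)" by (simp add: sum_list_sum_nth atLeast0LessThan)
  also have "\<dots> \<le> (\<Sum>j<length \<xi>. double_parts \<xi> ! j)"
    using length_le by (intro sum_mono) (auto simp: nth_double_parts row_end_def)
  also have "\<dots> \<le> (\<Sum>j<height. double_parts \<xi> ! j)"
    using length_le by (intro sum_mono2) auto
  also have "\<dots> = sum_list (double_parts \<xi>)"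
    by (simp add: sum_list_sum_nth atLeast0LessThan length_double_parts)
  finally show ?thesis .
qed

text \<open>Row \<open>i\<close> with \<open>i < length \<xi>\<close> has the beta-number \<open>N + \<xi> ! i\<close>. The later rows have beta-numbers below \<open>N\<close>
that avoid the positions \<open>N - z\<close>; as both sets have \<open>N\<close> elements, nothing else is missing.\<close>

lemma beta_numbers_double:
  assumes N: "sum_list (double_parts \<xi>) \<le> N"
  shows "beta_number N (double_parts \<xi>) ` {..<N} = doubled_set N (set \<xi>)"
proof (rule card_subset_eq)
  let ?l = "beta_number N (double_parts \<xi>)"
  have ZN: "0 < z \<and> z \<le> N" if "z \<in> set \<xi>" for z
    using member_le_sum_list[OF that] sum_list_le N strict(2) that by (auto intro: gr0I)
  show "finite (doubled_set N (set \<xi>))" by (simp add: doubled_set_def)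
  show "?l ` {..<N} \<subseteq> doubled_set N (set \<xi>)"
  proof
    fix v assume "v \<in> ?l ` {..<N}"
    then obtain i where i: "i < N" "v = ?l i" by auto
    show "v \<in> doubled_set N (set \<xi>)"
    proof (cases "i < length \<xi>")
      case True
      then have "v = N + \<xi> ! i"
        using i length_le by (simp add: beta_number_def length_double_parts nth_double_parts row_end_def)
      then show ?thesis using True by (auto simp: doubled_set_def)
    next
      case False
      have "rows_beyond i = 0" if "\<not> i < height" using less_rows_beyond_iff[of 0 i] row_end_le[of 0] that by auto
      then have v: "v = rows_beyond i + (N - 1 - i)"
        using i False by (simp add: beta_number_def length_double_parts nth_double_parts)
      then have "v < N" using rows_beyond_le[of i] False i by simp
      moreover have "v \<noteq> N - z" if z: "z \<in> set \<xi>" for z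
      proof -
        obtain x where x: "x < length \<xi>" "z = \<xi> ! x" using z by (metis in_set_conv_nth)
        show ?thesis
        proof (cases "x < rows_beyond i")
          case True
          then have "i < row_end x" using less_rows_beyond_iff by blast
          then show ?thesis using v True i ZN[OF z] x(2) by (simp add: row_end_def)
        next
          case ge: False
          then have "row_end x \<le> i" using less_rows_beyond_iff[of x i] x by simp
          then show ?thesis using v ge i ZN[OF z] x(2) by (simp add: row_end_def)
        qed
      qed
      ultimately show ?thesis by (auto simp: doubled_set_def)
    qed
  qed
  have "card (?l ` {..<N}) = N" using card_image[OF inj_beta_number[OF is_partition_double_parts]] by simp
  also have "\<dots> = card (doubled_set N (set \<xi>))"
  proof -
    have i: "inj_on (\<lambda>x. N - x) (set \<xi>)"
    proof (rule inj_onI)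
      fix y z assume yz: "y \<in> set \<xi>" "z \<in> set \<xi>" "N - y = N - z"
      then show "y = z" using ZN[OF yz(1)] ZN[OF yz(2)] by linarith
    qed
    have sub: "(\<lambda>x. N - x) ` set \<xi> \<subseteq> {..<N}"
    proof
      fix v assume "v \<in> (\<lambda>x. N - x) ` set \<xi>"
      then obtain z where "z \<in> set \<xi>" "v = N - z" by auto
      then show "v \<in> {..<N}" using ZN[of z] by simp
    qed
    have "card (doubled_set N (set \<xi>)) = card ((\<lambda>x. N + x) ` set \<xi>) + card ({..<N} - (\<lambda>x. N - x) ` set \<xi>)"
      unfolding doubled_set_def by (rule card_Un_disjoint) auto
    also have "card ({..<N} - (\<lambda>x. N - x) ` set \<xi>) = N - card (set \<xi>)"
      using sub card_image[OF i] by (subst card_Diff_subset) auto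
    also have "card ((\<lambda>x. N + x) ` set \<xi>) = card (set \<xi>)" by (rule card_image) simp
    also have "card (set \<xi>) + (N - card (set \<xi>)) = N"
      using card_mono[OF _ sub] card_image[OF i] by simp
    finally show ?thesis by simp
  qed
  finally show "card (?l ` {..<N}) = card (doubled_set N (set \<xi>))" .
qed

end

lemma linear_phi_eq_beta_phi:
  assumes inj: "inj_on l {..<N}"
  shows "of_real (linear_phi k N l) = beta_phi k (l ` {..<N})"
proof -
  have S: "{a. a \<in> l ` {..<N} \<and> k \<le> a} = l ` {i. i < N \<and> k \<le> l i}" by auto
  have "beta_phi k (l ` {..<N}) = (\<Sum>i | i < N \<and> k \<le> l i. fact (l i) / fact (l i - k) *
     (\<Prod>b\<in>l ` {..<N} - {l i}. (of_nat (l i - k) - of_nat b) / (of_nat (l i) - of_nat b)))"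
    unfolding beta_phi_def S by (subst sum.reindex) (use inj in \<open>auto simp: inj_on_def\<close>)
  also have "\<dots> = (\<Sum>i | i < N \<and> k \<le> l i. fact (l i) / fact (l i - k) *
     (\<Prod>j\<in>{..<N}-{i}. (of_nat (l i - k) - of_nat (l j)) / (of_nat (l i) - of_nat (l j))))"
  proof (rule sum.cong[OF refl])
    fix i assume i: "i \<in> {i. i < N \<and> k \<le> l i}"
    have e: "l ` {..<N} - {l i} = l ` ({..<N} - {i})"
      using i by (subst inj_on_image_set_diff[OF inj]) auto
    have "inj_on l ({..<N} - {i})" using inj by (rule inj_on_subset) auto
    then show "fact (l i) / fact (l i - k) *
       (\<Prod>b\<in>l ` {..<N} - {l i}. (of_nat (l i - k) - of_nat b) / (of_nat (l i) - of_nat b)) =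
      fact (l i) / fact (l i - k) *
       (\<Prod>j\<in>{..<N}-{i}. (of_nat (l i - k) - of_nat (l j)) / (of_nat (l i) - of_nat (l j)) :: complex)"
      unfolding e by (simp add: prod.reindex)
  qed
  also have "\<dots> = of_real (linear_phi k N l)" by (simp add: linear_phi_def)
  finally show ?thesis by simp
qed

text \<open>With \<open>N\<close> the size of the double, all the formulas apply as long as \<open>k \<le> N\<close>; otherwise \<open>k\<close> exceeds both sizes
and both sides are 0 by definition.\<close>

theorem theorem1p1:
  fixes k :: nat and \<xi> :: "nat list"
  assumes "k \<ge> 1" and "odd k" and "strict_partition \<xi>"
  shows "Ch [k] (double \<xi>) = 2 * Ch_spin [k] \<xi>"
proof -
  interpret strict_parts \<xi>
    using assms(3) unfolding strict_sorted by unfold_locales auto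
  define N where "N = sum_list (double_parts \<xi>)"
  show ?thesis
  proof (cases "k \<le> N")
    case True
    interpret beta_set_of_double k N "set \<xi>"
    proof
      show "odd k" by (rule assms(2))
      show "0 \<notin> set \<xi>" by (rule strict(2))
      fix z assume "z \<in> set \<xi>"
      then show "z \<le> N" using member_le_sum_list[of z \<xi>] sum_list_le by (simp add: N_def)
    qed
    have "Ch [k] (double \<xi>) = of_real (linear_phi k N (beta_number N (double_parts \<xi>)))"
      unfolding double_eq
      by (rule Ch_formula[OF is_partition_double_parts assms(1)]) (use True in \<open>simp_all add: N_def\<close>)
    also have "\<dots> = beta_phi k (doubled_set N (set \<xi>))"
      unfolding linear_phi_eq_beta_phi[OF inj_beta_number[OF is_partition_double_parts]]
      by (subst beta_numbers_double) (simp_all add: N_def)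
    also have "\<dots> = 2 * spin_phi k (set \<xi>)" by (rule beta_phi_double)
    also have "spin_phi k (set \<xi>) = Ch_spin [k] \<xi>" by (rule Ch_spin_formula[OF assms(2,3), symmetric])
    finally show ?thesis .
  next
    case False
    then have "\<not> k \<le> sum_list (double \<xi>)" "\<not> k \<le> sum_list \<xi>"
      using sum_list_le by (auto simp: N_def double_eq)
    then show ?thesis by (simp add: Ch_def Ch_spin_def)
  qed
qed

end
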